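(* There exists an absolute constant $C_2>0$, and for every $C_0>0$ there exists a constant $C_1>0$ depending only on $C_0$, such that for every $K\ge1$ there is $r_0\in(0,1)$ depending only on $C_0$ and $K$ with the following property. Let $A=(A_1,A_2):B_8\to\mathbb{R}^2$ be a real vector-valued function with $\|A\|_{L^2(B_8)}\le K$, and let $v\in W^{2,2}_{loc}(B_8)$ be a real-valued solution of $$\Delta v+A\cdot\nabla v=0\quad\text{in }B_8$$ such that $|v(z)|\le C_0$ for all $z\in B_8$ and $\|\nabla v\|_{L^2(B_{6/5})}\ge 1$. Then for all $0<r\le r_0$, $$\|v\|_{L^\infty(B_r)}\ \ge\ r^{\,C_1+C_2K^2}.$$
   Context: $B_r$ denotes the open ball of radius $r$ centered at $0$ in $\mathbb{R}^2$. The equation holds almost everywhere. Functions in $W^{2,2}_{loc}$ in two dimensions are identified with their continuous representatives. *)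

theory Defs
  imports "HOL-Analysis.Analysis" "HOL-Probability.Essential_Supremum"
begin

text \<open>
  All integrals are with respect to Lebesgue measure. Functions on a domain \<open>\<Omega>\<close> are total
  functions whose values outside \<open>\<Omega>\<close> are never used.
\<close>

definition partial :: "'n \<Rightarrow> (real^'n \<Rightarrow> real) \<Rightarrow> real^'n \<Rightarrow> real" where
  "partial i f x = frechet_derivative f (at x) (axis i 1)"

primrec Ck :: "nat \<Rightarrow> (real^'n \<Rightarrow> real) \<Rightarrow> bool" where
  "Ck 0 f \<longleftrightarrow> continuous_on UNIV f"
| "Ck (Suc k) f \<longleftrightarrow> (\<forall>x. f differentiable (at x)) \<and> (\<forall>i. Ck k (partial i f))"

definition test_functions :: "(real^'n) set \<Rightarrow> (real^'n \<Rightarrow> real) set" where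
  "test_functions \<Omega> =
     {\<phi>. (\<forall>k. Ck k \<phi>) \<and> compact (closure {x. \<phi> x \<noteq> 0}) \<and> closure {x. \<phi> x \<noteq> 0} \<subseteq> \<Omega>}"

definition L1_loc :: "(real^'n) set \<Rightarrow> (real^'n \<Rightarrow> real) set" where
  "L1_loc \<Omega> = {f. \<forall>S. compact S \<and> S \<subseteq> \<Omega> \<longrightarrow> integrable (lebesgue_on S) f}"

definition L2 :: "(real^'n) set \<Rightarrow> (real^'n \<Rightarrow> 'b::euclidean_space) set" where
  "L2 S = {f. f \<in> borel_measurable (lebesgue_on S) \<and>
              integrable (lebesgue_on S) (\<lambda>x. (norm (f x))\<^sup>2)}"

definition L2_norm :: "(real^'n) set \<Rightarrow> (real^'n \<Rightarrow> 'b::euclidean_space) \<Rightarrow> real" where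
  "L2_norm S f = sqrt (\<integral>x. (norm (f x))\<^sup>2 \<partial>lebesgue_on S)"

definition L2_loc :: "(real^'n) set \<Rightarrow> (real^'n \<Rightarrow> real) set" where
  "L2_loc \<Omega> = {f. \<forall>S. compact S \<and> S \<subseteq> \<Omega> \<longrightarrow> f \<in> L2 S}"

definition Linf_norm :: "(real^'n) set \<Rightarrow> (real^'n \<Rightarrow> real) \<Rightarrow> ereal" where
  "Linf_norm S f = esssup (lebesgue_on S) (\<lambda>x. ereal \<bar>f x\<bar>)"

definition has_weak_partial ::
  "(real^'n) set \<Rightarrow> 'n \<Rightarrow> (real^'n \<Rightarrow> real) \<Rightarrow> (real^'n \<Rightarrow> real) \<Rightarrow> bool" where
  "has_weak_partial \<Omega> i f g \<longleftrightarrow> f \<in> L1_loc \<Omega> \<and> g \<in> L1_loc \<Omega> \<and>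
     (\<forall>\<phi>\<in>test_functions \<Omega>.
        (\<integral>x. f x * partial i \<phi> x \<partial>lebesgue_on \<Omega>) = - (\<integral>x. g x * \<phi> x \<partial>lebesgue_on \<Omega>))"

text \<open>
  On an open set weak derivatives are unique up to null sets; the operators below pick some
  representative and are meaningful only where a weak derivative exists.
\<close>

definition weak_partial ::
  "(real^'n) set \<Rightarrow> 'n \<Rightarrow> (real^'n \<Rightarrow> real) \<Rightarrow> real^'n \<Rightarrow> real" where
  "weak_partial \<Omega> i f = (SOME g. has_weak_partial \<Omega> i f g)"

definition weak_grad :: "(real^'n) set \<Rightarrow> (real^'n \<Rightarrow> real) \<Rightarrow> real^'n \<Rightarrow> real^'n" where
  "weak_grad \<Omega> f x = (\<chi> i. weak_partial \<Omega> i f x)"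

definition weak_laplacian :: "(real^'n) set \<Rightarrow> (real^'n \<Rightarrow> real) \<Rightarrow> real^'n \<Rightarrow> real" where
  "weak_laplacian \<Omega> f x = (\<Sum>i\<in>UNIV. weak_partial \<Omega> i (weak_partial \<Omega> i f) x)"

definition W22_loc :: "(real^'n) set \<Rightarrow> (real^'n \<Rightarrow> real) set" where
  "W22_loc \<Omega> = {f. f \<in> L2_loc \<Omega> \<and>
     (\<exists>g h. (\<forall>i. has_weak_partial \<Omega> i f (g i) \<and> g i \<in> L2_loc \<Omega>) \<and>
            (\<forall>i j. has_weak_partial \<Omega> j (g i) (h i j) \<and> h i j \<in> L2_loc \<Omega>))}"

end

theory Submission
  imports Defs "HOL-Computational_Algebra.Polynomial"
begin

text \<open>
  With \<open>u = \<nabla>v\<close> the equation becomes a first order system: \<open>curl u = 0\<close> and \<open>\<bar>div u\<bar> \<le> \<bar>A\<bar> \<bar>u\<bar>\<close>.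
  Replacing \<open>v\<close> by a mollification, one may assume that \<open>v\<close> is smooth and that
  \<open>(\<Delta>v)\<^sup>2 \<le> b (\<bar>\<nabla>v\<bar>\<^sup>2 + \<epsilon>\<^sup>2)\<close> for a smooth \<open>b \<ge> 0\<close> with \<open>\<integral>b \<le> 2K\<^sup>2\<close> and \<open>\<epsilon>\<close> as small as desired.

  For compactly supported fields \<open>W\<close> the Carleman inequality
  \<open>\<integral>\<Delta>\<phi> \<bar>W\<bar>\<^sup>2 e\<^sup>\<phi> \<le> \<integral>((div W)\<^sup>2 + (curl W)\<^sup>2) e\<^sup>\<phi>\<close> is applied to \<open>W = \<eta>\<nabla>v\<close> and to
  \<open>\<phi> = - 2n log \<bar>x\<bar> + P + \<bar>x\<bar>\<^sup>2\<close>, where \<open>P\<close> is a (regularised) logarithmic potential of a multiple of \<open>b\<close>,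
  so that \<open>\<Delta>\<phi>\<close> absorbs the drift. The total mass of \<open>b\<close> is what produces the \<open>K\<^sup>2\<close> in the exponent:
  \<open>P\<close> is bounded above by a multiple of \<open>K\<^sup>2\<close>, and although it is unbounded below, it is at least a
  negative multiple of \<open>K\<^sup>2\<close> on the four sides of a suitable rectangle surrounding the ball of radius
  \<open>5/4\<close>, because the logarithm is locally integrable in one variable. If \<open>\<integral>\<bar>\<nabla>v\<bar>\<^sup>2 e\<^sup>P\<close> were too small, \<open>v\<close>
  would be almost constant on that boundary, hence (Aleksandrov--Bakelman--Pucci) almost constant inside,
  and Caccioppoli's inequality would contradict the lower bound for \<open>\<nabla>v\<close>. Taking \<open>n\<close> of size
  \<open>C + C K\<^sup>2\<close> makes the outer cutoff term negligible, and Caccioppoli's inequality on \<open>B\<^sub>r\<close> finishes the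
  proof.
\<close>

section \<open>Calculus of smooth functions\<close>

text \<open>In the plane L^2 is critical for the drift: rescaling does not make \<open>A\<close>
  small, and a weight with bounded Laplacian cannot absorb it. So the weight must depend on the
  solution, and the price is a potential that may be very negative. The regularisation \<epsilon>
  lets a quotient stand for the equation. The drift term does not commute with mollification, but
  the least \<open>b\<close> with \<open>(lapl v x)\<^sup>2 \<le> b x * (grad_sq v x +
  \<epsilon>\<^sup>2)\<close> is stable, because its denominator stays away from zero. Quantities
  multiplied by \<epsilon> may be enormous, since \<epsilon> is fixed after \<open>r\<close>,
  \<open>C0\<close> and \<open>K\<close>, and before the mollification radius. The exponent comes
  from comparing three regions. The logarithmic factor of the weight is at least
  \<open>9 powr (- n)\<close> on the rectangle, at most \<open>16 powr (- n)\<close> where the outer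
  cutoff varies, and at most \<open>(4 / r\<^sup>2) powr n\<close> where the inner one varies. The
  gap \<open>(16/9) powr n\<close> has to beat an exponential of \<open>K\<^sup>2\<close>, which
  dictates the size of \<open>n\<close>; the inner factor then becomes the power of the
  radius.\<close>

definition smooth :: "(real^'n \<Rightarrow> real) \<Rightarrow> bool" where
  "smooth f \<longleftrightarrow> (\<forall>k. Ck k f)"

lemma Ck_Suc_imp_Ck: "Ck (Suc k) f \<Longrightarrow> Ck k f"
proof (induction k arbitrary: f)
  case 0
  then show ?case
    by (simp add: continuous_at_imp_continuous_on differentiable_imp_continuous_within)
qed auto

lemma partial_eqI: "(f has_derivative f') (at x) \<Longrightarrow> partial i f x = f' (axis i 1)"
  by (simp add: partial_def frechet_derivative_at[symmetric])

lemma Ck_imp_continuous: "Ck k f \<Longrightarrow> continuous_on UNIV f"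
proof (induction k)
  case (Suc k)
  then show ?case using Ck_Suc_imp_Ck by blast
qed simp

lemma smooth_imp_continuous_on: "smooth f \<Longrightarrow> continuous_on S f"
  by (meson Ck_imp_continuous continuous_on_subset smooth_def subset_UNIV)

lemma smooth_imp_isCont: "smooth f \<Longrightarrow> isCont f x"
  using continuous_on_eq_continuous_at open_UNIV smooth_imp_continuous_on by blast

lemma smooth_partial [intro]: "smooth f \<Longrightarrow> smooth (partial i f)"
  by (metis Ck.simps(2) smooth_def)

lemma smooth_differentiable: "smooth f \<Longrightarrow> f differentiable (at x)"
  by (metis Ck.simps(2) smooth_def)

lemma has_derivative_partial:
  fixes f :: "real^'n \<Rightarrow> real"
  assumes "f differentiable (at x)"
  shows "(f has_derivative (\<lambda>h. \<Sum>i\<in>UNIV. h$i * partial i f x)) (at x)"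
proof -
  have 1: "(f has_derivative frechet_derivative f (at x)) (at x)"
    using assms frechet_derivative_works by blast
  interpret bounded_linear "frechet_derivative f (at x)"
    using 1 has_derivative_bounded_linear by blast
  have "frechet_derivative f (at x) h = (\<Sum>i\<in>UNIV. h$i * partial i f x)" for h
  proof -
    have h: "h = (\<Sum>i\<in>UNIV. h$i *\<^sub>R axis i 1)"
      by (metis (no_types, lifting) basis_expansion scalar_mult_eq_scaleR sum.cong)
    show ?thesis
      by (subst h) (simp add: sum scaleR partial_def)
  qed
  then show ?thesis using 1 by (metis (no_types, lifting) ext)
qed

lemma smooth_has_derivative:
  "smooth f \<Longrightarrow> (f has_derivative (\<lambda>h. \<Sum>i\<in>UNIV. h$i * partial i f x)) (at x)"
  by (simp add: has_derivative_partial smooth_differentiable)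

text \<open>Coinduction for smoothness: a class of differentiable functions closed under
  \<open>partial\<close> contains only smooth functions. It suits families such as convolutions and
  reflections, whose derivatives have the same shape with another kernel.\<close>

lemma smooth_coinduct:
  assumes "P f" and "\<And>f x. P f \<Longrightarrow> f differentiable (at x)" and "\<And>f i. P f \<Longrightarrow> P (partial i f)"
  shows "smooth f"
proof -
  have "\<forall>f. P f \<longrightarrow> Ck k f" for k
  proof (induction k)
    case 0
    then show ?case
      by (auto simp: assms(2) continuous_at_imp_continuous_on differentiable_imp_continuous_within)
  qed (auto simp: assms)
  then show ?thesis using assms(1) by (auto simp: smooth_def)
qed

lemma partial_const [simp]: "partial i (\<lambda>x. c) = (\<lambda>x. 0)"
  by (rule ext) (simp add: partial_eqI[OF has_derivative_const])

lemma smooth_const [simp, intro]: "smooth (\<lambda>x. c)"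
  by (rule smooth_coinduct[where P="\<lambda>f. \<exists>c. f = (\<lambda>x. c)"]) auto

lemma partial_coord [simp]: "partial i (\<lambda>x. x$j) = (\<lambda>x. if i = j then 1 else 0)"
proof
  fix x :: "real^'a"
  have "((\<lambda>x. x$j) has_derivative (\<lambda>h. h$j)) (at x)"
    by (simp add: bounded_linear_imp_has_derivative bounded_linear_vec_nth)
  from partial_eqI[OF this] show "partial i (\<lambda>x. x$j) x = (if i = j then 1 else 0)"
    by (simp add: axis_def)
qed

lemma smooth_coord [simp, intro]: "smooth (\<lambda>x. x$j)"
proof -
  have "Ck k (\<lambda>x. x$j)" for k
    by (cases k) (use smooth_const[unfolded smooth_def] in
      \<open>auto intro!: continuous_intros bounded_linear_imp_differentiable bounded_linear_vec_nth\<close>)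
  then show ?thesis by (simp add: smooth_def)
qed

lemma partial_add:
  assumes "f differentiable (at x)" "g differentiable (at x)"
  shows "partial i (\<lambda>x. f x + g x) x = partial i f x + partial i g x"
  using partial_eqI[OF has_derivative_add[OF assms[THEN has_derivative_partial]]]
  by (simp add: axis_def if_distrib[of "\<lambda>x. x * _"] cong: if_cong)

lemma partial_mult:
  fixes f g :: "real^'n \<Rightarrow> real"
  assumes "f differentiable (at x)" "g differentiable (at x)"
  shows "partial i (\<lambda>x. f x * g x) x = f x * partial i g x + partial i f x * g x"
  using partial_eqI[OF has_derivative_mult[OF assms[THEN has_derivative_partial]]]
  by (simp add: axis_def if_distrib[of "\<lambda>x. x * _"] cong: if_cong)

lemma Ck_add: "Ck k f \<Longrightarrow> Ck k g \<Longrightarrow> Ck k (\<lambda>x. f x + g x)"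
proof (induction k arbitrary: f g)
  case (Suc k)
  then have "partial i (\<lambda>x. f x + g x) = (\<lambda>x. partial i f x + partial i g x)" for i
    by (auto intro!: ext simp: partial_add)
  with Suc show ?case by simp
qed (auto intro: continuous_intros)

lemma Ck_mult: "Ck k f \<Longrightarrow> Ck k g \<Longrightarrow> Ck k (\<lambda>x. f x * g x)"
proof (induction k arbitrary: f g)
  case (Suc k)
  then have "partial i (\<lambda>x. f x * g x) = (\<lambda>x. f x * partial i g x + partial i f x * g x)" for i
    by (auto intro!: ext simp: partial_mult)
  with Suc show ?case
    using Ck_Suc_imp_Ck[OF Suc.prems(1)] Ck_Suc_imp_Ck[OF Suc.prems(2)]
    by (auto intro!: Ck_add Suc.IH)
qed (auto intro: continuous_intros)

lemma smooth_add [intro]: "smooth f \<Longrightarrow> smooth g \<Longrightarrow> smooth (\<lambda>x. f x + g x)"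
  by (simp add: smooth_def Ck_add)

lemma smooth_mult [intro]: "smooth f \<Longrightarrow> smooth g \<Longrightarrow> smooth (\<lambda>x. f x * g x)"
  by (simp add: smooth_def Ck_mult)

lemma smooth_minus [intro]: "smooth f \<Longrightarrow> smooth (\<lambda>x. - f x)"
  using smooth_mult[OF smooth_const[of "-1"]] by simp

lemma smooth_diff [intro]: "smooth f \<Longrightarrow> smooth g \<Longrightarrow> smooth (\<lambda>x. f x - g x)"
  using smooth_add[OF _ smooth_minus, of f g] by simp

lemma smooth_power [intro]: "smooth f \<Longrightarrow> smooth (\<lambda>x. f x ^ n)"
  by (induction n) auto

lemma smooth_sum [intro]: "(\<And>i. i \<in> A \<Longrightarrow> smooth (f i)) \<Longrightarrow> smooth (\<lambda>x. \<Sum>i\<in>A. f i x)"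
  by (induction A rule: infinite_finite_induct) auto

lemma partial_smooth_add:
  "smooth f \<Longrightarrow> smooth g \<Longrightarrow> partial i (\<lambda>x. f x + g x) x = partial i f x + partial i g x"
  by (simp add: partial_add smooth_differentiable)

lemma partial_smooth_mult:
  "smooth f \<Longrightarrow> smooth g \<Longrightarrow> partial i (\<lambda>x. f x * g x) x = f x * partial i g x + partial i f x * g x"
  by (simp add: partial_mult smooth_differentiable)

lemma partial_smooth_minus: "smooth f \<Longrightarrow> partial i (\<lambda>x. - f x) x = - partial i f x"
  using partial_smooth_mult[OF smooth_const[of "-1"], of f i x] by simp

lemma partial_smooth_diff:
  "smooth f \<Longrightarrow> smooth g \<Longrightarrow> partial i (\<lambda>x. f x - g x) x = partial i f x - partial i g x"
  using partial_smooth_add[OF _ smooth_minus, of f g i x] by (simp add: partial_smooth_minus)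

lemma partial_smooth_sum:
  "(\<And>i. i \<in> A \<Longrightarrow> smooth (f i)) \<Longrightarrow> partial j (\<lambda>x. \<Sum>i\<in>A. f i x) x = (\<Sum>i\<in>A. partial j (f i) x)"
  by (induction A rule: infinite_finite_induct) (auto simp: partial_smooth_add smooth_sum)

lemma partial_smooth_power:
  "smooth f \<Longrightarrow> partial i (\<lambda>x. f x ^ n) x = real n * f x ^ (n - 1) * partial i f x"
proof (induction n)
  case (Suc n)
  then show ?case
    using partial_smooth_mult[OF \<open>smooth f\<close> smooth_power[OF \<open>smooth f\<close>], of i n x]
    by (cases n) (auto simp: algebra_simps)
qed simp

lemma partial_compose:
  assumes "smooth f" "(h has_real_derivative h') (at (f x))"
  shows "partial i (\<lambda>x. h (f x)) x = h' * partial i f x"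
  using partial_eqI[OF has_derivative_compose[OF smooth_has_derivative[OF assms(1)]
    assms(2)[unfolded has_field_derivative_def]]]
  by (simp add: axis_def if_distrib[of "\<lambda>x. x * _"] cong: if_cong)

text \<open>The chain rule turns \<open>h\<close> into \<open>h'\<close>, so the induction on the
  order runs over all of \<open>S\<close> at once, a family of one-variable functions closed under
  differentiation. Derivatives are demanded only on \<open>T\<close>, which contains the range of
  \<open>f\<close>; this admits \<open>inverse\<close> on the positive reals.\<close>

lemma smooth_compose:
  assumes "smooth f" and f: "\<And>x. f x \<in> T" and "h \<in> S"
    and S: "\<And>h. h \<in> S \<Longrightarrow> \<exists>h'\<in>S. \<forall>t\<in>T. (h has_real_derivative h' t) (at t)"
  shows "smooth (\<lambda>x. h (f x))"
proof -
  have diff: "(\<lambda>x. h (f x)) differentiable (at x)" if "h \<in> S" for h x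
    using has_derivative_compose[OF smooth_has_derivative[OF assms(1)]] S[OF that] f
    unfolding has_field_derivative_def differentiable_def by blast
  have "\<forall>h\<in>S. Ck k (\<lambda>x. h (f x))" for k
  proof (induction k)
    case 0
    then show ?case
      by (auto intro!: continuous_at_imp_continuous_on differentiable_imp_continuous_within diff)
  next
    case (Suc k)
    show ?case
    proof
      fix h assume h: "h \<in> S"
      then obtain h' where h': "h' \<in> S" "\<forall>t\<in>T. (h has_real_derivative h' t) (at t)"
        using S by blast
      have "partial i (\<lambda>x. h (f x)) = (\<lambda>x. h' (f x) * partial i f x)" for i
        using partial_compose[OF assms(1)] h' f by blast
      moreover have "Ck k (\<lambda>x. h' (f x) * partial i f x)" for i
        using Suc h' smooth_partial[OF assms(1)] by (auto intro!: Ck_mult simp: smooth_def)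
      ultimately show "Ck (Suc k) (\<lambda>x. h (f x))"
        by (simp add: diff h)
    qed
  qed
  then show ?thesis using \<open>h \<in> S\<close> by (simp add: smooth_def)
qed

lemma smooth_exp [intro]: "smooth f \<Longrightarrow> smooth (\<lambda>x. exp (f x))"
  by (rule smooth_compose[where T=UNIV and S="{exp}"]) (auto intro!: derivative_eq_intros)

lemma partial_smooth_exp: "smooth f \<Longrightarrow> partial i (\<lambda>x. exp (f x)) x = exp (f x) * partial i f x"
  by (rule partial_compose) (auto intro!: derivative_eq_intros)

text \<open>Polynomials in 1/t are closed under differentiation: the factor \<open>[:0,0,1:]\<close>
  is the 1/t^2 from the inner derivative.\<close>

lemma has_real_derivative_poly_inverse:
  "t \<noteq> 0 \<Longrightarrow> ((\<lambda>t. poly p (inverse t)) has_real_derivative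
     poly (- pderiv p * [:0,0,1:]) (inverse t)) (at t)"
  by (auto intro!: derivative_eq_intros DERIV_chain2[OF poly_DERIV] simp: field_simps power2_eq_square)

lemma smooth_inverse [intro]:
  assumes "smooth f" "\<And>x. f x > 0"
  shows "smooth (\<lambda>x. inverse (f x))"
proof (rule smooth_compose[where h=inverse and f=f and T="{0<..}" and S="range (\<lambda>p t. poly p (inverse t))"])
  show "inverse \<in> range (\<lambda>(p::real poly) t. poly p (inverse t))"
    by (rule range_eqI[of _ _ "[:0,1:]"]) auto
  show "\<exists>h'\<in>range (\<lambda>(p::real poly) t. poly p (inverse t)). \<forall>t\<in>{0<..}. (h has_real_derivative h' t) (at t)"
    if "h \<in> range (\<lambda>(p::real poly) t. poly p (inverse t))" for h
  proof -
    obtain p where h: "h = (\<lambda>t. poly p (inverse t))" using \<open>h \<in> _\<close> by auto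
    have "\<forall>t\<in>{0<..}. (h has_real_derivative poly (- pderiv p * [:0,0,1:]) (inverse t)) (at t)"
      unfolding h using has_real_derivative_poly_inverse[of _ p] by (metis greaterThan_iff less_irrefl)
    then show ?thesis by (intro bexI[of _ "\<lambda>t. poly (- pderiv p * [:0,0,1:]) (inverse t)"]) blast+
  qed
qed (use assms in auto)

lemma smooth_divide [intro]: "smooth f \<Longrightarrow> smooth g \<Longrightarrow> (\<And>x. g x > 0) \<Longrightarrow> smooth (\<lambda>x. f x / g x)"
  unfolding divide_inverse by (intro smooth_mult smooth_inverse)

lemma partial_smooth_ln:
  "smooth f \<Longrightarrow> f x > 0 \<Longrightarrow> partial i (\<lambda>x. ln (f x)) x = inverse (f x) * partial i f x"
  by (rule partial_compose) (auto intro!: derivative_eq_intros simp: inverse_eq_divide)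

lemma smooth_ln [intro]:
  assumes "smooth f" "\<And>x. f x > 0"
  shows "smooth (\<lambda>x. ln (f x))"
proof -
  have "partial i (\<lambda>x. ln (f x)) = (\<lambda>x. inverse (f x) * partial i f x)" for i
    using partial_smooth_ln assms by blast
  moreover have "smooth (\<lambda>x. inverse (f x) * partial i f x)" for i
    by (intro smooth_mult smooth_inverse smooth_partial assms)
  moreover have "(\<lambda>x. ln (f x)) differentiable (at x)" for x
    using has_derivative_compose[OF smooth_has_derivative[OF assms(1)] DERIV_ln[OF assms(2), unfolded has_field_derivative_def]]
    unfolding differentiable_def by blast
  ultimately have "Ck (Suc k) (\<lambda>x. ln (f x))" for k
    by (simp add: smooth_def)
  then show ?thesis by (meson Ck_Suc_imp_Ck smooth_def)
qed

text \<open>The functions p(1/t) exp(-1/t), extended by zero to t \<le> 0, are closed under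
  differentiation and contain the usual flat function. Indexing by \<open>p\<close> is what makes
  \<open>smooth_compose\<close> applicable.\<close>

definition flat :: "real poly \<Rightarrow> real \<Rightarrow> real" where
  "flat p t = (if t \<le> 0 then 0 else poly p (inverse t) * exp (- inverse t))"

lemma poly_times_exp_minus_tendsto_0: "((\<lambda>s. poly p s * exp (- s)) \<longlongrightarrow> (0::real)) at_top"
proof -
  have "((\<lambda>s. (\<Sum>i\<le>degree p. coeff p i * (s ^ i / exp s))) \<longlongrightarrow> (\<Sum>i\<le>degree p. coeff p i * 0)) at_top"
    by (intro tendsto_intros tendsto_power_div_exp_0)
  then show ?thesis
    by (simp add: poly_altdef sum_distrib_right exp_minus divide_inverse mult.assoc)
qed

lemma has_real_derivative_flat:
  "(flat p has_real_derivative flat ((p - pderiv p) * [:0,0,1:]) t) (at t)"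
proof (cases "t = 0")
  case False
  show ?thesis
  proof (cases "t < 0")
    case True
    have "((\<lambda>t. 0) has_real_derivative 0) (at t)" by simp
    then have "(flat p has_real_derivative 0) (at t)"
      by (rule has_field_derivative_transform_within_open[of _ _ _ "{..<0}"])
         (use True in \<open>auto simp: flat_def\<close>)
    then show ?thesis using True by (simp add: flat_def)
  next
    case neg: False
    have "((\<lambda>t. poly p (inverse t) * exp (- inverse t)) has_real_derivative
       flat ((p - pderiv p) * [:0,0,1:]) t) (at t)"
      using neg False by (auto intro!: derivative_eq_intros DERIV_chain2[OF poly_DERIV] simp: flat_def field_simps power2_eq_square)
    then show ?thesis
      by (rule has_field_derivative_transform_within_open[of _ _ _ "{0<..}"])
         (use neg False in \<open>auto simp: flat_def\<close>)
  qed
next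
  case True
  have "((\<lambda>h. flat p h / h) \<longlongrightarrow> 0) (at_right 0)"
  proof -
    \<comment> \<open>In the variable s = 1/h the difference quotient is s p(s) exp(-s); the factor
      \<open>[:0,1:]\<close> is the division by h.\<close>
    have "((\<lambda>h. poly (p * [:0,1:]) (inverse h) * exp (- inverse h)) \<longlongrightarrow> 0) (at_right (0::real))"
      using filterlim_compose[OF poly_times_exp_minus_tendsto_0[of "p * [:0,1:]"] filterlim_inverse_at_top_right] .
    then show ?thesis
      by (rule Lim_transform_eventually)
         (auto simp: eventually_at_filter flat_def field_simps)
  qed
  moreover have "((\<lambda>h. flat p h / h) \<longlongrightarrow> 0) (at_left 0)"
    by (rule Lim_transform_eventually[OF tendsto_const]) (auto simp: eventually_at_filter flat_def)
  ultimately have "((\<lambda>h. flat p h / h) \<longlongrightarrow> 0) (at 0)"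
    by (simp add: filterlim_split_at)
  then show ?thesis
    using True by (simp add: DERIV_def flat_def)
qed

lemma smooth_flat [intro]: "smooth f \<Longrightarrow> smooth (\<lambda>x. flat p (f x))"
  by (rule smooth_compose[where h="flat p" and f=f and T=UNIV and S="range flat"])
     (use has_real_derivative_flat in blast)+

section \<open>Directional derivatives and symmetry of second partial derivatives\<close>

lemma smooth_has_real_derivative_line:
  fixes f :: "real^'n \<Rightarrow> real"
  assumes "smooth f"
  shows "((\<lambda>s. f (x + s *\<^sub>R h)) has_real_derivative (\<Sum>i\<in>UNIV. h$i * partial i f (x + s *\<^sub>R h))) (at s)"
proof -
  have "((\<lambda>s. x + s *\<^sub>R h) has_derivative (\<lambda>s. s *\<^sub>R h)) (at s)"
    by (auto intro!: derivative_eq_intros)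
  from has_derivative_compose[OF this smooth_has_derivative[OF assms]]
  show ?thesis
    unfolding has_field_derivative_def
    by (rule has_derivative_eq_rhs) (simp add: fun_eq_iff sum_distrib_left sum_distrib_right mult_ac)
qed

lemma smooth_has_real_derivative_axis:
  fixes f :: "real^'n \<Rightarrow> real"
  assumes "smooth f"
  shows "((\<lambda>s. f (x + s *\<^sub>R axis i 1)) has_real_derivative partial i f (x + s *\<^sub>R axis i 1)) (at s)"
  using smooth_has_real_derivative_line[OF assms, of x "axis i 1" s]
  by (simp add: axis_def if_distrib[of "\<lambda>x. x * _"] cong: if_cong)

text \<open>Two mean value theorems in turn: one in direction \<open>i\<close> for the increment in
  direction \<open>j\<close>, then one in direction \<open>j\<close> for
  \<open>partial i f\<close>.\<close>

lemma second_difference_mvt: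
  fixes f :: "real^'n \<Rightarrow> real"
  assumes "smooth f" "h > 0"
  shows "\<exists>s t. 0 < s \<and> s < h \<and> 0 < t \<and> t < h \<and>
    f (x + h *\<^sub>R axis i 1 + h *\<^sub>R axis j 1) - f (x + h *\<^sub>R axis i 1) - f (x + h *\<^sub>R axis j 1) + f x
     = h\<^sup>2 * partial j (partial i f) (x + s *\<^sub>R axis i 1 + t *\<^sub>R axis j 1)"
proof -
  define g where "g s = f ((x + h *\<^sub>R axis j 1) + s *\<^sub>R axis i 1) - f (x + s *\<^sub>R axis i 1)" for s
  have "(g has_real_derivative partial i f ((x + h *\<^sub>R axis j 1) + s *\<^sub>R axis i 1)
     - partial i f (x + s *\<^sub>R axis i 1)) (at s)" for s
    unfolding g_def by (intro derivative_intros smooth_has_real_derivative_axis assms)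
  then obtain s where s: "0 < s" "s < h" "g h - g 0 = (h - 0) * (partial i f ((x + h *\<^sub>R axis j 1) + s *\<^sub>R axis i 1)
     - partial i f (x + s *\<^sub>R axis i 1))"
    using MVT2[OF \<open>h > 0\<close>, of g "\<lambda>s. partial i f ((x + h *\<^sub>R axis j 1) + s *\<^sub>R axis i 1)
     - partial i f (x + s *\<^sub>R axis i 1)"] by blast
  obtain t where t: "0 < t" "t < h" "partial i f ((x + s *\<^sub>R axis i 1) + h *\<^sub>R axis j 1)
     - partial i f ((x + s *\<^sub>R axis i 1) + 0 *\<^sub>R axis j 1) = (h - 0) * partial j (partial i f) ((x + s *\<^sub>R axis i 1) + t *\<^sub>R axis j 1)"
    using MVT2[OF \<open>h > 0\<close>, of "\<lambda>t. partial i f ((x + s *\<^sub>R axis i 1) + t *\<^sub>R axis j 1)"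
      "\<lambda>t. partial j (partial i f) ((x + s *\<^sub>R axis i 1) + t *\<^sub>R axis j 1)"]
      smooth_has_real_derivative_axis[OF smooth_partial[OF assms(1)]] by blast
  have "g h - g 0 = h\<^sup>2 * partial j (partial i f) (x + s *\<^sub>R axis i 1 + t *\<^sub>R axis j 1)"
    using s(3) t(3) by (simp add: algebra_simps power2_eq_square)
  with s t show ?thesis
    by (intro exI[of _ s] exI[of _ t]) (simp add: g_def algebra_simps)
qed

text \<open>The second difference is symmetric in the two directions, so both mixed derivatives are
  limits of the same quotients \<open>Q n\<close>.\<close>

lemma partial_commute:
  fixes f :: "real^'n \<Rightarrow> real"
  assumes "smooth f"
  shows "partial i (partial j f) x = partial j (partial i f) x"
proof -
  define h where "h n = 1 / real (Suc n)" for n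
  have h: "h n > 0" for n by (simp add: h_def)
  have h0: "h \<longlonglongrightarrow> 0" unfolding h_def by (rule LIMSEQ_Suc[OF lim_1_over_n])
  define Q where "Q n = (f (x + h n *\<^sub>R axis i 1 + h n *\<^sub>R axis j 1) - f (x + h n *\<^sub>R axis i 1) - f (x + h n *\<^sub>R axis j 1) + f x)
      / (h n)\<^sup>2" for n
  have lim: "Q \<longlonglongrightarrow> partial b (partial a f) x"
    if Q: "\<And>n. \<exists>s t. 0 < s \<and> s < h n \<and> 0 < t \<and> t < h n \<and>
      Q n = partial b (partial a f) (x + s *\<^sub>R axis a 1 + t *\<^sub>R axis b 1)" for a b
  proof -
    obtain s t where st: "\<And>n. 0 < s n" "\<And>n. s n < h n" "\<And>n. 0 < t n" "\<And>n. t n < h n"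
      "\<And>n. Q n = partial b (partial a f) (x + s n *\<^sub>R axis a 1 + t n *\<^sub>R axis b 1)"
      using Q by metis
    have "s \<longlonglongrightarrow> 0" "t \<longlonglongrightarrow> 0"
      using st(1-4)[THEN less_imp_le]
      by (rule_tac tendsto_sandwich[OF _ _ tendsto_const h0]; simp)+
    then have "(\<lambda>n. x + s n *\<^sub>R axis a 1 + t n *\<^sub>R axis b 1) \<longlonglongrightarrow> x + 0 *\<^sub>R axis a 1 + 0 *\<^sub>R axis b 1"
      by (intro tendsto_intros)
    then have "(\<lambda>n. partial b (partial a f) (x + s n *\<^sub>R axis a 1 + t n *\<^sub>R axis b 1)) \<longlonglongrightarrow> partial b (partial a f) x"
      using isCont_tendsto_compose[OF smooth_imp_isCont[OF smooth_partial[OF smooth_partial[OF assms]]]]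
      by fastforce
    then show ?thesis using st(5) by presburger
  qed
  have "Q \<longlonglongrightarrow> partial j (partial i f) x"
  proof (rule lim)
    show "\<exists>s t. 0 < s \<and> s < h n \<and> 0 < t \<and> t < h n \<and> Q n = partial j (partial i f) (x + s *\<^sub>R axis i 1 + t *\<^sub>R axis j 1)" for n
      unfolding Q_def using second_difference_mvt[OF assms h[of n], of x i j] h[of n]
      by (metis nonzero_mult_div_cancel_left less_irrefl zero_less_power)
  qed
  moreover have "Q \<longlonglongrightarrow> partial i (partial j f) x"
  proof (rule lim)
    show "\<exists>s t. 0 < s \<and> s < h n \<and> 0 < t \<and> t < h n \<and> Q n = partial i (partial j f) (x + s *\<^sub>R axis j 1 + t *\<^sub>R axis i 1)" for n
    proof -
      have "Q n = (f (x + h n *\<^sub>R axis j 1 + h n *\<^sub>R axis i 1) - f (x + h n *\<^sub>R axis j 1) - f (x + h n *\<^sub>R axis i 1) + f x)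
        / (h n)\<^sup>2"
        by (simp add: Q_def algebra_simps)
      then show ?thesis
        using second_difference_mvt[OF assms h[of n], of x j i] h[of n]
        by (metis nonzero_mult_div_cancel_left less_irrefl zero_less_power)
    qed
  qed
  ultimately show ?thesis using LIMSEQ_unique by blast
qed

text \<open>All derivatives fall on the smooth factor \<open>k\<close>, so continuity of
  \<open>g\<close> suffices. This serves the logarithmic potential as well as the mollification of
  \<open>v\<close>.\<close>

lemma convolution_has_derivative:
  fixes g k :: "real^'n \<Rightarrow> real"
  assumes g: "continuous_on (cbox a b) g" and k: "smooth k"
  shows "((\<lambda>x. integral (cbox a b) (\<lambda>t. g t * k (x - t))) has_derivative
     (\<lambda>h. \<Sum>i\<in>UNIV. h$i * integral (cbox a b) (\<lambda>t. g t * partial i k (x - t)))) (at x)"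
proof -
  have cont2: "continuous_on (A \<times> cbox a b) (\<lambda>(x,t). g t * f (x - t))" if "smooth f" for f :: "real^'n \<Rightarrow> real" and A
    unfolding split_beta
    by (intro continuous_intros continuous_on_compose2[OF g] continuous_on_compose2[OF smooth_imp_continuous_on[OF that, of UNIV]]) auto
  have cont1: "continuous_on (cbox a b) (\<lambda>t. g t * f (x - t))" if "smooth f" for f :: "real^'n \<Rightarrow> real" and x
    by (intro continuous_intros g continuous_on_compose2[OF smooth_imp_continuous_on[OF that, of UNIV]]) auto
  define fx where "fx x t = (\<Sum>i\<in>UNIV. (g t * partial i k (x - t)) *\<^sub>R blinfun_inner_right (axis i (1::real)))" for x t :: "real^'n"
  have "((\<lambda>x. integral (cbox a b) (\<lambda>t. g t * k (x - t))) has_derivative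
     integral (cbox a b) (fx x)) (at x within UNIV)"
  proof (rule leibniz_rule)
    show "((\<lambda>x. g t * k (x - t)) has_derivative blinfun_apply (fx x t)) (at x within UNIV)" for x t
    proof -
      have d: "((\<lambda>x. x - t) has_derivative (\<lambda>h. h)) (at x)" by (auto intro!: derivative_eq_intros)
      show ?thesis
        by (rule has_derivative_eq_rhs[OF has_derivative_mult_right[OF has_derivative_compose[OF d smooth_has_derivative[OF k]]]])
          (auto simp: fx_def blinfun.sum_left blinfun.scaleR_left inner_axis' sum_distrib_left algebra_simps)
    qed
    show "(\<lambda>t. g t * k (x - t)) integrable_on cbox a b" for x
      by (intro integrable_continuous cont1 k)
    show "continuous_on (UNIV \<times> cbox a b) (\<lambda>(x, t). fx x t)"
      unfolding fx_def split_beta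
      by (intro continuous_intros cont2[unfolded split_beta] smooth_partial k)
  qed auto
  moreover have "blinfun_apply (integral (cbox a b) (fx x)) h =
      (\<Sum>i\<in>UNIV. h$i * integral (cbox a b) (\<lambda>t. g t * partial i k (x - t)))" for h
  proof -
    have "continuous_on (cbox a b) (fx x)"
      unfolding fx_def by (intro continuous_intros cont1 smooth_partial k)
    then have "blinfun_apply (integral (cbox a b) (fx x)) h = integral (cbox a b) (\<lambda>t. blinfun_apply (fx x t) h)"
      by (intro blinfun_apply_integral integrable_continuous)
    also have "\<dots> = integral (cbox a b) (\<lambda>t. \<Sum>i\<in>UNIV. h$i * (g t * partial i k (x - t)))"
      by (auto intro!: integral_cong simp: fx_def blinfun.sum_left blinfun.scaleR_left inner_axis' mult.commute)
    also have "\<dots> = (\<Sum>i\<in>UNIV. h$i * integral (cbox a b) (\<lambda>t. g t * partial i k (x - t)))"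
      by (subst integral_sum) (auto intro!: integrable_continuous continuous_intros cont1 smooth_partial k)
    finally show ?thesis .
  qed
  ultimately show ?thesis
    by (auto elim!: has_derivative_eq_rhs)
qed

lemma partial_convolution:
  fixes g k :: "real^'n \<Rightarrow> real"
  assumes g: "continuous_on (cbox a b) g" and k: "smooth k"
  shows "partial i (\<lambda>x. integral (cbox a b) (\<lambda>t. g t * k (x - t)))
     = (\<lambda>x. integral (cbox a b) (\<lambda>t. g t * partial i k (x - t)))"
  using partial_eqI[OF convolution_has_derivative[OF assms]]
  by (auto simp: axis_def if_distrib[of "\<lambda>x. x * _"] cong: if_cong)

lemma smooth_convolution:
  fixes g k :: "real^'n \<Rightarrow> real"
  assumes g: "continuous_on (cbox a b) g" and k: "smooth k"
  shows "smooth (\<lambda>x. integral (cbox a b) (\<lambda>t. g t * k (x - t)))"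
proof (rule smooth_coinduct[where P="\<lambda>f. \<exists>k. smooth k \<and> f = (\<lambda>x. integral (cbox a b) (\<lambda>t. g t * k (x - t)))"])
  show "f differentiable (at x)" if "\<exists>k. smooth k \<and> f = (\<lambda>x. integral (cbox a b) (\<lambda>t. g t * k (x - t)))" for f x
    using that convolution_has_derivative[OF g] unfolding differentiable_def by blast
  show "\<exists>k. smooth k \<and> partial i f = (\<lambda>x. integral (cbox a b) (\<lambda>t. g t * k (x - t)))"
    if "\<exists>k. smooth k \<and> f = (\<lambda>x. integral (cbox a b) (\<lambda>t. g t * k (x - t)))" for f i
    using that partial_convolution[OF g] by blast
qed (use k in blast)

lemma integral_cbox_eq_UNIV:
  fixes f :: "'a::euclidean_space \<Rightarrow> real"
  assumes "\<And>x. x \<notin> S \<Longrightarrow> f x = 0"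
  shows "integral S f = integral UNIV f"
proof -
  have "(\<lambda>x. if x \<in> S then f x else 0) = f" using assms by auto
  then show ?thesis using integral_restrict_UNIV[of S f] by simp
qed

text \<open>Translating a compactly supported function does not change its integral; differentiate
  this in the translation parameter.\<close>

lemma integral_partial_eq_0:
  fixes f :: "real^'n \<Rightarrow> real"
  assumes f: "smooth f" and supp: "\<And>x. norm x > c \<Longrightarrow> f x = 0" and "0 < c" "c < d"
  shows "integral (cbox (vec (-d)) (vec d)) (partial i f) = 0"
proof -
  let ?B = "cbox (vec (-d)) (vec d) :: (real^'n) set"
  define G where "G s = integral ?B (\<lambda>x. f (x + s *\<^sub>R axis i 1))" for s
  have in_B: "x \<in> ?B" if "norm x \<le> d" for x
    using order_trans[OF component_le_norm_cart that] by (simp add: mem_box_cart abs_le_iff minus_le_iff)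
  \<comment> \<open>The margin \<open>d - c\<close> is the room in which the support can be
    translated without leaving the box.\<close>
  have G: "G s = integral UNIV f" if "\<bar>s\<bar> < d - c" for s
  proof -
    let ?c = "s *\<^sub>R axis i (1::real) :: real^'n"
    have "G s = integral (cbox (vec (-d) + ?c) (vec d + ?c)) f"
      using integral_shift_cbox_plus[of "vec (-d)" "vec d" f ?c] by (simp add: G_def o_def add.commute)
    also have "\<dots> = integral UNIV f"
    proof (rule integral_cbox_eq_UNIV)
      fix x assume "x \<notin> cbox (vec (-d) + ?c) (vec d + ?c)"
      then have "x - ?c \<notin> ?B" by (auto simp: mem_box_cart algebra_simps)
      then have "norm (x - ?c) > d" using in_B by force
      moreover have "norm (x - ?c) \<le> norm x + norm ?c"
        by (rule norm_triangle_ineq4)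
      ultimately show "f x = 0"
        using that by (intro supp) simp
    qed
    finally show ?thesis .
  qed
  have "(G has_real_derivative integral ?B (\<lambda>x. partial i f (x + 0 *\<^sub>R axis i 1))) (at 0 within UNIV)"
    unfolding G_def
  proof (rule leibniz_rule_field_derivative)
    show "((\<lambda>s. f (t + s *\<^sub>R axis i 1)) has_field_derivative partial i f (t + x *\<^sub>R axis i 1)) (at x within UNIV)" for x t
      using smooth_has_real_derivative_axis[OF f] by blast
    show "(\<lambda>x. f (x + s *\<^sub>R axis i 1)) integrable_on ?B" for s
      by (intro integrable_continuous continuous_on_compose2[OF smooth_imp_continuous_on[OF f, of UNIV]] continuous_intros) auto
    show "continuous_on (UNIV \<times> ?B) (\<lambda>(s, t). partial i f (t + s *\<^sub>R axis i 1))"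
      unfolding split_beta
      by (intro continuous_on_compose2[OF smooth_imp_continuous_on[OF smooth_partial[OF f], of UNIV]] continuous_intros) auto
  qed auto
  moreover have "(G has_real_derivative 0) (at 0)"
    by (rule has_field_derivative_transform_within[where d="d - c" and f="\<lambda>_. integral UNIV f"])
      (use G \<open>c < d\<close> in \<open>auto simp: dist_real_def\<close>)
  ultimately show ?thesis using DERIV_unique by fastforce
qed

section \<open>Cutoffs, Caccioppoli and Carleman inequalities\<close>

definition grad_sq :: "(real^2 \<Rightarrow> real) \<Rightarrow> real^2 \<Rightarrow> real" where
  "grad_sq f x = (partial 1 f x)\<^sup>2 + (partial 2 f x)\<^sup>2"

definition lapl :: "(real^2 \<Rightarrow> real) \<Rightarrow> real^2 \<Rightarrow> real" where
  "lapl f x = partial 1 (partial 1 f) x + partial 2 (partial 2 f) x"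

text \<open>Squares instead of discs carry the integrals: they are boxes, for which differentiation
  under the integral and exchange of iterated integrals are at hand. Cutoffs do the work of the
  discs.\<close>

definition cube :: "real \<Rightarrow> (real^2) set" where
  "cube d = cbox (vec (- d)) (vec d)"

lemma grad_sq_nonneg [simp]: "0 \<le> grad_sq f x"
  by (simp add: grad_sq_def)

lemma smooth_grad_sq [intro]: "smooth f \<Longrightarrow> smooth (grad_sq f)"
  unfolding grad_sq_def by (intro smooth_add smooth_power smooth_partial)

lemma smooth_lapl [intro]: "smooth f \<Longrightarrow> smooth (lapl f)"
  unfolding lapl_def by (intro smooth_add smooth_power smooth_partial)

lemma smooth_partial_app [intro]: "smooth f \<Longrightarrow> smooth (\<lambda>x. partial i f x)"
  using smooth_partial[of f i] by simp

lemma smooth_grad_sq_app [intro]: "smooth f \<Longrightarrow> smooth (\<lambda>x. grad_sq f x)"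
  using smooth_grad_sq[of f] by simp

lemma smooth_lapl_app [intro]: "smooth f \<Longrightarrow> smooth (\<lambda>x. lapl f x)"
  using smooth_lapl[of f] by simp

lemma mem_cube: "x \<in> cube d \<longleftrightarrow> \<bar>x$1\<bar> \<le> d \<and> \<bar>x$2\<bar> \<le> d"
  by (auto simp: cube_def mem_box_cart forall_2 abs_le_iff)

lemma norm_sq_2: "(norm (x::real^2))\<^sup>2 = (x$1)\<^sup>2 + (x$2)\<^sup>2"
  by (simp add: norm_vec_def L2_set_def sum_2)

lemma norm_le_imp_mem_cube: "norm x \<le> d \<Longrightarrow> x \<in> cube d"
  using component_le_norm_cart[of x] by (meson mem_cube order_trans)

lemma content_cube: "0 \<le> d \<Longrightarrow> measure lborel (cube d) = (2 * d)\<^sup>2"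
  by (simp add: cube_def content_cbox_if_cart interval_eq_empty_cart prod_2 power2_eq_square)

lemma smooth_integrable_cbox [intro]: "smooth f \<Longrightarrow> f integrable_on cbox a b"
  by (simp add: integrable_continuous smooth_imp_continuous_on)

lemma smooth_integrable_cube [intro]: "smooth f \<Longrightarrow> f integrable_on cube d"
  unfolding cube_def by blast

lemma smooth_norm_sq [intro]: "smooth (\<lambda>x::real^2. (norm x)\<^sup>2)"
  unfolding norm_sq_2 by (intro smooth_add smooth_power smooth_coord)

lemma partial_norm_sq: "partial i (\<lambda>x::real^2. (norm x)\<^sup>2) x = 2 * x$i"
proof -
  have "((\<lambda>x::real^2. (norm x)\<^sup>2) has_derivative (\<lambda>h. 2 * (x \<bullet> h))) (at x)"
    unfolding power2_norm_eq_inner by (auto intro!: derivative_eq_intros simp: inner_commute)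
  from partial_eqI[OF this, of i] show ?thesis by (simp add: inner_axis)
qed

lemma smooth_divide_const [intro]: "smooth f \<Longrightarrow> smooth (\<lambda>x. f x / c)"
  unfolding divide_inverse by (intro smooth_mult smooth_const)

lemma partial_smooth_divide_const: "smooth f \<Longrightarrow> partial i (\<lambda>x. f x / c) x = partial i f x / c"
  using partial_smooth_mult[OF _ smooth_const, of f i "inverse c" x] by (simp add: divide_inverse)

lemmas smooth_intros = smooth_divide_const smooth_const smooth_coord smooth_add smooth_mult smooth_minus smooth_diff
  smooth_power smooth_exp smooth_partial smooth_partial_app smooth_grad_sq smooth_grad_sq_app
  smooth_lapl smooth_lapl_app smooth_norm_sq

lemmas partial_rules = partial_smooth_divide_const partial_smooth_add partial_smooth_mult partial_smooth_minus
  partial_smooth_diff partial_smooth_power partial_smooth_exp partial_norm_sq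

section \<open>Smooth step and radial cutoffs\<close>

definition step :: "real \<Rightarrow> real" where
  "step t = flat 1 t / (flat 1 t + flat 1 (1 - t))"

lemma flat_1_nonneg: "0 \<le> flat 1 t"
  by (simp add: flat_def)

lemma flat_1_pos_iff: "0 < flat 1 t \<longleftrightarrow> 0 < t"
  by (auto simp: flat_def)

lemma step_denom_pos: "0 < flat 1 t + flat 1 (1 - t)"
  using flat_1_nonneg[of t] flat_1_nonneg[of "1 - t"] flat_1_pos_iff[of t] flat_1_pos_iff[of "1 - t"]
  by linarith

lemma step_nonneg: "0 \<le> step t" and step_le_1: "step t \<le> 1"
  using flat_1_nonneg[of t] flat_1_nonneg[of "1 - t"] step_denom_pos[of t] by (simp_all add: step_def)

lemma step_eq_0: "t \<le> 0 \<Longrightarrow> step t = 0"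
  by (simp add: step_def flat_def)

lemma step_eq_1: "1 \<le> t \<Longrightarrow> step t = 1"
  using step_denom_pos[of t] by (simp add: step_def flat_def)

lemma smooth_step [intro]: "smooth f \<Longrightarrow> smooth (\<lambda>x. step (f x))"
  unfolding step_def by (intro smooth_divide smooth_add smooth_flat smooth_diff smooth_const step_denom_pos)

lemma step_derivative_bounded:
  "\<exists>C>0. \<forall>t. \<exists>D. (step has_real_derivative D) (at t) \<and> \<bar>D\<bar> \<le> C \<and> (t \<le> 0 \<or> 1 \<le> t \<longrightarrow> D = 0)"
proof -
  define q :: "real poly" where "q = (1 - pderiv 1) * [:0,0,1:]"
  have f: "(flat 1 has_real_derivative flat q t) (at t)" for t
    using has_real_derivative_flat[of 1 t] by (simp add: q_def)
  have cont: "continuous_on A (flat p)" for A p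
    using has_real_derivative_flat by (meson DERIV_isCont continuous_at_imp_continuous_on)
  define D where "D t = (flat q t * (flat 1 t + flat 1 (1 - t)) - flat 1 t * (flat q t - flat q (1 - t)))
      / (flat 1 t + flat 1 (1 - t))\<^sup>2" for t
  have D: "(step has_real_derivative D t) (at t)" for t
    unfolding step_def D_def
    using step_denom_pos[of t]
    by (auto intro!: derivative_eq_intros f DERIV_chain2[OF f] simp: power2_eq_square)
  have "continuous_on {0..1} D"
    unfolding D_def using step_denom_pos
    by (intro continuous_intros cont continuous_on_compose2[OF cont[of UNIV]]) (auto simp: less_imp_neq[symmetric])
  then have "bounded (D ` {0..1})"
    by (simp add: compact_continuous_image compact_imp_bounded)
  then obtain C where C: "C > 0" "\<And>t. t \<in> {0..1} \<Longrightarrow> \<bar>D t\<bar> \<le> C"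
    by (auto simp: bounded_pos)
  have 0: "D t = 0" if "t \<le> 0 \<or> 1 \<le> t" for t
    using that by (auto simp: D_def flat_def)
  have "\<bar>D t\<bar> \<le> C" for t
    using C(1) C(2)[of t] 0[of t] by (cases "0 \<le> t \<and> t \<le> 1") auto
  with C(1) 0 D show ?thesis by blast
qed

text \<open>A fixed bound for the derivative of \<open>step\<close>. It enters only absolute
  multiplicative constants, so any choice serves.\<close>

definition step_lip :: real where
  "step_lip = (SOME C. C > 0 \<and> (\<forall>t. \<exists>D. (step has_real_derivative D) (at t) \<and> \<bar>D\<bar> \<le> C \<and> (t \<le> 0 \<or> 1 \<le> t \<longrightarrow> D = 0)))"

lemma step_lip_pos: "step_lip > 0"
  and step_lip: "\<exists>D. (step has_real_derivative D) (at t) \<and> \<bar>D\<bar> \<le> step_lip \<and> (t \<le> 0 \<or> 1 \<le> t \<longrightarrow> D = 0)"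
  using someI_ex[OF step_derivative_bounded] unfolding step_lip_def by auto

text \<open>The transition is expressed in the square of the norm, which keeps the function smooth
  at the origin and makes the gradient of the argument of \<open>step\<close> linear.\<close>

definition cutoff :: "real \<Rightarrow> real \<Rightarrow> real^2 \<Rightarrow> real" where
  "cutoff a b x = step ((b\<^sup>2 - (norm x)\<^sup>2) / (b\<^sup>2 - a\<^sup>2))"

lemma cutoff_nonneg [simp]: "0 \<le> cutoff a b x" and cutoff_le_1 [simp]: "cutoff a b x \<le> 1"
  by (simp_all add: cutoff_def step_nonneg step_le_1)

lemma cutoff_sq_le_1 [simp]: "(cutoff a b x)\<^sup>2 \<le> 1"
  by (simp add: power_le_one)

lemma smooth_cutoff [intro]: "smooth (cutoff a b)"
  unfolding cutoff_def divide_inverse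
  by (intro smooth_step smooth_mult smooth_diff smooth_const smooth_norm_sq)

context
  fixes a b :: real
  assumes ab: "0 \<le> a" "a < b"
begin

lemma cutoff_denom_pos: "0 < b\<^sup>2 - a\<^sup>2"
  using ab by (simp add: power_strict_mono)

lemma cutoff_eq_1: "norm x \<le> a \<Longrightarrow> cutoff a b x = 1"
  unfolding cutoff_def using cutoff_denom_pos by (intro step_eq_1) (simp add: power_mono)

lemma cutoff_eq_0: "b \<le> norm x \<Longrightarrow> cutoff a b x = 0"
  unfolding cutoff_def using cutoff_denom_pos ab
  by (intro step_eq_0) (auto simp: divide_le_0_iff intro: power_mono)

lemma cutoff_gradient:
  shows "grad_sq (cutoff a b) x \<le> (2 * step_lip * b / (b\<^sup>2 - a\<^sup>2))\<^sup>2"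
    and "norm x \<le> a \<or> b \<le> norm x \<Longrightarrow> partial i (cutoff a b) x = 0"
proof -
  let ?t = "(b\<^sup>2 - (norm x)\<^sup>2) / (b\<^sup>2 - a\<^sup>2)"
  obtain D where D: "(step has_real_derivative D) (at ?t)" "\<bar>D\<bar> \<le> step_lip" "?t \<le> 0 \<or> 1 \<le> ?t \<longrightarrow> D = 0"
    using step_lip by blast
  have "partial i (\<lambda>x::real^2. (b\<^sup>2 - (norm x)\<^sup>2) * inverse (b\<^sup>2 - a\<^sup>2)) x = - (2 * x$i / (b\<^sup>2 - a\<^sup>2))" for i
    by (simp add: partial_smooth_mult partial_smooth_diff partial_norm_sq smooth_diff smooth_norm_sq divide_inverse)
  then have p: "partial i (cutoff a b) x = - (D * (2 * x$i / (b\<^sup>2 - a\<^sup>2)))" for i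
    unfolding cutoff_def using D(1)
    by (subst partial_compose[where f="\<lambda>x. (b\<^sup>2 - (norm x)\<^sup>2) / (b\<^sup>2 - a\<^sup>2)"])
      (auto simp: divide_inverse intro!: smooth_mult smooth_diff smooth_norm_sq)
  show 0: "partial i (cutoff a b) x = 0" if "norm x \<le> a \<or> b \<le> norm x" for i
  proof -
    have "?t \<le> 0 \<or> 1 \<le> ?t"
      using that cutoff_denom_pos ab
      by (auto simp: divide_le_0_iff power_mono)
    then show ?thesis using D p by simp
  qed
  show "grad_sq (cutoff a b) x \<le> (2 * step_lip * b / (b\<^sup>2 - a\<^sup>2))\<^sup>2"
  proof (cases "norm x \<le> b")
    case True
    have "grad_sq (cutoff a b) x = (2 * \<bar>D\<bar> * norm x / (b\<^sup>2 - a\<^sup>2))\<^sup>2"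
      by (simp add: grad_sq_def p norm_sq_2 power_mult_distrib power_divide add_divide_distrib[symmetric]) (simp add: algebra_simps)
    also have "\<dots> \<le> (2 * step_lip * b / (b\<^sup>2 - a\<^sup>2))\<^sup>2"
      using D(2) True cutoff_denom_pos step_lip_pos
      by (intro power_mono divide_right_mono mult_mono) auto
    finally show ?thesis .
  qed (simp add: 0 grad_sq_def)
qed

end

lemma integral_cube_le:
  assumes "smooth f" "smooth g" "\<And>x. x \<in> cube d \<Longrightarrow> f x \<le> g x"
  shows "integral (cube d) f \<le> integral (cube d) g"
  using assms by (intro integral_le) auto

text \<open>Testing the equation with \<open>\<eta>\<^sup>2 (v - c)\<close>. The drift term is absorbed because \<open>v - c\<close> is bounded,
  although the drift is only square integrable.\<close>

lemma caccioppoli: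
  fixes v \<eta> b :: "real^2 \<Rightarrow> real"
  assumes v: "smooth v" and \<eta>: "smooth \<eta>" and b: "smooth b" "\<And>x. 0 \<le> b x"
    and eq: "\<And>x. (lapl v x)\<^sup>2 \<le> b x * (grad_sq v x + \<epsilon>\<^sup>2)"
    and supp: "\<And>x. norm x > R \<Longrightarrow> \<eta> x = 0" and R: "0 < R" "R < d"
    and M: "\<And>x. \<eta> x \<noteq> 0 \<Longrightarrow> \<bar>v x - c\<bar> \<le> M"
  shows "integral (cube d) (\<lambda>x. (\<eta> x)\<^sup>2 * grad_sq v x) \<le>
    integral (cube d) (\<lambda>x. 8 * M\<^sup>2 * grad_sq \<eta> x + 2 * M\<^sup>2 * ((\<eta> x)\<^sup>2 * b x) + \<epsilon>\<^sup>2 / 2 * (\<eta> x)\<^sup>2)"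
proof -
  define X where "X i x = (\<eta> x)\<^sup>2 * ((v x - c) * partial i v x)" for i x
  have sX: "smooth (X i)" for i
    unfolding X_def using v \<eta> by (intro smooth_intros)
  have int0: "integral (cube d) (partial i (X i)) = 0" for i
    unfolding cube_def by (rule integral_partial_eq_0[OF sX _ R]) (simp add: X_def supp)
  have div: "partial 1 (X 1) x + partial 2 (X 2) x = (\<eta> x)\<^sup>2 * grad_sq v x
     + 2 * \<eta> x * (v x - c) * (partial 1 \<eta> x * partial 1 v x + partial 2 \<eta> x * partial 2 v x)
     + (\<eta> x)\<^sup>2 * ((v x - c) * lapl v x)" for x
    unfolding X_def using v \<eta>
    by (simp add: partial_rules smooth_intros) (simp add: grad_sq_def lapl_def power2_eq_square algebra_simps)
  \<comment> \<open>Young's inequality spends one quarter of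
    \<open>(\<eta> x)\<^sup>2 * grad_sq v x\<close> on the cutoff term and one quarter on the drift
    term. The remaining half explains the factor 2 in front of the divergence, which integrates to
    zero.\<close>
  have le: "(\<eta> x)\<^sup>2 * grad_sq v x \<le> 2 * (partial 1 (X 1) x + partial 2 (X 2) x)
     + (8 * M\<^sup>2 * grad_sq \<eta> x + 2 * M\<^sup>2 * ((\<eta> x)\<^sup>2 * b x) + \<epsilon>\<^sup>2 / 2 * (\<eta> x)\<^sup>2)" for x
  proof (cases "\<eta> x = 0")
    case True
    then show ?thesis by (simp add: div b)
  next
    case False
    define m where "m = v x - c"
    have m: "m\<^sup>2 \<le> M\<^sup>2" using M[OF False] by (simp add: m_def abs_le_square_iff[symmetric])
    have 1: "- (2 * \<eta> x * m * (partial 1 \<eta> x * partial 1 v x + partial 2 \<eta> x * partial 2 v x))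
      \<le> (\<eta> x)\<^sup>2 * grad_sq v x / 4 + 4 * m\<^sup>2 * grad_sq \<eta> x"
    proof -
      have "0 \<le> (\<eta> x * partial 1 v x / 2 + 2 * m * partial 1 \<eta> x)\<^sup>2 + (\<eta> x * partial 2 v x / 2 + 2 * m * partial 2 \<eta> x)\<^sup>2"
        by simp
      then show ?thesis by (simp add: grad_sq_def power2_eq_square algebra_simps add_divide_distrib)
    qed
    \<comment> \<open>From \<open>p * q \<le> (p + q / 4)\<^sup>2\<close>: the uncontrolled
      \<open>b\<close> is paired with the bounded square of \<open>m\<close>, so only its integral
      will matter.\<close>
    have 2: "- ((\<eta> x)\<^sup>2 * (m * lapl v x)) \<le> (\<eta> x)\<^sup>2 * (m\<^sup>2 * b x + (grad_sq v x + \<epsilon>\<^sup>2) / 4)"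
    proof -
      have "(m * lapl v x)\<^sup>2 \<le> (m\<^sup>2 * b x) * (grad_sq v x + \<epsilon>\<^sup>2)"
        using mult_left_mono[OF eq[of x], of "m\<^sup>2"] by (simp add: power_mult_distrib mult.assoc)
      also have "\<dots> \<le> (m\<^sup>2 * b x + (grad_sq v x + \<epsilon>\<^sup>2) / 4)\<^sup>2"
        using zero_le_power2[of "m\<^sup>2 * b x - (grad_sq v x + \<epsilon>\<^sup>2) / 4"]
        by (simp add: power2_eq_square algebra_simps)
      finally have "\<bar>m * lapl v x\<bar> \<le> m\<^sup>2 * b x + (grad_sq v x + \<epsilon>\<^sup>2) / 4"
        by (rule abs_le_square_iff[THEN iffD2, of "m * lapl v x" "m\<^sup>2 * b x + (grad_sq v x + \<epsilon>\<^sup>2) / 4", THEN order_trans])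
           (simp add: b)
      then have "- (m * lapl v x) \<le> m\<^sup>2 * b x + (grad_sq v x + \<epsilon>\<^sup>2) / 4" by linarith
      from mult_left_mono[OF this, of "(\<eta> x)\<^sup>2"] show ?thesis by simp
    qed
    have 3: "8 * m\<^sup>2 * grad_sq \<eta> x \<le> 8 * M\<^sup>2 * grad_sq \<eta> x"
      using m by (simp add: mult_right_mono)
    have 4: "m\<^sup>2 * ((\<eta> x)\<^sup>2 * b x) \<le> M\<^sup>2 * ((\<eta> x)\<^sup>2 * b x)"
      using m b(2)[of x] by (simp add: mult_right_mono)
    show ?thesis
      using 1 2 3 4 unfolding div m_def[symmetric] by (simp add: algebra_simps add_divide_distrib)
  qed
  have "integral (cube d) (\<lambda>x. (\<eta> x)\<^sup>2 * grad_sq v x) \<le>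
    integral (cube d) (\<lambda>x. 2 * (partial 1 (X 1) x + partial 2 (X 2) x)
     + (8 * M\<^sup>2 * grad_sq \<eta> x + 2 * M\<^sup>2 * ((\<eta> x)\<^sup>2 * b x) + \<epsilon>\<^sup>2 / 2 * (\<eta> x)\<^sup>2))"
    by (intro integral_cube_le le smooth_intros v \<eta> b sX)
  also have "\<dots> = integral (cube d) (\<lambda>x. 2 * (partial 1 (X 1) x + partial 2 (X 2) x))
    + integral (cube d) (\<lambda>x. 8 * M\<^sup>2 * grad_sq \<eta> x + 2 * M\<^sup>2 * ((\<eta> x)\<^sup>2 * b x) + \<epsilon>\<^sup>2 / 2 * (\<eta> x)\<^sup>2)"
    by (intro integral_add smooth_integrable_cube smooth_intros v \<eta> b sX)
  also have "integral (cube d) (\<lambda>x. 2 * (partial 1 (X 1) x + partial 2 (X 2) x)) =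
    2 * (integral (cube d) (partial 1 (X 1)) + integral (cube d) (partial 2 (X 2)))"
    by (subst integral_add[symmetric])
       (auto intro!: smooth_integrable_cube smooth_intros sX simp: integral_mult_right[symmetric] simp del: integral_mult_right)
  finally show ?thesis by (simp add: int0)
qed

text \<open>With F = W1 - i W2 the first bracket is |2 dbar F|^2 and the last one is |exp(-\<phi>) 2
  d(exp(\<phi>) F)|^2, where d and dbar are the Wirtinger derivatives. Up to sign the latter
  operator is the adjoint of 2 dbar in L^2 with weight exp(\<phi>), and the commutator of the two is
  multiplication by the Laplacian of \<phi>. \<open>X1\<close> and \<open>X2\<close> collect the
  boundary terms of the integrations by parts.\<close>

lemma carleman_identity:
  fixes W1 W2 \<phi> :: "real^2 \<Rightarrow> real"
  assumes "smooth W1" "smooth W2" "smooth \<phi>"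
  defines "X1 \<equiv> \<lambda>x. exp (\<phi> x) * (4 * (W1 x * partial 2 W2 x) + 2 * (W1 x * (partial 2 \<phi> x * W2 x)) - partial 1 \<phi> x * ((W1 x)\<^sup>2 + (W2 x)\<^sup>2))"
    and "X2 \<equiv> \<lambda>x. exp (\<phi> x) * (- (4 * (W1 x * partial 1 W2 x) + 2 * (W1 x * (partial 1 \<phi> x * W2 x))) - partial 2 \<phi> x * ((W1 x)\<^sup>2 + (W2 x)\<^sup>2))"
  shows "partial 1 X1 x + partial 2 X2 x =
     ((partial 1 W1 x + partial 2 W2 x)\<^sup>2 + (partial 2 W1 x - partial 1 W2 x)\<^sup>2) * exp (\<phi> x)
     - lapl \<phi> x * ((W1 x)\<^sup>2 + (W2 x)\<^sup>2) * exp (\<phi> x)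
     - ((partial 1 W1 x - partial 2 W2 x + partial 1 \<phi> x * W1 x - partial 2 \<phi> x * W2 x)\<^sup>2
       + (partial 2 W1 x + partial 1 W2 x + partial 2 \<phi> x * W1 x + partial 1 \<phi> x * W2 x)\<^sup>2) * exp (\<phi> x)"
  unfolding X1_def X2_def using assms(1-3)
  by (simp add: partial_rules smooth_intros partial_commute[OF assms(2), of 2 1] partial_commute[OF assms(3), of 2 1])
     (simp add: lapl_def power2_eq_square algebra_simps)

text \<open>The last square in \<open>carleman_identity\<close> has the good sign and is dropped;
  the divergence integrates to zero.\<close>

lemma carleman:
  fixes W1 W2 \<phi> :: "real^2 \<Rightarrow> real"
  assumes s: "smooth W1" "smooth W2" "smooth \<phi>"
    and supp: "\<And>x. norm x > R \<Longrightarrow> W1 x = 0" "\<And>x. norm x > R \<Longrightarrow> W2 x = 0" and R: "0 < R" "R < d"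
  shows "integral (cube d) (\<lambda>x. lapl \<phi> x * ((W1 x)\<^sup>2 + (W2 x)\<^sup>2) * exp (\<phi> x)) \<le>
    integral (cube d) (\<lambda>x. ((partial 1 W1 x + partial 2 W2 x)\<^sup>2 + (partial 2 W1 x - partial 1 W2 x)\<^sup>2) * exp (\<phi> x))"
    (is "integral _ ?L \<le> integral _ ?R")
proof -
  define X1 where "X1 = (\<lambda>x. exp (\<phi> x) * (4 * (W1 x * partial 2 W2 x) + 2 * (W1 x * (partial 2 \<phi> x * W2 x)) - partial 1 \<phi> x * ((W1 x)\<^sup>2 + (W2 x)\<^sup>2)))"
  define X2 where "X2 = (\<lambda>x. exp (\<phi> x) * (- (4 * (W1 x * partial 1 W2 x) + 2 * (W1 x * (partial 1 \<phi> x * W2 x))) - partial 2 \<phi> x * ((W1 x)\<^sup>2 + (W2 x)\<^sup>2)))"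
  have sX: "smooth X1" "smooth X2"
    unfolding X1_def X2_def by (intro smooth_intros s)+
  have int0: "integral (cube d) (partial 1 X1) = 0" "integral (cube d) (partial 2 X2) = 0"
    unfolding cube_def by (rule integral_partial_eq_0[OF _ _ R], rule sX, simp add: X1_def X2_def supp)+
  have sL: "smooth ?L" and sR: "smooth ?R" by (intro smooth_intros s)+
  have "?L x + (partial 1 X1 x + partial 2 X2 x) \<le> ?R x" for x
    unfolding X1_def X2_def carleman_identity[OF s] by simp
  then have "integral (cube d) (\<lambda>x. ?L x + (partial 1 X1 x + partial 2 X2 x)) \<le> integral (cube d) ?R"
    by (intro integral_cube_le smooth_add sL sR smooth_partial_app sX)
  moreover have "integral (cube d) (\<lambda>x. ?L x + (partial 1 X1 x + partial 2 X2 x))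
     = integral (cube d) ?L + (integral (cube d) (partial 1 X1) + integral (cube d) (partial 2 X2))"
    using sL sX by (simp add: integral_add smooth_integrable_cube smooth_partial smooth_add smooth_partial_app)
  ultimately show ?thesis by (simp add: int0)
qed

text \<open>The logarithm of the norm, regularised at scale \<delta>. Its Laplacian
  (\<open>lapl_kern\<close>) is a positive approximate Dirac mass of total integral 2 pi, so that no
  distributions are involved.\<close>

definition kern :: "real \<Rightarrow> real^2 \<Rightarrow> real" where
  "kern \<delta> x = ln ((norm x)\<^sup>2 + \<delta>\<^sup>2) / 2"

context
  fixes \<delta> :: real
  assumes \<delta>: "0 < \<delta>"
begin

lemma kern_arg_pos: "0 < (norm (x::real^2))\<^sup>2 + \<delta>\<^sup>2"
  using \<delta> by (simp add: add_nonneg_pos)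

lemma smooth_kern_arg: "smooth (\<lambda>x::real^2. (norm x)\<^sup>2 + \<delta>\<^sup>2)"
  by (intro smooth_intros)

lemma smooth_kern: "smooth (kern \<delta>)"
  unfolding kern_def by (intro smooth_divide_const smooth_ln smooth_kern_arg kern_arg_pos)

lemma partial_kern: "partial i (kern \<delta>) = (\<lambda>x. x$i * inverse ((norm x)\<^sup>2 + \<delta>\<^sup>2))"
proof
  fix x :: "real^2"
  have "partial i (kern \<delta>) x = inverse ((norm x)\<^sup>2 + \<delta>\<^sup>2) * (2 * x$i) * inverse 2"
    unfolding kern_def
    by (simp add: partial_smooth_divide_const smooth_ln smooth_kern_arg kern_arg_pos partial_smooth_ln
        partial_smooth_add smooth_norm_sq partial_norm_sq)
  then show "partial i (kern \<delta>) x = x$i * inverse ((norm x)\<^sup>2 + \<delta>\<^sup>2)" by simp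
qed

lemma lapl_kern: "lapl (kern \<delta>) x = 2 * \<delta>\<^sup>2 / ((norm x)\<^sup>2 + \<delta>\<^sup>2)\<^sup>2"
proof -
  have inv: "partial i (\<lambda>x::real^2. inverse ((norm x)\<^sup>2 + \<delta>\<^sup>2)) x = - (2 * x$i) / ((norm x)\<^sup>2 + \<delta>\<^sup>2)\<^sup>2" for i
  proof -
    have "partial i (\<lambda>x::real^2. (norm x)\<^sup>2 + \<delta>\<^sup>2) x = 2 * x$i"
      by (simp add: partial_smooth_add smooth_norm_sq partial_norm_sq)
    moreover have "(inverse has_real_derivative - inverse (((norm x)\<^sup>2 + \<delta>\<^sup>2)\<^sup>2)) (at ((norm x)\<^sup>2 + \<delta>\<^sup>2))"
      using kern_arg_pos[of x] by (auto intro!: derivative_eq_intros simp: power2_eq_square)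
    ultimately show ?thesis
      using partial_compose[OF smooth_kern_arg, of inverse _ x i] by (simp add: divide_inverse)
  qed
  have "partial i (partial i (kern \<delta>)) x = x$i * (- (2 * x$i) / ((norm x)\<^sup>2 + \<delta>\<^sup>2)\<^sup>2) + inverse ((norm x)\<^sup>2 + \<delta>\<^sup>2)" for i
    unfolding partial_kern
    by (simp add: partial_smooth_mult smooth_inverse smooth_kern_arg kern_arg_pos inv)
  then have "lapl (kern \<delta>) x = - 2 * (norm x)\<^sup>2 / ((norm x)\<^sup>2 + \<delta>\<^sup>2)\<^sup>2 + 2 * inverse ((norm x)\<^sup>2 + \<delta>\<^sup>2)"
    unfolding lapl_def norm_sq_2[of x] by (simp only:) (simp add: power2_eq_square diff_divide_distrib mult.left_commute)
  also have "2 * inverse ((norm x)\<^sup>2 + \<delta>\<^sup>2) = 2 * ((norm x)\<^sup>2 + \<delta>\<^sup>2) / ((norm x)\<^sup>2 + \<delta>\<^sup>2)\<^sup>2"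
  proof -
    have "2 * inverse s = 2 * s / s\<^sup>2" if "s > 0" for s :: real
      using that by (simp add: power2_eq_square inverse_eq_divide)
    then show ?thesis using kern_arg_pos[of x] by blast
  qed
  finally show ?thesis by (simp add: add_divide_distrib distrib_left)
qed

end

text \<open>The factor 4 is generous: as \<delta> tends to 0 the Laplacian approaches 8 pi
  \<open>b\<close> inside the square, while only \<open>2 * b\<close> is wanted. The slack pays for
  a crude lower bound of the kernel.\<close>

definition potential :: "(real^2 \<Rightarrow> real) \<Rightarrow> real \<Rightarrow> real^2 \<Rightarrow> real" where
  "potential b \<delta> x = integral (cube 5) (\<lambda>t. 4 * b t * kern \<delta> (x - t))"

lemma smooth_potential:
  assumes "0 < \<delta>" "smooth b"
  shows "smooth (potential b \<delta>)"
  unfolding potential_def cube_def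
  by (intro smooth_convolution smooth_kern assms smooth_imp_continuous_on smooth_intros)

lemma lapl_potential:
  assumes "0 < \<delta>" "smooth b"
  shows "lapl (potential b \<delta>) x = integral (cube 5) (\<lambda>t. 4 * b t * lapl (kern \<delta>) (x - t))"
proof -
  have c: "continuous_on (cbox (vec (- 5)) (vec 5)) (\<lambda>t. 4 * b t)"
    by (intro smooth_imp_continuous_on smooth_intros assms)
  have p: "partial i (partial i (potential b \<delta>)) x = integral (cube 5) (\<lambda>t. 4 * b t * partial i (partial i (kern \<delta>)) (x - t))" for i
    unfolding potential_def cube_def
    by (simp add: partial_convolution[OF c] smooth_kern[OF assms(1)] smooth_partial)
  have i: "(\<lambda>t. 4 * b t * partial i (partial i (kern \<delta>)) (x - t)) integrable_on cube 5" for i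
    unfolding cube_def
    by (intro integrable_continuous continuous_intros smooth_imp_continuous_on assms
        continuous_on_compose2[OF smooth_imp_continuous_on[OF smooth_partial[OF smooth_partial[OF smooth_kern[OF assms(1)]]], of UNIV]]) auto
  show ?thesis
    unfolding lapl_def p by (subst integral_add[OF i i, symmetric]) (simp add: algebra_simps)
qed

text \<open>Only the square of side \<delta> around \<open>x\<close> is kept: there the norm of
  \<open>x - t\<close> is at most \<delta> / sqrt 2, so the Laplacian of the kernel is at least
  \<open>8 / (9 * \<delta>\<^sup>2)\<close>, and the area is \<open>\<delta>\<^sup>2\<close>.
  Uniform continuity replaces \<open>b t\<close> by \<open>b x - 1/4\<close>. Where
  \<open>b x < 1/4\<close> the claimed bound is negative.\<close>

lemma lapl_potential_ge:
  assumes b: "smooth b" "\<And>x. 0 \<le> b x"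
  shows "\<exists>\<delta>0>0. \<forall>\<delta>. 0 < \<delta> \<and> \<delta> \<le> \<delta>0 \<longrightarrow> (\<forall>x. norm x \<le> 24/5 \<longrightarrow> 2 * b x - 1 \<le> lapl (potential b \<delta>) x)"
proof -
  have "uniformly_continuous_on (cube 5) b"
    unfolding cube_def by (intro compact_uniformly_continuous smooth_imp_continuous_on b compact_cbox)
  then obtain d where d: "d > 0" "\<And>x t. x \<in> cube 5 \<Longrightarrow> t \<in> cube 5 \<Longrightarrow> dist t x < d \<Longrightarrow> \<bar>b t - b x\<bar> < 1/4"
    unfolding uniformly_continuous_on_def dist_real_def by (metis zero_less_divide_1_iff zero_less_numeral)
  \<comment> \<open>The bound 1/10 keeps the square inside \<open>cube 5\<close> when the centre has
    norm at most 24/5; \<open>d/2\<close> keeps it in the range of uniform continuity.\<close>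
  define \<delta>0 where "\<delta>0 = min (d/2) (1/10)"
  have "2 * b x - 1 \<le> lapl (potential b \<delta>) x" if \<delta>: "0 < \<delta>" "\<delta> \<le> \<delta>0" and x: "norm x \<le> 24/5" for x \<delta>
  proof -
    define S where "S = cbox (x - vec (\<delta>/2)) (x + vec (\<delta>/2))"
    have k0: "0 \<le> lapl (kern \<delta>) z" for z by (simp add: lapl_kern \<delta>)
    have int: "(\<lambda>t. 4 * b t * lapl (kern \<delta>) (x - t)) integrable_on cbox l u" for l u
      by (intro integrable_continuous continuous_intros smooth_imp_continuous_on b
        continuous_on_compose2[OF smooth_imp_continuous_on[OF smooth_lapl[OF smooth_kern[OF \<delta>(1)]], of UNIV]]) auto
    have xc: "\<bar>x$i\<bar> \<le> 24/5" for i using component_le_norm_cart[of x i] x by linarith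
    have S5: "S \<subseteq> cube 5"
    proof
      fix t assume "t \<in> S"
      then have c: "x$i \<le> t$i + \<delta>/2 \<and> t$i \<le> x$i + \<delta>/2" for i
        by (auto simp: S_def mem_box_cart algebra_simps)
      moreover have "\<delta> \<le> 1/10" using \<delta> by (simp add: \<delta>0_def)
      ultimately have "\<bar>t$i\<bar> \<le> 5" for i
        using xc[of i] c[of i] by linarith
      then show "t \<in> cube 5" by (simp add: mem_cube)
    qed
    have x5: "x \<in> cube 5" using x by (intro norm_le_imp_mem_cube) simp
    show ?thesis
    proof (cases "b x < 1/4")
      case True
      have "0 \<le> integral (cube 5) (\<lambda>t. 4 * b t * lapl (kern \<delta>) (x - t))"
        unfolding cube_def by (intro integral_nonneg int) (simp add: b k0)
      then show ?thesis using True lapl_potential[OF \<delta>(1) b(1), of x] by linarith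
    next
      case False
      have "4 * (b x - 1/4) * (8 / (9 * \<delta>\<^sup>2)) * \<delta>\<^sup>2 = integral S (\<lambda>t. 4 * (b x - 1/4) * (8 / (9 * \<delta>\<^sup>2)))"
      proof -
        have "measure lborel S = \<delta>\<^sup>2"
          using \<delta>(1) by (simp add: S_def content_cbox_if_cart interval_eq_empty_cart prod_2 power2_eq_square)
        then show ?thesis unfolding S_def by (simp add: mult.commute)
      qed
      also have "\<dots> \<le> integral S (\<lambda>t. 4 * b t * lapl (kern \<delta>) (x - t))"
      proof (rule integral_le)
        fix t assume t: "t \<in> S"
        then have "x$i \<le> t$i + \<delta>/2 \<and> t$i \<le> x$i + \<delta>/2" for i
          by (auto simp: S_def mem_box_cart algebra_simps)
        then have c: "\<bar>x$i - t$i\<bar> \<le> \<delta>/2" for i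
          by (smt (verit))
        have "(x$i - t$i)\<^sup>2 \<le> (\<delta>/2)\<^sup>2" for i
          using c[of i] \<delta>(1) by (simp add: abs_le_square_iff[symmetric])
        from this[of 1] this[of 2] have n: "(norm (x - t))\<^sup>2 \<le> \<delta>\<^sup>2 / 2"
          unfolding norm_sq_2 power_divide by simp
        then have "(norm (x - t))\<^sup>2 < d\<^sup>2"
        proof -
          have "\<delta>\<^sup>2 \<le> (d/2)\<^sup>2" using \<delta> by (intro power_mono) (auto simp: \<delta>0_def)
          moreover have "0 < d\<^sup>2" using d by simp
          moreover have "(d/2)\<^sup>2 = d\<^sup>2 / 4" by (simp add: power_divide)
          ultimately show ?thesis using n by linarith
        qed
        then have "norm (x - t) < d" using d(1) by (simp add: power2_less_imp_less)
        then have "\<bar>b t - b x\<bar> < 1/4"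
          using d(2)[OF x5] t S5 by (auto simp: dist_norm norm_minus_commute)
        then have b1: "b x - 1/4 \<le> b t" by linarith
        have "8 / (9 * \<delta>\<^sup>2) = 2 * \<delta>\<^sup>2 / (\<delta>\<^sup>2/2 + \<delta>\<^sup>2)\<^sup>2"
          using \<delta>(1) by (simp add: field_simps power2_eq_square)
        also have "\<dots> \<le> 2 * \<delta>\<^sup>2 / ((norm (x - t))\<^sup>2 + \<delta>\<^sup>2)\<^sup>2"
          using n \<delta>(1) by (intro divide_left_mono power_mono mult_pos_pos zero_less_power add_nonneg_pos add_pos_pos) auto
        finally have "8 / (9 * \<delta>\<^sup>2) \<le> lapl (kern \<delta>) (x - t)"
          by (simp add: lapl_kern \<delta>(1))
        then show "4 * (b x - 1/4) * (8 / (9 * \<delta>\<^sup>2)) \<le> 4 * b t * lapl (kern \<delta>) (x - t)"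
          using b1 False by (intro mult_mono) (auto intro: b)
      qed (auto simp: S_def int)
      also have "\<dots> \<le> integral (cube 5) (\<lambda>t. 4 * b t * lapl (kern \<delta>) (x - t))"
        using S5 unfolding cube_def S_def by (intro integral_subset_le int) (auto simp: b k0)
      finally have "4 * (b x - 1/4) * (8 / (9 * \<delta>\<^sup>2)) * \<delta>\<^sup>2 \<le> lapl (potential b \<delta>) x" using lapl_potential[OF \<delta>(1) b(1), of x] by simp
      moreover have "4 * (b x - 1/4) * (8 / (9 * \<delta>\<^sup>2)) * \<delta>\<^sup>2 = 32/9 * (b x - 1/4)"
        using \<delta>(1) by simp
      ultimately show ?thesis using b(2)[of x] by simp
    qed
  qed
  moreover have "\<delta>0 > 0" using d by (simp add: \<delta>0_def)
  ultimately show ?thesis by blast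
qed

lemma potential_le:
  assumes b: "smooth b" "\<And>x. 0 \<le> b x" and \<delta>: "0 < \<delta>" "\<delta> \<le> 1" and x: "norm x \<le> 5"
  shows "potential b \<delta> x \<le> 16 * integral (cube 5) b"
proof -
  have "potential b \<delta> x \<le> integral (cube 5) (\<lambda>t. 16 * b t)"
    unfolding potential_def
  proof (rule integral_le)
    show "(\<lambda>t. 4 * b t * kern \<delta> (x - t)) integrable_on cube 5"
      unfolding cube_def
      by (intro integrable_continuous continuous_intros smooth_imp_continuous_on b
        continuous_on_compose2[OF smooth_imp_continuous_on[OF smooth_kern[OF \<delta>(1)], of UNIV]]) auto
    show "(\<lambda>t. 16 * b t) integrable_on cube 5"
      by (intro smooth_integrable_cube smooth_intros b)
    fix t assume t: "t \<in> cube 5"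
    have xi: "\<bar>x$i\<bar> \<le> 5" for i using component_le_norm_cart[of x i] x by linarith
    have "\<bar>(x - t)$1\<bar> \<le> 10" "\<bar>(x - t)$2\<bar> \<le> 10"
      using xi[of 1] xi[of 2] t by (auto simp: mem_cube abs_if split: if_splits)
    then have "((x - t)$1)\<^sup>2 \<le> 10\<^sup>2" "((x - t)$2)\<^sup>2 \<le> 10\<^sup>2"
      by (simp_all only: abs_le_square_iff[symmetric])
    moreover have "\<delta>\<^sup>2 \<le> 1" using \<delta> by (simp add: power_le_one)
    \<comment> \<open>Both components of \<open>x - t\<close> are at most 10 in modulus, so the left
      side is at most 201; the power of 2 makes the logarithm visibly smaller than 8.\<close>
    ultimately have "(norm (x - t))\<^sup>2 + \<delta>\<^sup>2 \<le> 2 ^ 8"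
      unfolding norm_sq_2 by simp
    then have "ln ((norm (x - t))\<^sup>2 + \<delta>\<^sup>2) \<le> ln (2 ^ 8)"
      using kern_arg_pos[OF \<delta>(1)] by (subst ln_le_cancel_iff) auto
    also have "\<dots> = 8 * ln 2" using ln_realpow[of 2 8] by simp
    also have "\<dots> \<le> 8" using ln_2_less_1 by simp
    finally have "kern \<delta> (x - t) \<le> 4" by (simp add: kern_def)
    then show "4 * b t * kern \<delta> (x - t) \<le> 16 * b t"
      using mult_left_mono[of "kern \<delta> (x - t)" 4 "4 * b t"] b(2)[of t] by simp
  qed
  then show ?thesis by simp
qed

section \<open>The Carleman weight and the weighted gradient estimate\<close>

definition annulus_cutoff :: "real \<Rightarrow> real^2 \<Rightarrow> real" where
  "annulus_cutoff r x = (1 - cutoff (r/2) r x) * cutoff 4 (9/2) x"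

text \<open>The Laplacian of the first term is close to a negative multiple of the Dirac mass,
  harmless only away from the origin; hence the inner cutoff. The term
  \<open>(norm x)\<^sup>2\<close> adds 4 to the Laplacian: one unit pays for the first term, one for
  the error in \<open>lapl_potential_ge\<close>, and the rest is positive even where
  \<open>b\<close> vanishes.\<close>

definition weight :: "real \<Rightarrow> (real^2 \<Rightarrow> real) \<Rightarrow> real \<Rightarrow> real^2 \<Rightarrow> real" where
  "weight n b \<delta> x = - (2 * n) * kern \<delta> x + potential b \<delta> x + (norm x)\<^sup>2"

lemma smooth_annulus_cutoff [intro]: "smooth (annulus_cutoff r)"
  unfolding annulus_cutoff_def by (intro smooth_intros smooth_cutoff)

lemma smooth_weight: "0 < \<delta> \<Longrightarrow> smooth b \<Longrightarrow> smooth (weight n b \<delta>)"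
  unfolding weight_def by (intro smooth_intros smooth_kern smooth_potential)

lemma lapl_weight:
  assumes "0 < \<delta>" "smooth b"
  shows "lapl (weight n b \<delta>) x = - (2 * n) * lapl (kern \<delta>) x + lapl (potential b \<delta>) x + 4"
proof -
  note s = smooth_kern[OF assms(1)] smooth_potential[OF assms]
  have "partial i (weight n b \<delta>) = (\<lambda>x. - (2 * n) * partial i (kern \<delta>) x + partial i (potential b \<delta>) x + 2 * x$i)" for i
    unfolding weight_def by (rule ext) (simp add: partial_rules smooth_intros s)
  then show ?thesis
    unfolding lapl_def
    by (simp add: partial_rules smooth_intros s) (simp add: algebra_simps)
qed

text \<open>For \<eta> times the gradient of \<open>v\<close>, divergence and curl consist of \<eta>
  times the Laplacian, controlled by \<open>b\<close>, and of terms with the gradient of \<eta>. On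
  the support of \<eta> the Laplacian of the weight is at least \<open>2 * b + 1\<close>: the part
  \<open>2 * b\<close> absorbs the drift, the part 1 is the left-hand side.\<close>

lemma weighted_estimate:
  fixes v b :: "real^2 \<Rightarrow> real"
  assumes v: "smooth v" and b: "smooth b" "\<And>x. 0 \<le> b x"
    and eq: "\<And>x. (lapl v x)\<^sup>2 \<le> b x * (grad_sq v x + \<epsilon>\<^sup>2)"
    and r: "0 < r" "r \<le> 1" and n: "0 \<le> n"
  shows "\<exists>\<delta>. 0 < \<delta> \<and> \<delta> \<le> 1 \<and>
    integral (cube 5) (\<lambda>x. (annulus_cutoff r x)\<^sup>2 * grad_sq v x * exp (weight n b \<delta> x)) \<le>
    integral (cube 5) (\<lambda>x. (2 * \<epsilon>\<^sup>2 * ((annulus_cutoff r x)\<^sup>2 * b x) + 2 * grad_sq (annulus_cutoff r) x * grad_sq v x) * exp (weight n b \<delta> x))"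
proof -
  obtain \<delta>0 where \<delta>0: "\<delta>0 > 0" "\<And>\<delta> x. 0 < \<delta> \<Longrightarrow> \<delta> \<le> \<delta>0 \<Longrightarrow> norm x \<le> 24/5 \<Longrightarrow> 2 * b x - 1 \<le> lapl (potential b \<delta>) x"
    using lapl_potential_ge[OF b] by blast
  \<comment> \<open>With this bound on \<delta> the Laplacian of the kernel is at most
    \<open>1 / (2 * (n + 1))\<close> at norms at least \<open>r/2\<close>, so the singular part of
    the weight costs at most 1.\<close>
  define \<delta>1 where "\<delta>1 = r\<^sup>2 / (8 * sqrt (n + 1))"
  have \<delta>1: "\<delta>1 > 0" using r n by (simp add: \<delta>1_def)
  define \<delta> where "\<delta> = min 1 (min \<delta>0 \<delta>1)"
  have \<delta>: "0 < \<delta>" "\<delta> \<le> 1" "\<delta> \<le> \<delta>0" "\<delta> \<le> \<delta>1" using \<delta>0 \<delta>1 by (auto simp: \<delta>_def)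
  define \<eta> where "\<eta> = annulus_cutoff r"
  define \<phi> where "\<phi> = weight n b \<delta>"
  have s\<eta>: "smooth \<eta>" by (auto simp: \<eta>_def)
  have s\<phi>: "smooth \<phi>" by (simp add: \<phi>_def smooth_weight \<delta> b)
  have supp: "\<eta> x = 0" if "norm x > 9/2" for x
    using that by (simp add: \<eta>_def annulus_cutoff_def cutoff_eq_0)
  have supp2: "\<eta> x = 0" if "norm x < r/2" for x
    using that r by (simp add: \<eta>_def annulus_cutoff_def cutoff_eq_1)
  have lap: "(2 * b x + 1) * ((\<eta> x)\<^sup>2 * grad_sq v x) \<le> lapl \<phi> x * ((\<eta> x)\<^sup>2 * grad_sq v x)" for x
  proof (cases "\<eta> x = 0")
    case False
    then have x: "norm x \<le> 9/2" "r/2 \<le> norm x" using supp supp2 not_le by blast+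
    have "2 * n * lapl (kern \<delta>) x \<le> 1"
    proof -
      have "r ^ 4 / 16 = ((r/2)\<^sup>2)\<^sup>2" by (simp add: power_divide flip: power_mult)
      also have "\<dots> \<le> ((norm x)\<^sup>2 + \<delta>\<^sup>2)\<^sup>2"
        using x(2) r by (intro power_mono order_trans[OF power_mono[OF x(2)]]) auto
      finally have "lapl (kern \<delta>) x \<le> 2 * \<delta>\<^sup>2 / (r ^ 4 / 16)"
        unfolding lapl_kern[OF \<delta>(1)] using r by (intro divide_left_mono mult_pos_pos) (auto simp: kern_arg_pos[OF \<delta>(1)])
      also have "\<dots> \<le> 2 * \<delta>1\<^sup>2 / (r ^ 4 / 16)"
        using \<delta> r by (intro divide_right_mono mult_left_mono power_mono) auto
      also have "\<dots> = 1 / (2 * (n + 1))"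
      proof -
        have "\<delta>1\<^sup>2 = r ^ 4 / (64 * (n + 1))"
          using n by (simp add: \<delta>1_def power_mult_distrib power_divide flip: power_mult)
        moreover have "2 * (r ^ 4 / (64 * N)) / (r ^ 4 / 16) = 1 / (2 * N)" if "N > 0" for N
          using r that by (simp add: field_simps)
        ultimately show ?thesis using n by (metis add_nonneg_pos zero_less_one)
      qed
      finally have "2 * n * lapl (kern \<delta>) x \<le> 2 * n * (1 / (2 * (n + 1)))"
        using n by (intro mult_left_mono) auto
      also have "\<dots> \<le> 1" using n by (simp add: field_simps)
      finally show ?thesis .
    qed
    moreover have "2 * b x - 1 \<le> lapl (potential b \<delta>) x" using \<delta> x by (intro \<delta>0) auto
    ultimately have "2 * b x + 1 \<le> lapl \<phi> x"
      unfolding \<phi>_def lapl_weight[OF \<delta>(1) b(1)] by linarith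
    then show ?thesis by (rule mult_right_mono) simp
  qed simp
  define W where "W i x = \<eta> x * partial i v x" for i x
  have sW: "smooth (W i)" for i unfolding W_def by (intro smooth_intros s\<eta> v)
  have W: "(W 1 x)\<^sup>2 + (W 2 x)\<^sup>2 = (\<eta> x)\<^sup>2 * grad_sq v x" for x
    by (simp add: W_def grad_sq_def power_mult_distrib algebra_simps)
  have DC: "(partial 1 (W 1) x + partial 2 (W 2) x)\<^sup>2 + (partial 2 (W 1) x - partial 1 (W 2) x)\<^sup>2
     \<le> 2 * ((\<eta> x)\<^sup>2 * (lapl v x)\<^sup>2) + 2 * (grad_sq \<eta> x * grad_sq v x)" for x
  proof -
    \<comment> \<open>\<open>p\<close> and \<open>q\<close> are the scalar and the cross product of
      the two gradients, so the sum of their squares factors exactly.\<close>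
    define p where "p = partial 1 \<eta> x * partial 1 v x + partial 2 \<eta> x * partial 2 v x"
    define q where "q = partial 2 \<eta> x * partial 1 v x - partial 1 \<eta> x * partial 2 v x"
    have 1: "partial 1 (W 1) x + partial 2 (W 2) x = \<eta> x * lapl v x + p"
      unfolding W_def using s\<eta> v
      by (simp add: partial_rules smooth_intros lapl_def p_def algebra_simps)
    have 2: "partial 2 (W 1) x - partial 1 (W 2) x = q"
      unfolding W_def using s\<eta> v
      by (simp add: partial_rules smooth_intros q_def partial_commute[OF v, of 2 1])
    have 3: "p\<^sup>2 + q\<^sup>2 = grad_sq \<eta> x * grad_sq v x"
      by (simp add: p_def q_def grad_sq_def power2_eq_square algebra_simps)
    have "(\<eta> x * lapl v x + p)\<^sup>2 \<le> 2 * (\<eta> x * lapl v x)\<^sup>2 + 2 * p\<^sup>2"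
      using zero_le_power2[of "\<eta> x * lapl v x - p"] by (simp add: power2_eq_square algebra_simps)
    then show ?thesis
      using zero_le_power2[of q] unfolding 1 2 3[symmetric] power_mult_distrib distrib_left by linarith
  qed
  have C: "integral (cube 5) (\<lambda>x. lapl \<phi> x * ((W 1 x)\<^sup>2 + (W 2 x)\<^sup>2) * exp (\<phi> x)) \<le>
    integral (cube 5) (\<lambda>x. ((partial 1 (W 1) x + partial 2 (W 2) x)\<^sup>2 + (partial 2 (W 1) x - partial 1 (W 2) x)\<^sup>2) * exp (\<phi> x))"
    by (rule carleman[OF sW sW s\<phi>, where R="9/2"]) (auto simp: W_def supp)
  define F where "F x = 2 * b x * ((\<eta> x)\<^sup>2 * grad_sq v x) * exp (\<phi> x)" for x
  define L where "L x = (\<eta> x)\<^sup>2 * grad_sq v x * exp (\<phi> x)" for x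
  define T where "T x = (2 * \<epsilon>\<^sup>2 * ((\<eta> x)\<^sup>2 * b x) + 2 * grad_sq \<eta> x * grad_sq v x) * exp (\<phi> x)" for x
  have sm: "smooth F" "smooth L" "smooth T"
    unfolding F_def L_def T_def by (intro smooth_intros s\<eta> s\<phi> v b)+
  have "integral (cube 5) (\<lambda>x. F x + L x) \<le> integral (cube 5) (\<lambda>x. lapl \<phi> x * ((W 1 x)\<^sup>2 + (W 2 x)\<^sup>2) * exp (\<phi> x))"
    using mult_right_mono[OF lap, of "exp (\<phi> _)"]
    by (intro integral_cube_le smooth_intros sm s\<phi> sW) (auto simp: W F_def L_def algebra_simps)
  also note C
  also have "integral (cube 5) (\<lambda>x. ((partial 1 (W 1) x + partial 2 (W 2) x)\<^sup>2 + (partial 2 (W 1) x - partial 1 (W 2) x)\<^sup>2) * exp (\<phi> x))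
     \<le> integral (cube 5) (\<lambda>x. F x + T x)"
  proof (intro integral_cube_le smooth_intros sm s\<phi> sW)
    fix x
    have "(\<eta> x)\<^sup>2 * (lapl v x)\<^sup>2 \<le> (\<eta> x)\<^sup>2 * (b x * (grad_sq v x + \<epsilon>\<^sup>2))"
      by (intro mult_left_mono eq) simp
    with DC[of x] have "(partial 1 (W 1) x + partial 2 (W 2) x)\<^sup>2 + (partial 2 (W 1) x - partial 1 (W 2) x)\<^sup>2
       \<le> 2 * ((\<eta> x)\<^sup>2 * (b x * (grad_sq v x + \<epsilon>\<^sup>2))) + 2 * (grad_sq \<eta> x * grad_sq v x)"
      by linarith
    from mult_right_mono[OF this, of "exp (\<phi> x)"]
    show "((partial 1 (W 1) x + partial 2 (W 2) x)\<^sup>2 + (partial 2 (W 1) x - partial 1 (W 2) x)\<^sup>2) * exp (\<phi> x) \<le> F x + T x"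
      by (simp add: F_def T_def algebra_simps)
  qed
  finally have "integral (cube 5) L \<le> integral (cube 5) T"
    using sm by (simp add: integral_add smooth_integrable_cube)
  then show ?thesis
    using \<delta> unfolding L_def T_def \<eta>_def \<phi>_def by blast
qed

lemma integral_cutoff_gradient_le:
  assumes "0 \<le> a" "a < c" "c \<le> d"
  shows "integral (cube d) (grad_sq (cutoff a c)) \<le> (2 * step_lip * c / (c\<^sup>2 - a\<^sup>2))\<^sup>2 * (2 * c)\<^sup>2"
proof -
  have 0: "grad_sq (cutoff a c) x = 0" if "x \<notin> cube e" "c \<le> e" for x e
  proof -
    have "c \<le> norm x" using that norm_le_imp_mem_cube[of x e] by linarith
    then show ?thesis using cutoff_gradient(2)[OF assms(1,2)] by (simp add: grad_sq_def)
  qed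
  have "integral (cube d) (grad_sq (cutoff a c)) = integral (cube c) (grad_sq (cutoff a c))"
    using integral_cbox_eq_UNIV[of "cube d", OF 0] integral_cbox_eq_UNIV[of "cube c", OF 0] assms(3) by simp
  also have "\<dots> \<le> integral (cube c) (\<lambda>x. (2 * step_lip * c / (c\<^sup>2 - a\<^sup>2))\<^sup>2)"
    by (intro integral_cube_le smooth_intros smooth_cutoff cutoff_gradient assms)
  also have "\<dots> = (2 * step_lip * c / (c\<^sup>2 - a\<^sup>2))\<^sup>2 * (2 * c)\<^sup>2"
    using content_cube[of c] assms by (simp add: cube_def mult.commute)
  finally show ?thesis .
qed

text \<open>The cutoff part of the constant depends only on the ratio of \<open>a\<close> and
  \<open>c\<close>, so it is the same for the discs of all radii \<open>r\<close>. The last term is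
  \<open>\<epsilon>\<^sup>2 / 2\<close> times the area 100 of \<open>cube 5\<close>.\<close>

lemma caccioppoli_cutoff:
  fixes v b :: "real^2 \<Rightarrow> real"
  assumes v: "smooth v" and b: "smooth b" "\<And>x. 0 \<le> b x"
    and eq: "\<And>x. (lapl v x)\<^sup>2 \<le> b x * (grad_sq v x + \<epsilon>\<^sup>2)"
    and ac: "0 \<le> a" "a < c" "c \<le> 24/5"
    and M: "\<And>x. norm x \<le> c \<Longrightarrow> \<bar>v x - m\<bar> \<le> M"
  shows "integral (cube 5) (\<lambda>x. (cutoff a c x)\<^sup>2 * grad_sq v x)
     \<le> M\<^sup>2 * (32 * (2 * step_lip * c / (c\<^sup>2 - a\<^sup>2))\<^sup>2 * c\<^sup>2 + 2 * integral (cube 5) b) + 50 * \<epsilon>\<^sup>2"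
proof -
  let ?\<eta> = "cutoff a c"
  have "integral (cube 5) (\<lambda>x. (?\<eta> x)\<^sup>2 * grad_sq v x) \<le>
    integral (cube 5) (\<lambda>x. 8 * M\<^sup>2 * grad_sq ?\<eta> x + 2 * M\<^sup>2 * ((?\<eta> x)\<^sup>2 * b x) + \<epsilon>\<^sup>2 / 2 * (?\<eta> x)\<^sup>2)"
  proof (rule caccioppoli[OF v _ b eq, where R="24/5" and c=m])
    show "?\<eta> x = 0" if "norm x > 24/5" for x using that ac by (intro cutoff_eq_0) auto
    show "\<bar>v x - m\<bar> \<le> M" if "?\<eta> x \<noteq> 0" for x
      using that cutoff_eq_0[OF ac(1,2), of x] by (intro M) linarith
  qed auto
  also have "\<dots> \<le> integral (cube 5) (\<lambda>x. 8 * M\<^sup>2 * grad_sq ?\<eta> x + (2 * M\<^sup>2 * b x + \<epsilon>\<^sup>2 / 2))"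
  proof (intro integral_cube_le smooth_intros smooth_cutoff b)
    fix x
    have "2 * M\<^sup>2 * ((?\<eta> x)\<^sup>2 * b x) \<le> 2 * M\<^sup>2 * b x"
      using b(2)[of x] mult_right_mono[of "(?\<eta> x)\<^sup>2" 1 "b x"] by (intro mult_left_mono) auto
    moreover have "\<epsilon>\<^sup>2 / 2 * (?\<eta> x)\<^sup>2 \<le> \<epsilon>\<^sup>2 / 2"
      using mult_left_mono[of "(?\<eta> x)\<^sup>2" 1 "\<epsilon>\<^sup>2 / 2"] by simp
    ultimately show "8 * M\<^sup>2 * grad_sq ?\<eta> x + 2 * M\<^sup>2 * ((?\<eta> x)\<^sup>2 * b x) + \<epsilon>\<^sup>2 / 2 * (?\<eta> x)\<^sup>2
       \<le> 8 * M\<^sup>2 * grad_sq ?\<eta> x + (2 * M\<^sup>2 * b x + \<epsilon>\<^sup>2 / 2)" by linarith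
  qed
  also have "\<dots> = 8 * M\<^sup>2 * integral (cube 5) (grad_sq ?\<eta>) + (2 * M\<^sup>2 * integral (cube 5) b + 50 * \<epsilon>\<^sup>2)"
  proof -
    have "integral (cube 5) (\<lambda>x. \<epsilon>\<^sup>2 / 2) = 50 * \<epsilon>\<^sup>2"
      using content_cube[of 5] by (simp add: cube_def)
    then show ?thesis
      using b by (simp add: integral_add smooth_integrable_cube smooth_intros smooth_cutoff)
  qed
  also have "\<dots> \<le> 8 * M\<^sup>2 * ((2 * step_lip * c / (c\<^sup>2 - a\<^sup>2))\<^sup>2 * (2 * c)\<^sup>2) + (2 * M\<^sup>2 * integral (cube 5) b + 50 * \<epsilon>\<^sup>2)"
    using ac by (intro add_mono mult_left_mono integral_cutoff_gradient_le) auto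
  also have "\<dots> = M\<^sup>2 * (32 * (2 * step_lip * c / (c\<^sup>2 - a\<^sup>2))\<^sup>2 * c\<^sup>2 + 2 * integral (cube 5) b) + 50 * \<epsilon>\<^sup>2"
    by (simp add: algebra_simps power_mult_distrib)
  finally show ?thesis .
qed

text \<open>The logarithmic part of the weight is compared on three regions: \<open>cube 2\<close>,
  where the argument of the logarithm is at most 9; norms at least \<open>r/2\<close>, where it is
  at least \<open>r\<^sup>2 / 4\<close>; norms at least 4, where it is at least 16. The potential
  stays on the left, where no pointwise lower bound is available. One \<delta> serves all
  rectangles, since four strips will be used together.\<close>

lemma carleman_estimate:
  fixes v b :: "real^2 \<Rightarrow> real"
  assumes v: "smooth v" and b: "smooth b" "\<And>x. 0 \<le> b x"
    and eq: "\<And>x. (lapl v x)\<^sup>2 \<le> b x * (grad_sq v x + \<epsilon>\<^sup>2)"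
    and r: "0 < r" "r \<le> 1" and n: "0 \<le> n"
  defines "B \<equiv> integral (cube 5) b"
  shows "\<exists>\<delta>. 0 < \<delta> \<and> \<delta> \<le> 1 \<and> (\<forall>l u. cbox l u \<subseteq> cube 2 \<and> (\<forall>x\<in>cbox l u. 1 \<le> norm x) \<longrightarrow>
    exp (- n * ln 9) * integral (cbox l u) (\<lambda>x. grad_sq v x * exp (potential b \<delta> x)) \<le>
    exp (16 * B + 25) * (2 * \<epsilon>\<^sup>2 * exp (n * ln (4 / r\<^sup>2)) * B
      + 18 * step_lip\<^sup>2 / r\<^sup>2 * exp (n * ln (4 / r\<^sup>2)) * integral (cube 5) (\<lambda>x. (cutoff r (2 * r) x)\<^sup>2 * grad_sq v x)
      + 18 * step_lip\<^sup>2 * exp (- n * ln 16) * integral (cube 5) (\<lambda>x. (cutoff (9/2) (24/5) x)\<^sup>2 * grad_sq v x)))"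
proof -
  define \<eta> where "\<eta> = annulus_cutoff r"
  obtain \<delta> where \<delta>: "0 < \<delta>" "\<delta> \<le> 1" and E0:
    "integral (cube 5) (\<lambda>x. (\<eta> x)\<^sup>2 * grad_sq v x * exp (weight n b \<delta> x)) \<le>
    integral (cube 5) (\<lambda>x. (2 * \<epsilon>\<^sup>2 * ((\<eta> x)\<^sup>2 * b x) + 2 * grad_sq \<eta> x * grad_sq v x) * exp (weight n b \<delta> x))"
    using weighted_estimate[OF v b eq r n] unfolding \<eta>_def by blast
  define \<phi> where "\<phi> = weight n b \<delta>"
  have s\<eta>: "smooth \<eta>" by (auto simp: \<eta>_def)
  have s\<phi>: "smooth \<phi>" by (simp add: \<phi>_def smooth_weight \<delta> b)
  have sP: "smooth (potential b \<delta>)" by (simp add: smooth_potential \<delta> b)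
  define N1 where "N1 = n * ln (4 / r\<^sup>2)"
  \<comment> \<open>\<open>16 * B\<close> bounds the potential from above
    (\<open>potential_le\<close>), and 25 bounds \<open>(norm x)\<^sup>2\<close> on the disc of
    radius 5.\<close>
  define E where "E = exp (16 * B + 25)"
  have \<phi>: "\<phi> x = - n * ln ((norm x)\<^sup>2 + \<delta>\<^sup>2) + potential b \<delta> x + (norm x)\<^sup>2" for x
    by (simp add: \<phi>_def weight_def kern_def)
  have \<phi>_le: "exp (\<phi> x) \<le> E * exp (- n * ln s)" if "norm x \<le> 5" "0 < s" "s \<le> (norm x)\<^sup>2" for x s
  proof -
    have "ln s \<le> ln ((norm x)\<^sup>2 + \<delta>\<^sup>2)"
      using that kern_arg_pos[OF \<delta>(1), of x] by (subst ln_le_cancel_iff) (auto intro: order_trans)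
    then have "- n * ln ((norm x)\<^sup>2 + \<delta>\<^sup>2) \<le> - n * ln s"
      using n by (simp add: mult_left_mono)
    moreover have "(norm x)\<^sup>2 \<le> 5\<^sup>2" using that by (intro power_mono) auto
    moreover have "potential b \<delta> x \<le> 16 * B" unfolding B_def by (intro potential_le b \<delta> that)
    ultimately have "\<phi> x \<le> (16 * B + 25) + - n * ln s" unfolding \<phi> by simp
    then show ?thesis unfolding E_def exp_add[symmetric] by simp
  qed
  have \<phi>_le1: "exp (\<phi> x) \<le> E * exp N1" if "norm x \<le> 5" "r / 2 \<le> norm x" for x
  proof -
    have "(r/2)\<^sup>2 \<le> (norm x)\<^sup>2" using that r by (intro power_mono) auto
    then have "exp (\<phi> x) \<le> E * exp (- n * ln ((r/2)\<^sup>2))" using that r by (intro \<phi>_le) auto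
    moreover have "- n * ln ((r/2)\<^sup>2) = N1"
    proof -
      have "(r/2)\<^sup>2 = inverse (4 / r\<^sup>2)" by (simp add: power_divide)
      then have "ln ((r/2)\<^sup>2) = - ln (4 / r\<^sup>2)"
        using r by (simp only: ln_inverse divide_pos_pos zero_less_power zero_less_numeral)
      then show ?thesis by (simp add: N1_def)
    qed
    ultimately show ?thesis by simp
  qed
  have \<phi>_le2: "exp (\<phi> x) \<le> E * exp (- n * ln 16)" if "norm x \<le> 5" "4 \<le> norm x" for x
  proof -
    have "4\<^sup>2 \<le> (norm x)\<^sup>2" using that by (intro power_mono) auto
    then show ?thesis using that by (intro \<phi>_le) auto
  qed
  define z1 where "z1 x = (cutoff r (2 * r) x)\<^sup>2 * grad_sq v x" for x
  define z2 where "z2 x = (cutoff (9/2) (24/5) x)\<^sup>2 * grad_sq v x" for x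
  have sz: "smooth z1" "smooth z2" unfolding z1_def z2_def by (intro smooth_intros smooth_cutoff v)+
  have z0: "0 \<le> z1 x" "0 \<le> z2 x" for x by (simp_all add: z1_def z2_def)
  have supp: "\<eta> x = 0" if "norm x > 9/2" for x
    using that by (simp add: \<eta>_def annulus_cutoff_def cutoff_eq_0)
  have supp2: "\<eta> x = 0" if "norm x < r/2" for x
    using that r by (simp add: \<eta>_def annulus_cutoff_def cutoff_eq_1)
  have \<eta>1: "(\<eta> x)\<^sup>2 \<le> 1" for x
    by (simp add: \<eta>_def annulus_cutoff_def power_le_one mult_le_one)
  have Epos: "0 \<le> E" by (simp add: E_def)
  have T1: "(\<eta> x)\<^sup>2 * b x * exp (\<phi> x) \<le> E * exp N1 * b x" for x
  proof (cases "\<eta> x = 0")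
    case False
    then have "r/2 \<le> norm x" "norm x \<le> 5" using supp[of x] supp2[of x] by linarith+
    then have "((\<eta> x)\<^sup>2 * b x) * exp (\<phi> x) \<le> (1 * b x) * (E * exp N1)"
      by (intro mult_mono \<phi>_le1 \<eta>1) (auto simp: b Epos)
    then show ?thesis by (simp add: algebra_simps)
  qed (simp add: b Epos)
  have p\<eta>: "partial i \<eta> x = - (partial i (cutoff (r/2) r) x * cutoff 4 (9/2) x) + (1 - cutoff (r/2) r x) * partial i (cutoff 4 (9/2)) x" for i x
    unfolding \<eta>_def annulus_cutoff_def[abs_def]
    by (simp add: partial_rules smooth_intros smooth_cutoff)
  have T2: "2 * grad_sq \<eta> x * grad_sq v x * exp (\<phi> x) \<le>
     E * (18 * step_lip\<^sup>2 / r\<^sup>2 * exp N1 * z1 x + 18 * step_lip\<^sup>2 * exp (- n * ln 16) * z2 x)" (is "_ \<le> ?rhs") for x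
  proof -
    have rhs: "E * (18 * step_lip\<^sup>2 / r\<^sup>2 * exp N1 * z1 x) \<le> ?rhs" "E * (18 * step_lip\<^sup>2 * exp (- n * ln 16) * z2 x) \<le> ?rhs" "0 \<le> ?rhs"
    proof -
      have "0 \<le> E * (18 * step_lip\<^sup>2 / r\<^sup>2 * exp N1 * z1 x)" "0 \<le> E * (18 * step_lip\<^sup>2 * exp (- n * ln 16) * z2 x)"
        by (intro mult_nonneg_nonneg Epos z0; simp)+
      then show "E * (18 * step_lip\<^sup>2 / r\<^sup>2 * exp N1 * z1 x) \<le> ?rhs" "E * (18 * step_lip\<^sup>2 * exp (- n * ln 16) * z2 x) \<le> ?rhs" "0 \<le> ?rhs"
        unfolding distrib_left by linarith+
    qed
    \<comment> \<open>The gradient of \<eta> lives on two disjoint annuli. Its square is at most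
      64/9 times \<open>step_lip\<^sup>2 / r\<^sup>2\<close> on the inner one and (36/17)^2 times
      \<open>step_lip\<^sup>2\<close> on the outer one; both factors are rounded up to 9.\<close>
    consider "norm x \<le> r/2" | "r/2 < norm x" "norm x \<le> r" | "r < norm x" "norm x < 4 \<or> 9/2 < norm x" | "4 \<le> norm x" "norm x \<le> 9/2"
      by linarith
    then show ?thesis
    proof cases
      case 1
      then have "partial i \<eta> x = 0" for i
        unfolding p\<eta> using r by (simp add: cutoff_gradient(2))
      then show ?thesis using rhs by (simp add: grad_sq_def)
    next
      case 2
      have "partial i \<eta> x = - partial i (cutoff (r/2) r) x" for i
        unfolding p\<eta> using r 2 by (simp add: cutoff_gradient(2) cutoff_eq_1)
      then have "grad_sq \<eta> x = grad_sq (cutoff (r/2) r) x" by (simp add: grad_sq_def)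
      also have "\<dots> \<le> (2 * step_lip * r / (r\<^sup>2 - (r/2)\<^sup>2))\<^sup>2" using r by (intro cutoff_gradient) auto
      also have "\<dots> = 64/9 * step_lip\<^sup>2 / r\<^sup>2"
        using r by (simp add: field_simps power2_eq_square)
      also have "\<dots> \<le> 9 * step_lip\<^sup>2 / r\<^sup>2" by (intro divide_right_mono mult_right_mono) auto
      finally have g: "grad_sq \<eta> x \<le> 9 * step_lip\<^sup>2 / r\<^sup>2" .
      have "(grad_sq \<eta> x * grad_sq v x) * exp (\<phi> x) \<le> (9 * step_lip\<^sup>2 / r\<^sup>2 * grad_sq v x) * (E * exp N1)"
        using 2 r by (intro mult_mono g \<phi>_le1) (auto simp: Epos)
      moreover have "z1 x = grad_sq v x" using 2 r by (simp add: z1_def cutoff_eq_1)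
      then have "E * (18 * step_lip\<^sup>2 / r\<^sup>2 * exp N1 * z1 x) = 2 * ((9 * step_lip\<^sup>2 / r\<^sup>2 * grad_sq v x) * (E * exp N1))"
        by simp
      ultimately show ?thesis using rhs(1) by linarith
    next
      case 3
      then have "partial i \<eta> x = 0" for i
        unfolding p\<eta> using r by (auto simp: cutoff_gradient(2))
      then show ?thesis using rhs by (simp add: grad_sq_def)
    next
      case 4
      have "partial i \<eta> x = partial i (cutoff 4 (9/2)) x" for i
        unfolding p\<eta> using r 4 by (simp add: cutoff_gradient(2) cutoff_eq_0)
      then have "grad_sq \<eta> x = grad_sq (cutoff 4 (9/2)) x" by (simp add: grad_sq_def)
      also have "\<dots> \<le> (2 * step_lip * (9/2) / ((9/2)\<^sup>2 - 4\<^sup>2))\<^sup>2" by (intro cutoff_gradient) auto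
      also have "\<dots> \<le> 9 * step_lip\<^sup>2" by (simp add: power_mult_distrib power_divide)
      finally have g: "grad_sq \<eta> x \<le> 9 * step_lip\<^sup>2" .
      have "(grad_sq \<eta> x * grad_sq v x) * exp (\<phi> x) \<le> (9 * step_lip\<^sup>2 * grad_sq v x) * (E * exp (- n * ln 16))"
        using 4 r by (intro mult_mono g \<phi>_le2) (auto simp: Epos)
      moreover have "z2 x = grad_sq v x" using 4 r by (simp add: z2_def cutoff_eq_1)
      then have "E * (18 * step_lip\<^sup>2 * exp (- n * ln 16) * z2 x) = 2 * ((9 * step_lip\<^sup>2 * grad_sq v x) * (E * exp (- n * ln 16)))"
        by simp
      ultimately show ?thesis using rhs(2) by linarith
    qed
  qed
  define RR where "RR x = E * (2 * \<epsilon>\<^sup>2 * exp N1 * b x + (18 * step_lip\<^sup>2 / r\<^sup>2 * exp N1 * z1 x + 18 * step_lip\<^sup>2 * exp (- n * ln 16) * z2 x))" for x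
  have "integral (cube 5) (\<lambda>x. (2 * \<epsilon>\<^sup>2 * ((\<eta> x)\<^sup>2 * b x) + 2 * grad_sq \<eta> x * grad_sq v x) * exp (\<phi> x)) \<le> integral (cube 5) RR"
  proof (rule integral_cube_le)
    show "smooth RR" unfolding RR_def by (intro smooth_intros b sz)
    show "smooth (\<lambda>x. (2 * \<epsilon>\<^sup>2 * ((\<eta> x)\<^sup>2 * b x) + 2 * grad_sq \<eta> x * grad_sq v x) * exp (\<phi> x))"
      by (intro smooth_intros b s\<eta> s\<phi> v)
    fix x
    have "2 * \<epsilon>\<^sup>2 * ((\<eta> x)\<^sup>2 * b x * exp (\<phi> x)) \<le> 2 * \<epsilon>\<^sup>2 * (E * exp N1 * b x)"
      by (intro mult_left_mono T1) auto
    with T2[of x] show "(2 * \<epsilon>\<^sup>2 * ((\<eta> x)\<^sup>2 * b x) + 2 * grad_sq \<eta> x * grad_sq v x) * exp (\<phi> x) \<le> RR x"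
      unfolding RR_def by (simp add: algebra_simps)
  qed
  also have "integral (cube 5) RR = E * (2 * \<epsilon>\<^sup>2 * exp N1 * B + (18 * step_lip\<^sup>2 / r\<^sup>2 * exp N1 * integral (cube 5) z1 + 18 * step_lip\<^sup>2 * exp (- n * ln 16) * integral (cube 5) z2))"
    unfolding RR_def B_def using b sz by (simp add: integral_add smooth_integrable_cube smooth_intros)
  finally have R: "integral (cube 5) (\<lambda>x. (\<eta> x)\<^sup>2 * grad_sq v x * exp (\<phi> x)) \<le> \<dots>"
    using E0 unfolding \<phi>_def by linarith
  have "exp (- n * ln 9) * integral (cbox l u) (\<lambda>x. grad_sq v x * exp (potential b \<delta> x)) \<le>
     integral (cube 5) (\<lambda>x. (\<eta> x)\<^sup>2 * grad_sq v x * exp (\<phi> x))"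
    if lu: "cbox l u \<subseteq> cube 2" "\<forall>x\<in>cbox l u. 1 \<le> norm x" for l u
  proof -
    have "exp (- n * ln 9) * integral (cbox l u) (\<lambda>x. grad_sq v x * exp (potential b \<delta> x))
      = integral (cbox l u) (\<lambda>x. exp (- n * ln 9) * (grad_sq v x * exp (potential b \<delta> x)))" by simp
    also have "\<dots> \<le> integral (cbox l u) (\<lambda>x. (\<eta> x)\<^sup>2 * grad_sq v x * exp (\<phi> x))"
    proof (rule integral_le)
      fix x assume x: "x \<in> cbox l u"
      then have x2: "\<bar>x$1\<bar> \<le> 2" "\<bar>x$2\<bar> \<le> 2" "1 \<le> norm x" using lu by (auto simp: mem_cube)
      have "(x$1)\<^sup>2 \<le> 2\<^sup>2" "(x$2)\<^sup>2 \<le> 2\<^sup>2"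
        using x2 by (simp_all only: abs_le_square_iff[symmetric])
      then have nx: "(norm x)\<^sup>2 \<le> 8" by (simp add: norm_sq_2)
      then have "norm x \<le> 4" by (simp add: power2_le_imp_le[of "norm x" 4])
      then have \<eta>x: "\<eta> x = 1" using x2 r by (simp add: \<eta>_def annulus_cutoff_def cutoff_eq_1 cutoff_eq_0)
      have "\<delta>\<^sup>2 \<le> 1" using \<delta> by (simp add: power_le_one)
      then have "ln ((norm x)\<^sup>2 + \<delta>\<^sup>2) \<le> ln 9"
        using nx kern_arg_pos[OF \<delta>(1), of x] by (subst ln_le_cancel_iff) auto
      then have "n * ln ((norm x)\<^sup>2 + \<delta>\<^sup>2) \<le> n * ln 9" using n by (rule mult_left_mono)
      then have "- n * ln 9 + potential b \<delta> x \<le> \<phi> x" unfolding \<phi> using zero_le_power2[of "norm x"] unfolding mult_minus_left by linarith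
      then have "exp (- n * ln 9) * exp (potential b \<delta> x) \<le> exp (\<phi> x)" unfolding exp_add[symmetric] by simp
      from mult_left_mono[OF this, of "grad_sq v x"]
      show "exp (- n * ln 9) * (grad_sq v x * exp (potential b \<delta> x)) \<le> (\<eta> x)\<^sup>2 * grad_sq v x * exp (\<phi> x)"
        by (simp add: \<eta>x algebra_simps)
    qed (intro smooth_integrable_cbox smooth_intros v sP s\<eta> s\<phi>)+
    also have "\<dots> \<le> integral (cube 5) (\<lambda>x. (\<eta> x)\<^sup>2 * grad_sq v x * exp (\<phi> x))"
    proof -
      have "cbox l u \<subseteq> cube 5" using lu(1) by (auto simp: mem_cube)
      then show ?thesis
        by (intro integral_subset_le smooth_integrable_cbox smooth_integrable_cube smooth_intros v s\<eta> s\<phi>) auto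
    qed
    finally show ?thesis .
  qed
  note main = order_trans[OF this R, unfolded E_def N1_def z1_def[abs_def] z2_def[abs_def]]
  show ?thesis
  proof (intro exI[of _ \<delta>] conjI \<delta> allI impI)
    fix l u :: "real^2" assume "cbox l u \<subseteq> cube 2 \<and> (\<forall>x\<in>cbox l u. 1 \<le> norm x)"
    then show "exp (- n * ln 9) * integral (cbox l u) (\<lambda>x. grad_sq v x * exp (potential b \<delta> x)) \<le>
      exp (16 * B + 25) * (2 * \<epsilon>\<^sup>2 * exp (n * ln (4 / r\<^sup>2)) * B
        + 18 * step_lip\<^sup>2 / r\<^sup>2 * exp (n * ln (4 / r\<^sup>2)) * integral (cube 5) (\<lambda>x. (cutoff r (2 * r) x)\<^sup>2 * grad_sq v x)
        + 18 * step_lip\<^sup>2 * exp (- n * ln 16) * integral (cube 5) (\<lambda>x. (cutoff (9/2) (24/5) x)\<^sup>2 * grad_sq v x))"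
      using main[of l u] unfolding add.assoc by blast
  qed
qed

section \<open>Maximum principle\<close>

lemma continuous_absolutely_integrable_on_bounded:
  fixes f :: "'a::euclidean_space \<Rightarrow> real"
  assumes "continuous_on UNIV f" "bounded S" "S \<in> sets lebesgue"
  shows "f absolutely_integrable_on S"
proof -
  obtain a where "S \<subseteq> cbox (- a) a" using bounded_subset_cbox_symmetric[OF assms(2)] by blast
  moreover have "f absolutely_integrable_on cbox (- a) a"
    using assms(1) by (intro absolutely_integrable_continuous) (auto intro: continuous_on_subset)
  ultimately show ?thesis using assms(3) set_integrable_subset by blast
qed

text \<open>Along the line in direction \<open>h\<close> the derivative \<open>g1\<close> vanishes
  at 0. If the second derivative were positive, \<open>g1\<close> would be positive just to the
  right of 0 and \<open>f\<close> would exceed its maximum.\<close>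

lemma smooth_interior_max:
  fixes f :: "real^'n \<Rightarrow> real"
  assumes f: "smooth f" and S: "open S" "x \<in> S" and max: "\<And>y. y \<in> S \<Longrightarrow> f y \<le> f x"
  shows "partial i f x = 0"
    and "(\<Sum>i\<in>UNIV. h$i * (\<Sum>j\<in>UNIV. h$j * partial j (partial i f) x)) \<le> 0"
proof -
  have "(\<lambda>h. \<Sum>i\<in>UNIV. h$i * partial i f x) = (\<lambda>v. 0)"
    using differential_zero_maxmin[OF S(2,1) smooth_has_derivative[OF f]] max by blast
  from fun_cong[OF this, of "axis _ 1"] show 0: "partial i f x = 0" for i
    by (simp add: axis_def if_distrib[of "\<lambda>x. x * _"] cong: if_cong)
  define g1 where "g1 s = (\<Sum>i\<in>UNIV. h$i * partial i f (x + s *\<^sub>R h))" for s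
  have g: "((\<lambda>s. f (x + s *\<^sub>R h)) has_real_derivative g1 s) (at s)" for s
    unfolding g1_def by (rule smooth_has_real_derivative_line[OF f])
  have g1: "(g1 has_real_derivative (\<Sum>i\<in>UNIV. h$i * (\<Sum>j\<in>UNIV. h$j * partial j (partial i f) (x + s *\<^sub>R h)))) (at s)" for s
    unfolding g1_def
    by (auto intro!: DERIV_sum DERIV_cmult smooth_has_real_derivative_line smooth_partial f)
  have g10: "g1 0 = 0" by (simp add: g1_def 0)
  show "(\<Sum>i\<in>UNIV. h$i * (\<Sum>j\<in>UNIV. h$j * partial j (partial i f) x)) \<le> 0"
  proof (rule ccontr)
    assume "\<not> ?thesis"
    then obtain d where d: "d > 0" "\<And>s. 0 < s \<Longrightarrow> s < d \<Longrightarrow> 0 < g1 s"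
      using DERIV_pos_inc_right[OF g1[of 0]] g10 by auto
    have "((\<lambda>s. x + s *\<^sub>R h) \<longlongrightarrow> x + 0 *\<^sub>R h) (at_right 0)"
      by (intro tendsto_intros)
    then have "\<forall>\<^sub>F s in at_right 0. x + s *\<^sub>R h \<in> S"
      using S by (auto dest: topological_tendstoD)
    moreover have "\<forall>\<^sub>F s in at_right 0. 0 < s \<and> s < d"
      using d(1) by (auto simp: eventually_at_right)
    ultimately have "\<forall>\<^sub>F s in at_right 0. 0 < s \<and> s < d \<and> x + s *\<^sub>R h \<in> S"
      by eventually_elim auto
    then obtain s where s: "0 < s" "s < d" "x + s *\<^sub>R h \<in> S"
      using eventually_happens'[OF trivial_limit_at_right_real] by blast
    obtain z where z: "0 < z" "z < s" "f (x + s *\<^sub>R h) - f (x + 0 *\<^sub>R h) = (s - 0) * g1 z"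
      using MVT2[OF s(1), of "\<lambda>s. f (x + s *\<^sub>R h)" g1] g by blast
    then have "f (x + s *\<^sub>R h) > f x" using d(2)[of z] s by (smt (verit) mult_pos_pos scale_zero_left add.right_neutral)
    then show False using max[OF s(3)] by simp
  qed
qed

text \<open>The test vector \<open>(c, - a)\<close> gives \<open>a\<close> times the determinant.
  When \<open>a = 0\<close> and \<open>c\<close> is nonzero, the vector used in the proof makes the
  form equal to 1.\<close>

lemma nonpos_form_det_nonneg:
  fixes a c e :: real
  assumes "\<And>s t. s * (s * a + t * c) + t * (s * c + t * e) \<le> 0"
  shows "0 \<le> a * e - c * c"
proof (cases "a = 0")
  case True
  have "c = 0"
  proof (rule ccontr)
    assume "c \<noteq> 0"
    then show False using assms[of "(1 - e) / (2 * c)" 1] True by (simp add: field_simps)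
  qed
  then show ?thesis using True by simp
next
  case False
  have "a \<le> 0" using assms[of 1 0] by simp
  moreover have "a * (a * e - c * c) \<le> 0" using assms[of c "-a"] by (simp add: algebra_simps)
  ultimately show ?thesis using False by (simp add: mult_le_0_iff)
qed

text \<open>Each dyadic annulus between radii s and 2 s contributes at least 1: its area is 3 pi s^2
  and the integrand is at least 1 / (5 s^2). This logarithmic divergence is what limits the number
  of doublings by the mass of \<open>b\<close>.\<close>

lemma integral_inverse_sq_ball_ge:
  assumes "0 < \<epsilon>"
  shows "real N \<le> integral (ball 0 (2 ^ N * \<epsilon>)) (\<lambda>p::real^2. 1 / ((norm p)\<^sup>2 + \<epsilon>\<^sup>2))"
proof (induction N)
  case 0
  have "0 \<le> integral (ball 0 \<epsilon>) (\<lambda>p::real^2. 1 / ((norm p)\<^sup>2 + \<epsilon>\<^sup>2))"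
    by (cases "(\<lambda>p::real^2. 1 / ((norm p)\<^sup>2 + \<epsilon>\<^sup>2)) integrable_on ball 0 \<epsilon>")
       (auto intro: integral_nonneg simp: not_integrable_integral)
  then show ?case by simp
next
  case (Suc N)
  let ?f = "\<lambda>p::real^2. 1 / ((norm p)\<^sup>2 + \<epsilon>\<^sup>2)"
  define s where "s = 2 ^ N * \<epsilon>"
  have s: "s \<ge> \<epsilon>" "s > 0" using assms by (simp_all add: s_def)
  have cont: "continuous_on UNIV ?f"
    using assms by (intro continuous_intros) (auto simp: add_nonneg_eq_0_iff)
  have int: "?f integrable_on S" if "bounded S" "S \<in> sets lebesgue" for S
    using continuous_absolutely_integrable_on_bounded[OF cont that]
    by (rule set_lebesgue_integral_eq_integral)
  define A where "A = ball 0 (2 * s) - ball (0::real^2) s"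
  have A: "A \<in> lmeasurable" by (auto simp: A_def intro: fmeasurable.Diff)
  have mA: "measure lebesgue A = 3 * pi * s\<^sup>2"
    unfolding A_def using s
    by (subst measurable_measure_Diff) (auto simp: content_ball unit_ball_vol_2 power_mult_distrib)
  have "1 \<le> 1 / (5 * s\<^sup>2) * measure lebesgue A"
    unfolding mA using s pi_ge_two by simp
  also have "\<dots> = integral A (\<lambda>p. 1 / (5 * s\<^sup>2))"
    using lmeasure_integral[OF A] integral_mult_right[of A "1 / (5 * s\<^sup>2)" "\<lambda>_. 1"] by simp
  also have "\<dots> \<le> integral A ?f"
  proof (rule integral_le)
    show "(\<lambda>p. 1 / (5 * s\<^sup>2)) integrable_on A" using A integrable_on_const by blast
    show "?f integrable_on A" using A by (intro int) (auto simp: A_def bounded_diff)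
    fix p assume "p \<in> A"
    then have "(norm p)\<^sup>2 \<le> (2 * s)\<^sup>2" by (intro power_mono) (auto simp: A_def)
    moreover have "\<epsilon>\<^sup>2 \<le> s\<^sup>2" using s assms by (intro power_mono) auto
    ultimately have "(norm p)\<^sup>2 + \<epsilon>\<^sup>2 \<le> 5 * s\<^sup>2" by (simp add: power_mult_distrib)
    then show "1 / (5 * s\<^sup>2) \<le> ?f p"
      using add_nonneg_pos[OF zero_le_power2[of "norm p"] zero_less_power[OF assms, of 2]]
      by (intro frac_le) auto
  qed
  finally have "1 \<le> integral A ?f" .
  moreover have "integral (ball 0 (2 * s)) ?f = integral (ball 0 s) ?f + integral A ?f"
  proof -
    have "integral (ball 0 s \<union> A) ?f = integral (ball 0 s) ?f + integral A ?f"
      using A by (intro integral_Un int) (auto simp: A_def bounded_diff)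
    moreover have "ball 0 s \<union> A = ball 0 (2 * s)" using s by (auto simp: A_def)
    ultimately show ?thesis by simp
  qed
  ultimately show ?case using Suc by (simp add: s_def mult.assoc)
qed

text \<open>The Aleksandrov--Bakelman--Pucci argument. The weight \<open>1 / (\<bar>p\<bar>\<^sup>2 + \<epsilon>\<^sup>2)\<close> on the gradient image
  turns the critical \<open>L\<^sup>2\<close> bound on the drift into a logarithmic bound.\<close>

lemma abp_maximum_principle:
  fixes v b :: "real^2 \<Rightarrow> real"
  assumes v: "smooth v" and b: "smooth b" "\<And>x. 0 \<le> b x"
    and eq: "\<And>x. (lapl v x)\<^sup>2 \<le> b x * (grad_sq v x + \<epsilon>\<^sup>2)" and \<epsilon>: "0 < \<epsilon>"
    and R: "cbox l u \<subseteq> cube 2" and x0: "x0 \<in> cbox l u"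
    and bdry: "\<And>y. y \<in> cbox l u \<Longrightarrow> y \<notin> box l u \<Longrightarrow> v y \<le> m"
    and gt: "m + 8 * (2 ^ N * \<epsilon>) < v x0"
  shows "real N \<le> integral (cube 5) b"
proof -
  define \<tau> where "\<tau> = 2 ^ N * \<epsilon>"
  have \<tau>: "\<tau> > 0" using \<epsilon> by (simp add: \<tau>_def)
  define g :: "real^2 \<Rightarrow> real^2" where "g x = (\<chi> i. partial i v x)" for x
  define g' :: "real^2 \<Rightarrow> real^2 \<Rightarrow> real^2" where "g' x h = (\<chi> i. \<Sum>j\<in>UNIV. h$j * partial j (partial i v) x)" for x h
  have der: "(g has_derivative g' x) (at x within S)" for x S
  proof (rule has_derivative_componentwise_within[THEN iffD2], rule ballI)
    fix e :: "real^2" assume "e \<in> Basis"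
    then obtain j where e: "e = axis j 1" by (auto simp: Basis_vec_def)
    have "(partial j v has_derivative (\<lambda>h. \<Sum>i\<in>UNIV. h$i * partial i (partial j v) x)) (at x within S)"
      by (rule has_derivative_at_withinI[OF smooth_has_derivative[OF smooth_partial[OF v]]])
    then show "((\<lambda>x. g x \<bullet> e) has_derivative (\<lambda>h. g' x h \<bullet> e)) (at x within S)"
      by (simp add: e inner_axis g_def g'_def)
  qed
  have det: "det (matrix (g' x)) = partial 1 (partial 1 v) x * partial 2 (partial 2 v) x - partial 2 (partial 1 v) x * partial 2 (partial 1 v) x" for x
    by (simp add: det_2 matrix_def g'_def sum_2 axis_def partial_commute[OF v, of 2 1])
  have ng: "(norm (g x))\<^sup>2 = grad_sq v x" for x by (simp add: norm_sq_2 g_def grad_sq_def)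
  define f where "f p = 1 / ((norm p)\<^sup>2 + \<epsilon>\<^sup>2)" for p :: "real^2"
  \<comment> \<open>A closed condition, so that \<open>S\<close> is compact. Interior maxima of
    tilted copies of \<open>v\<close> belong to it, since the Hessian is negative semidefinite
    there.\<close>
  define S where "S = {x \<in> cbox l u. 0 \<le> det (matrix (g' x))}"
  have cdet: "continuous_on UNIV (\<lambda>x. det (matrix (g' x)))"
    unfolding det by (intro smooth_imp_continuous_on smooth_intros v)
  have S: "compact S"
  proof -
    have "closed {x. 0 \<le> det (matrix (g' x))}"
      by (rule closed_Collect_le[OF continuous_on_const cdet])
    then have "compact (cbox l u \<inter> {x. 0 \<le> det (matrix (g' x))})" by (intro compact_Int_closed compact_cbox)
    moreover have "cbox l u \<inter> {x. 0 \<le> det (matrix (g' x))} = S" by (auto simp: S_def)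
    ultimately show ?thesis by simp
  qed
  have S_leb: "S \<in> sets lebesgue" "bounded S" using S by (auto simp: compact_imp_bounded lmeasurable_compact fmeasurableD)
  have pos: "0 < grad_sq v x + \<epsilon>\<^sup>2" for x using \<epsilon> by (simp add: add_nonneg_pos)
  have c1: "continuous_on UNIV (\<lambda>x. \<bar>det (matrix (g' x))\<bar> * f (g x))"
    unfolding f_def ng using pos
    by (intro continuous_intros cdet smooth_imp_continuous_on smooth_intros v) (simp add: less_imp_neq[symmetric])
  have i1: "(\<lambda>x. \<bar>det (matrix (g' x))\<bar> * f (g x)) integrable_on S"
    using continuous_absolutely_integrable_on_bounded[OF c1 S_leb(2,1)] by (rule set_lebesgue_integral_eq_integral)
  \<comment> \<open>The area formula as an inequality: the gradient map may fail to be injective,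
    and overlaps only help.\<close>
  have img: "f integrable_on (g ` S) \<and> integral (g ` S) f \<le> integral S (\<lambda>x. \<bar>det (matrix (g' x))\<bar> * f (g x))"
    by (rule integral_on_image_ubound_nonneg[OF _ der i1]) (simp add: f_def)
  \<comment> \<open>For a slope \<open>p\<close> of norm below \<tau>, tilting by \<open>p\<close>
    changes differences by at most \<open>8 * \<tau>\<close> on a rectangle inside
    \<open>cube 2\<close>, less than the excess of \<open>v x0\<close> over the boundary values. So
    the tilted function has an interior maximum, where the gradient of \<open>v\<close> is
    \<open>p\<close>.\<close>
  have sub: "ball 0 \<tau> \<subseteq> g ` S"
  proof
    fix p :: "real^2" assume p: "p \<in> ball 0 \<tau>"
    define w where "w x = v x - (\<Sum>i\<in>UNIV. p$i * x$i)" for x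
    have sw: "smooth w" unfolding w_def by (intro smooth_intros smooth_sum v)
    have "\<exists>z\<in>cbox l u. \<forall>y\<in>cbox l u. w y \<le> w z"
      using x0 by (intro continuous_attains_sup compact_cbox smooth_imp_continuous_on sw) auto
    then obtain z where z: "z \<in> cbox l u" "\<And>y. y \<in> cbox l u \<Longrightarrow> w y \<le> w z" by blast
    have "z \<in> box l u"
    proof (rule ccontr)
      assume "z \<notin> box l u"
      then have "v z \<le> m" using bdry z by blast
      moreover have "w x0 \<le> w z" using z x0 by blast
      moreover have "(\<Sum>i\<in>UNIV. p$i * x0$i) - (\<Sum>i\<in>UNIV. p$i * z$i) \<le> 8 * \<tau>"
      proof -
        have "(\<Sum>i\<in>UNIV. p$i * x0$i) - (\<Sum>i\<in>UNIV. p$i * z$i) = p \<bullet> (x0 - z)"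
          by (simp add: inner_vec_def sum_2 algebra_simps)
        also have "\<dots> \<le> norm p * norm (x0 - z)" by (rule norm_cauchy_schwarz)
        also have "\<dots> \<le> \<tau> * 8"
        proof (intro mult_mono)
          have "norm (x0 - z) \<le> \<bar>(x0 - z)$1\<bar> + \<bar>(x0 - z)$2\<bar>"
            using norm_le_l1_cart[of "x0 - z"] by (simp add: sum_2)
          moreover have "x0 \<in> cube 2" "z \<in> cube 2" using R x0 z(1) by auto
          ultimately show "norm (x0 - z) \<le> 8" unfolding mem_cube vector_minus_component by arith
        qed (use p \<tau> in auto)
        finally show ?thesis by simp
      qed
      ultimately show False using gt by (simp add: w_def \<tau>_def)
    qed
    then have int: "open (box l u)" "z \<in> box l u" "\<And>y. y \<in> box l u \<Longrightarrow> w y \<le> w z"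
      using z box_subset_cbox by auto
    have pw: "partial i w = (\<lambda>x. partial i v x - p$i)" for i
      unfolding w_def[abs_def] using v exhaust_2[of i]
      by (auto simp: fun_eq_iff partial_smooth_diff smooth_sum smooth_intros partial_smooth_sum partial_rules sum_2 if_distrib)
    have "g z = p"
      using smooth_interior_max(1)[OF sw int] by (simp add: g_def vec_eq_iff pw)
    moreover have "0 \<le> det (matrix (g' z))"
      unfolding det
    proof (rule nonpos_form_det_nonneg)
      fix s t :: real
      have pp: "partial j (partial i w) z = partial j (partial i v) z" for i j
        unfolding pw by (simp add: partial_smooth_diff smooth_intros v)
      show "s * (s * partial 1 (partial 1 v) z + t * partial 2 (partial 1 v) z) + t * (s * partial 2 (partial 1 v) z + t * partial 2 (partial 2 v) z) \<le> 0"
        using smooth_interior_max(2)[OF sw int, of "vector [s, t]"]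
        by (simp add: sum_2 pp vector_2 partial_commute[OF v, of 1 2])
    qed
    ultimately show "p \<in> g ` S" using z(1) by (auto simp: S_def)
  qed
  have "real N \<le> integral (ball 0 \<tau>) f"
    unfolding f_def \<tau>_def using integral_inverse_sq_ball_ge[OF \<epsilon>] .
  also have "\<dots> \<le> integral (g ` S) f"
  proof (rule integral_subset_le[OF sub])
    have "continuous_on UNIV f"
      unfolding f_def using \<epsilon> by (intro continuous_intros) (auto simp: add_nonneg_eq_0_iff)
    then show "f integrable_on ball 0 \<tau>"
      by (intro set_lebesgue_integral_eq_integral(1) continuous_absolutely_integrable_on_bounded) auto
  qed (use img in \<open>auto simp: f_def\<close>)
  also have "\<dots> \<le> integral S (\<lambda>x. \<bar>det (matrix (g' x))\<bar> * f (g x))" using img by blast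
  also have "\<dots> \<le> integral S b"
  proof (rule integral_le[OF i1])
    show "b integrable_on S"
      using smooth_imp_continuous_on[OF b(1)] S_leb by (intro set_lebesgue_integral_eq_integral(1) continuous_absolutely_integrable_on_bounded)
    \<comment> \<open>The nonnegative Hessian determinant is at most the squared Laplacian, and the
      weight \<open>1 / (grad_sq v x + \<epsilon>\<^sup>2)\<close> cancels the gradient factor in
      \<open>eq\<close>, so that \<open>b x\<close> remains as upper bound.\<close>
    fix x assume "x \<in> S"
    then have "\<bar>det (matrix (g' x))\<bar> = det (matrix (g' x))" by (simp add: S_def)
    also have "\<dots> \<le> (lapl v x)\<^sup>2"
    proof -
      have "0 \<le> (partial 1 (partial 1 v) x)\<^sup>2 + (partial 2 (partial 2 v) x)\<^sup>2 + (partial 1 (partial 1 v) x + partial 2 (partial 2 v) x)\<^sup>2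
        + 2 * (partial 2 (partial 1 v) x)\<^sup>2" by simp
      then show ?thesis unfolding det lapl_def by (simp add: power2_eq_square algebra_simps)
    qed
    also have "\<dots> \<le> b x * (grad_sq v x + \<epsilon>\<^sup>2)" by (rule eq)
    finally show "\<bar>det (matrix (g' x))\<bar> * f (g x) \<le> b x"
      using pos[of x] by (simp add: f_def ng field_simps)
  qed
  also have "\<dots> \<le> integral (cube 5) b"
  proof (rule integral_subset_le)
    show "S \<subseteq> cube 5" using R by (auto simp: S_def mem_cube)
    show "b integrable_on S"
      using smooth_imp_continuous_on[OF b(1)] S_leb by (intro set_lebesgue_integral_eq_integral(1) continuous_absolutely_integrable_on_bounded)
  qed (use b in auto)
  finally show ?thesis .
qed

section \<open>Lines on which the potential is bounded below\<close>

abbreviation vec2 :: "real \<Rightarrow> real \<Rightarrow> real^2" where "vec2 s t \<equiv> vector [s, t]"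

lemma vec2_eta: "vec2 (x$1) (x$2) = x"
  by (simp add: vec_eq_iff forall_2 vector_2)

lemma vec2_axis: "vec2 s t = s *\<^sub>R axis 1 1 + t *\<^sub>R axis 2 1"
  by (simp add: vec_eq_iff forall_2 vector_2 axis_def)

lemma continuous_on_vec2 [continuous_intros]:
  "continuous_on S f \<Longrightarrow> continuous_on S g \<Longrightarrow> continuous_on S (\<lambda>x. vec2 (f x) (g x))"
  unfolding vec2_axis by (intro continuous_intros)

text \<open>Identifies the plane with \<open>real \<times> real\<close>, from which
  \<open>integral_vec2\<close> takes the iterated integrals in both orders.\<close>

lemma lborel_eq_distr_vec2: "(lborel :: (real^2) measure) = distr (lborel :: (real \<times> real) measure) borel (\<lambda>p. vec2 (fst p) (snd p))"
proof (rule lborel_eqI)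
  have m: "(\<lambda>p. vec2 (fst p) (snd p)) \<in> borel_measurable (lborel :: (real \<times> real) measure)"
    by (simp add: borel_measurable_continuous_onI continuous_on_vec2 continuous_on_fst continuous_on_snd continuous_on_id)
  fix l u :: "real^2" assume le: "\<And>b. b \<in> Basis \<Longrightarrow> l \<bullet> b \<le> u \<bullet> b"
  have le': "l$i \<le> u$i" for i using le[of "axis i 1"] by (simp add: inner_axis)
  have "emeasure (distr lborel borel (\<lambda>p. vec2 (fst p) (snd p))) (box l u)
     = emeasure lborel ((\<lambda>p::real\<times>real. vec2 (fst p) (snd p)) -` box l u)"
    using m by (subst emeasure_distr) auto
  also have "(\<lambda>p::real\<times>real. vec2 (fst p) (snd p)) -` box l u = box (l$1, l$2) (u$1, u$2)"
    by (auto simp: mem_box_cart forall_2 vector_2 mem_box Basis_prod_def inner_prod_def)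
  also have "emeasure lborel \<dots> = ennreal ((u$1 - l$1) * (u$2 - l$2))"
    using le' by (subst emeasure_lborel_box) (auto simp: Basis_prod_def prod.union_disjoint)
  also have "(u$1 - l$1) * (u$2 - l$2) = (\<Prod>b\<in>Basis. (u - l) \<bullet> b)"
  proof -
    have "Basis = {axis 1 1, axis 2 (1::real) :: real^2}"
      unfolding Basis_vec_def UNIV_2 by auto
    then have "(\<Prod>b\<in>Basis. (u - l) \<bullet> b) = (\<Prod>b\<in>{axis 1 1, axis 2 1}. (u - l) \<bullet> b)" by metis
    also have "\<dots> = (u$1 - l$1) * (u$2 - l$2)"
      by (subst prod.insert) (auto simp: axis_eq_axis inner_axis)
    finally show ?thesis by simp
  qed
  finally show "emeasure (distr lborel borel (\<lambda>p. vec2 (fst p) (snd p))) (box l u) = (\<Prod>b\<in>Basis. (u - l) \<bullet> b)" .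
qed simp

lemma integral_vec2:
  assumes G: "continuous_on UNIV (G :: real^2 \<Rightarrow> real)"
  shows "integral (cbox (vec2 a c) (vec2 b d)) G = integral {a..b} (\<lambda>s. integral {c..d} (\<lambda>t. G (vec2 s t)))"
    and "integral (cbox (vec2 a c) (vec2 b d)) G = integral {c..d} (\<lambda>t. integral {a..b} (\<lambda>s. G (vec2 s t)))"
proof -
  let ?T = "\<lambda>p. vec2 (fst p) (snd p)"
  have T: "?T \<in> borel_measurable (lborel :: (real \<times> real) measure)"
    by (simp add: borel_measurable_continuous_onI continuous_on_vec2 continuous_on_fst continuous_on_snd continuous_on_id)
  have GT: "continuous_on S (\<lambda>p. G (?T p))" for S
    by (intro continuous_on_compose2[OF G] continuous_intros) auto
  have G': "G \<in> borel_measurable borel" using G by (rule borel_measurable_continuous_onI)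
  have "integral (cbox (vec2 a c) (vec2 b d)) G = (LINT x:cbox (vec2 a c) (vec2 b d)|lborel. G x)"
  proof (intro set_borel_integral_eq_integral(2)[symmetric])
    show "set_integrable lborel (cbox (vec2 a c) (vec2 b d)) G"
      unfolding set_integrable_def
      by (intro borel_integrable_compact compact_cbox continuous_on_subset[OF G]) auto
  qed
  also have "\<dots> = (LINT p|lborel. indicator (cbox (vec2 a c) (vec2 b d)) (?T p) *\<^sub>R G (?T p))"
    unfolding set_lebesgue_integral_def using G'
    by (subst lborel_eq_distr_vec2, subst integral_distr[OF T]) auto
  also have "(\<lambda>p. indicator (cbox (vec2 a c) (vec2 b d)) (?T p) *\<^sub>R G (?T p)) = (\<lambda>p. indicator (cbox (a,c) (b,d)) p *\<^sub>R G (?T p))"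
    by (auto simp: fun_eq_iff indicator_def mem_box_cart forall_2 vector_2 cbox_Pair_eq)
  also have "(LINT p|lborel. \<dots> p) = (LINT p:cbox (a,c) (b,d)|lborel. G (?T p))"
    unfolding set_lebesgue_integral_def ..
  also have "\<dots> = integral (cbox (a,c) (b,d)) (\<lambda>p. G (?T p))"
  proof (intro set_borel_integral_eq_integral(2))
    show "set_integrable lborel (cbox (a,c) (b,d)) (\<lambda>p. G (?T p))"
      unfolding set_integrable_def by (intro borel_integrable_compact compact_cbox GT)
  qed
  also have "\<dots> = integral (cbox a b) (\<lambda>s. integral (cbox c d) (\<lambda>t. G (?T (s,t))))"
    by (intro integral_prod_continuous GT)
  finally show 1: "integral (cbox (vec2 a c) (vec2 b d)) G = integral {a..b} (\<lambda>s. integral {c..d} (\<lambda>t. G (vec2 s t)))"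
    by simp
  also have "\<dots> = integral {c..d} (\<lambda>t. integral {a..b} (\<lambda>s. G (vec2 s t)))"
    using integral_swap_continuous[of a c b d "\<lambda>s t. G (vec2 s t)"] GT[of "cbox (a,c) (b,d)"]
    by (simp add: split_beta)
  finally show "integral (cbox (vec2 a c) (vec2 b d)) G = integral {c..d} (\<lambda>t. integral {a..b} (\<lambda>s. G (vec2 s t)))" .
qed

text \<open>The expression is an antiderivative of
  \<open>ln (x\<^sup>2 + \<delta>\<^sup>2) / 2\<close>; the point is a bound independent of
  \<delta>. The range 7 covers differences between a coordinate in \<open>{-2..2}\<close> and one in
  \<open>{-5..5}\<close>.\<close>

lemma log_antiderivative_bound:
  fixes x :: real
  assumes "0 < \<delta>" "\<delta> \<le> 1" "\<bar>x\<bar> \<le> 7"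
  shows "\<bar>x * ln (x\<^sup>2 + \<delta>\<^sup>2) / 2 - x + \<delta> * arctan (x / \<delta>)\<bar> \<le> 200"
proof -
  define y where "y = x\<^sup>2 + \<delta>\<^sup>2"
  have y: "y > 0" using assms by (simp add: y_def add_nonneg_pos)
  have "x\<^sup>2 \<le> 7\<^sup>2" using assms(3) by (subst abs_le_square_iff[symmetric]) simp
  moreover have "\<delta>\<^sup>2 \<le> 1" using assms by (simp add: power_le_one)
  ultimately have "y \<le> 50" by (simp add: y_def)
  then have up: "ln y \<le> 49" using ln_le_minus_one[OF y] by simp
  have "\<bar>x\<bar> \<le> sqrt y" unfolding y_def by (simp add: real_le_rsqrt)
  \<comment> \<open>Near 0 the logarithm is beaten by its factor:
    \<open>- ln y \<le> 2 / sqrt y\<close> and \<open>\<bar>x\<bar> \<le> sqrt y\<close>.\<close>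
  have low: "- (\<bar>x\<bar> * ln y) \<le> 2"
  proof -
    have "- ln (sqrt y) \<le> inverse (sqrt y) - 1"
      using ln_le_minus_one[of "inverse (sqrt y)"] y by (simp add: ln_inverse)
    then have "- ln y \<le> 2 * inverse (sqrt y)" using y by (simp add: ln_sqrt)
    then have "\<bar>x\<bar> * - ln y \<le> \<bar>x\<bar> * (2 * inverse (sqrt y))" by (rule mult_left_mono) simp
    also have "\<dots> \<le> sqrt y * (2 * inverse (sqrt y))" using \<open>\<bar>x\<bar> \<le> sqrt y\<close> y by (intro mult_right_mono) auto
    also have "\<dots> = 2" using y by simp
    finally show ?thesis by simp
  qed
  have "\<bar>x\<bar> * ln y \<le> 7 * 49"
  proof (cases "ln y \<ge> 0")
    case True then show ?thesis using assms(3) up by (intro mult_mono) auto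
  next
    case False then have "\<bar>x\<bar> * ln y \<le> 0" by (simp add: mult_nonneg_nonpos)
    then show ?thesis by simp
  qed
  with low have 1: "\<bar>x * ln y\<bar> \<le> 343" by (auto simp: abs_if split: if_splits)
  have "\<bar>arctan (x / \<delta>)\<bar> \<le> 2"
    using arctan_bounded[of "x / \<delta>"] pi_less_4 by (simp add: abs_le_iff)
  then have 2: "\<bar>\<delta> * arctan (x / \<delta>)\<bar> \<le> 1 * 2"
    using assms unfolding abs_mult by (intro mult_mono) auto
  show ?thesis using 1 2 assms(3) unfolding y_def[symmetric] by simp
qed

lemma integral_log_ge:
  fixes \<delta> a \<tau> :: real
  assumes "0 < \<delta>" "\<delta> \<le> 1" "- 2 \<le> a" "a \<le> 5/4" "\<bar>\<tau>\<bar> \<le> 5"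
  shows "- 400 \<le> integral {a..a+3/4} (\<lambda>s. ln ((s - \<tau>)\<^sup>2 + \<delta>\<^sup>2) / 2)"
proof -
  define F where "F x = x * ln (x\<^sup>2 + \<delta>\<^sup>2) / 2 - x + \<delta> * arctan (x / \<delta>)" for x
  have pos: "0 < x\<^sup>2 + \<delta>\<^sup>2" for x using assms by (simp add: add_nonneg_pos)
  have F: "(F has_real_derivative ln (x\<^sup>2 + \<delta>\<^sup>2) / 2) (at x)" for x
  proof -
    have 1: "\<delta> * (inverse (1 + (x / \<delta>)\<^sup>2) * (1 / \<delta>)) = \<delta>\<^sup>2 / (x\<^sup>2 + \<delta>\<^sup>2)"
      using assms(1) by (simp add: field_simps power2_eq_square)
    have 2: "x * (2 * x / (x\<^sup>2 + \<delta>\<^sup>2)) / 2 - 1 + \<delta>\<^sup>2 / (x\<^sup>2 + \<delta>\<^sup>2) = 0"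
    proof -
      have "x * (2 * x / Y) / 2 - 1 + \<delta>\<^sup>2 / Y = (x\<^sup>2 + \<delta>\<^sup>2) / Y - 1" for Y
        by (simp add: power2_eq_square add_divide_distrib)
      from this[of "x\<^sup>2 + \<delta>\<^sup>2"] show ?thesis using pos[of x]
        by (metis divide_self less_irrefl diff_self)
    qed
    have d1: "((\<lambda>x. x\<^sup>2 + \<delta>\<^sup>2) has_real_derivative 2 * x) (at x)"
      by (auto intro!: derivative_eq_intros)
    have d2: "((\<lambda>x. ln (x\<^sup>2 + \<delta>\<^sup>2)) has_real_derivative 2 * x / (x\<^sup>2 + \<delta>\<^sup>2)) (at x)"
      using DERIV_chain2[OF DERIV_ln[OF pos] d1] by (simp add: divide_inverse mult.commute)
    have d3: "((\<lambda>x. arctan (x / \<delta>)) has_real_derivative inverse (1 + (x / \<delta>)\<^sup>2) * (1 / \<delta>)) (at x)"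
      by (rule DERIV_chain2[OF DERIV_arctan]) (use assms(1) in \<open>auto intro!: derivative_eq_intros\<close>)
    have "(F has_real_derivative (1 * ln (x\<^sup>2 + \<delta>\<^sup>2) + 2 * x / (x\<^sup>2 + \<delta>\<^sup>2) * x) / 2 - 1
      + \<delta> * (inverse (1 + (x / \<delta>)\<^sup>2) * (1 / \<delta>))) (at x)"
      unfolding F_def
      by (intro DERIV_add DERIV_diff DERIV_cdivide DERIV_mult d2 DERIV_cmult d3 DERIV_ident)
    moreover have "(1 * ln (x\<^sup>2 + \<delta>\<^sup>2) + 2 * x / (x\<^sup>2 + \<delta>\<^sup>2) * x) / 2 - 1
      + \<delta> * (inverse (1 + (x / \<delta>)\<^sup>2) * (1 / \<delta>)) = ln (x\<^sup>2 + \<delta>\<^sup>2) / 2"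
    proof -
      have "(1 * L + 2 * x / Y * x) / 2 = L / 2 + x * (2 * x / Y) / 2" for L Y
        by (simp add: add_divide_distrib)
      from this[of "ln (x\<^sup>2 + \<delta>\<^sup>2)" "x\<^sup>2 + \<delta>\<^sup>2"] show ?thesis unfolding 1 using 2 by linarith
    qed
    ultimately show ?thesis by metis
  qed
  have "((\<lambda>s. ln ((s - \<tau>)\<^sup>2 + \<delta>\<^sup>2) / 2) has_integral F (a + 3/4 - \<tau>) - F (a - \<tau>)) {a..a+3/4}"
  proof (rule fundamental_theorem_of_calculus)
    fix s
    have "((\<lambda>s. F (s - \<tau>)) has_real_derivative ln ((s - \<tau>)\<^sup>2 + \<delta>\<^sup>2) / 2 * 1) (at s)"
      by (rule DERIV_chain2[OF F]) (auto intro!: derivative_eq_intros)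
    then show "((\<lambda>s. F (s - \<tau>)) has_vector_derivative ln ((s - \<tau>)\<^sup>2 + \<delta>\<^sup>2) / 2) (at s within {a..a+3/4})"
      by (simp add: has_real_derivative_iff_has_vector_derivative has_vector_derivative_at_within)
  qed simp
  moreover have "\<bar>F (a + 3/4 - \<tau>)\<bar> \<le> 200" "\<bar>F (a - \<tau>)\<bar> \<le> 200"
    unfolding F_def using assms by (auto intro!: log_antiderivative_bound)
  ultimately show ?thesis by (smt (verit) integral_unique)
qed

text \<open>Discarding the other coordinate of \<open>x - t\<close> makes the logarithm smaller and
  constant along a line. So this is a lower bound for the potential on a whole line at once. At a
  single \<open>s\<close> it may be as low as a multiple of \<open>ln \<delta>\<close>, but its mean
  over \<open>s\<close> is controlled.\<close>

definition line_potential :: "2 \<Rightarrow> (real^2 \<Rightarrow> real) \<Rightarrow> real \<Rightarrow> real \<Rightarrow> real" where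
  "line_potential i b \<delta> s = integral (cube 5) (\<lambda>t. 4 * b t * (ln ((s - t$i)\<^sup>2 + \<delta>\<^sup>2) / 2))"

lemma continuous_line_potential_integrand:
  assumes "smooth b" "0 < \<delta>"
  shows "continuous_on S (\<lambda>p. 4 * b (snd p) * (ln ((fst p - snd p$i)\<^sup>2 + \<delta>\<^sup>2) / 2))"
proof -
  have "x\<^sup>2 + \<delta>\<^sup>2 \<noteq> 0" for x using assms by (simp add: sum_power2_eq_zero_iff)
  then show ?thesis
    by (intro continuous_intros continuous_on_compose2[OF smooth_imp_continuous_on[OF assms(1), of UNIV]]) auto
qed

lemma line_potential_le:
  assumes "smooth b" "\<And>x. 0 \<le> b x" "0 < \<delta>"
  shows "line_potential i b \<delta> (x$i) \<le> potential b \<delta> x"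
  unfolding line_potential_def potential_def cube_def
proof (rule integral_le)
  show "(\<lambda>t. 4 * b t * (ln ((x$i - t$i)\<^sup>2 + \<delta>\<^sup>2) / 2)) integrable_on cbox (vec (- 5)) (vec 5)"
  proof (rule integrable_continuous)
    have "continuous_on S (\<lambda>t. (x$i, t))" for S :: "(real^2) set" by (intro continuous_intros)
    from continuous_on_compose2[OF continuous_line_potential_integrand[OF assms(1,3), of UNIV i] this]
    show "continuous_on (cbox (vec (- 5)) (vec 5)) (\<lambda>t. 4 * b t * (ln ((x$i - t$i)\<^sup>2 + \<delta>\<^sup>2) / 2))"
      by simp
  qed
  show "(\<lambda>t. 4 * b t * kern \<delta> (x - t)) integrable_on cbox (vec (- 5)) (vec 5)"
      by (intro integrable_continuous continuous_intros smooth_imp_continuous_on assms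
        continuous_on_compose2[OF smooth_imp_continuous_on[OF smooth_kern[OF assms(3)], of UNIV]]) auto
  fix t
  have "((x - t)$i)\<^sup>2 \<le> (norm (x - t))\<^sup>2"
    using component_le_norm_cart[of "x - t" i] by (simp add: abs_le_square_iff[symmetric])
  then have "ln ((x$i - t$i)\<^sup>2 + \<delta>\<^sup>2) \<le> ln ((norm (x - t))\<^sup>2 + \<delta>\<^sup>2)"
    using assms(3) by (subst ln_le_cancel_iff) (auto simp: add_nonneg_pos)
  then show "4 * b t * (ln ((x$i - t$i)\<^sup>2 + \<delta>\<^sup>2) / 2) \<le> 4 * b t * kern \<delta> (x - t)"
    using assms(2)[of t] unfolding kern_def by (intro mult_left_mono) auto
qed

lemma continuous_line_potential:
  assumes "smooth b" "0 < \<delta>"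
  shows "continuous_on S (line_potential i b \<delta>)"
  unfolding line_potential_def cube_def
  using continuous_line_potential_integrand[OF assms]
  by (intro integral_continuous_on_param) (simp add: split_beta)

text \<open>After the exchange of integrals each \<open>t\<close> contributes \<open>4 * b t\<close>
  times a one-dimensional logarithmic integral, which is at least -400. Only the mass of
  \<open>b\<close> remains.\<close>

lemma integral_line_potential_ge:
  assumes b: "smooth b" "\<And>x. 0 \<le> b x" and \<delta>: "0 < \<delta>" "\<delta> \<le> 1" and a: "- 2 \<le> a" "a \<le> 5/4"
  shows "- 1600 * integral (cube 5) b \<le> integral {a..a+3/4} (line_potential i b \<delta>)"
proof -
  have c: "continuous_on S (\<lambda>(s,t). 4 * b t * (ln ((s - t$i)\<^sup>2 + \<delta>\<^sup>2) / 2))" for S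
    using continuous_line_potential_integrand[OF b(1) \<delta>(1)] by (simp add: split_beta)
  have "integral {a..a+3/4} (line_potential i b \<delta>)
      = integral (cube 5) (\<lambda>t. integral {a..a+3/4} (\<lambda>s. 4 * b t * (ln ((s - t$i)\<^sup>2 + \<delta>\<^sup>2) / 2)))"
    unfolding line_potential_def[abs_def] cube_def
    using integral_swap_continuous[OF c, of a "a+3/4" "vec (-5)" "vec 5"] by simp
  also have "\<dots> \<ge> integral (cube 5) (\<lambda>t. - 1600 * b t)"
  proof (rule integral_le)
    show "(\<lambda>t. - 1600 * b t) integrable_on cube 5" by (intro smooth_integrable_cube smooth_intros b)
    have "continuous_on (UNIV \<times> cbox a (a+3/4)) (\<lambda>(t,s). 4 * b t * (ln ((s - t$i)\<^sup>2 + \<delta>\<^sup>2) / 2))"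
    proof -
      have "continuous_on S (\<lambda>p. (snd p, fst p))" for S :: "((real^2) \<times> real) set" by (intro continuous_intros)
      from continuous_on_compose2[OF continuous_line_potential_integrand[OF b(1) \<delta>(1), of UNIV i] this]
      show ?thesis by (simp add: split_beta)
    qed
    from integral_continuous_on_param[OF this]
    show "(\<lambda>t. integral {a..a+3/4} (\<lambda>s. 4 * b t * (ln ((s - t$i)\<^sup>2 + \<delta>\<^sup>2) / 2))) integrable_on cube 5"
      unfolding cube_def box_real by (intro integrable_continuous) (rule continuous_on_subset, auto)
    fix t assume "t \<in> cube 5"
    then have "\<bar>t$i\<bar> \<le> 5" using exhaust_2[of i] by (auto simp: mem_cube)
    then have "- 400 \<le> integral {a..a+3/4} (\<lambda>s. ln ((s - t$i)\<^sup>2 + \<delta>\<^sup>2) / 2)"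
      using \<delta> a by (intro integral_log_ge)
    from mult_left_mono[OF this, of "4 * b t"]
    show "- 1600 * b t \<le> integral {a..a+3/4} (\<lambda>s. 4 * b t * (ln ((s - t$i)\<^sup>2 + \<delta>\<^sup>2) / 2))"
      using b(2)[of t] by simp
  qed
  finally show ?thesis by simp
qed

text \<open>Tangent line bound \<open>exp q \<ge> exp (- m) (1 + q + m)\<close>: a lower bound for the mean of \<open>q\<close> suffices.\<close>

lemma exists_good_line:
  fixes h q w :: "real \<Rightarrow> real"
  assumes cont: "continuous_on {a..a+3/4} h" "continuous_on {a..a+3/4} q" "continuous_on {a..a+3/4} w"
    and h: "\<And>s. 0 \<le> h s" and q: "- (3/4) * m \<le> integral {a..a+3/4} q"
    and w: "\<And>s. h s * exp (q s) \<le> w s" and I: "integral {a..a+3/4} w \<le> I"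
  shows "\<exists>s\<in>{a..a+3/4}. h s \<le> 4/3 * exp m * I"
proof -
  \<comment> \<open>At the minimiser of \<open>h\<close> the value \<open>h s\<close> can be pulled
    out of the integral of \<open>h t * exp (q t)\<close>; the tangent line then leaves only the
    integral of \<open>q\<close>.\<close>
  obtain s where s: "s \<in> {a..a+3/4}" "\<And>t. t \<in> {a..a+3/4} \<Longrightarrow> h s \<le> h t"
    using continuous_attains_inf[OF compact_Icc _ cont(1)] by auto
  have "h s * exp (- m) * (3/4) \<le> h s * exp (- m) * (integral {a..a+3/4} q + (3/4) * (1 + m))"
  proof (rule mult_left_mono)
    show "3/4 \<le> integral {a..a+3/4} q + (3/4) * (1 + m)" using q by argo
  qed (use h in simp)
  also have "\<dots> = integral {a..a+3/4} (\<lambda>t. h s * exp (- m) * (q t + (1 + m)))"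
    using cont by (simp add: integral_add integrable_continuous_real)
  also have "\<dots> \<le> integral {a..a+3/4} w"
  proof (rule integral_le)
    fix t assume t: "t \<in> {a..a+3/4}"
    have "exp (- m) * (q t + (1 + m)) \<le> exp (- m) * exp (q t + m)"
      using exp_ge_add_one_self[of "q t + m"] by (intro mult_left_mono) (linarith, simp)
    also have "\<dots> = exp (q t)" by (simp add: exp_add[symmetric])
    finally have "h s * (exp (- m) * (q t + (1 + m))) \<le> h t * exp (q t)"
      by (meson h s(2) t mult_left_mono mult_right_mono exp_ge_zero order_trans)
    then show "h s * exp (- m) * (q t + (1 + m)) \<le> w t" using w[of t] by (simp add: mult.assoc)
  qed (use cont in \<open>auto intro!: integrable_continuous_real continuous_intros\<close>)
  finally have "h s * exp (- m) * (3/4) \<le> I" using I by simp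
  then have "h s * exp (- m) * (3/4) * (4/3 * exp m) \<le> I * (4/3 * exp m)" by (intro mult_right_mono) auto
  moreover have "h s * exp (- m) * (3/4) * (4/3 * exp m) = h s" by (simp add: exp_minus)
  ultimately have "h s \<le> 4/3 * exp m * I" by (simp only: mult_ac)
  then show ?thesis using s(1) by blast
qed

text \<open>In place of the Cauchy-Schwarz inequality,
  \<open>\<bar>p\<bar> \<le> J / 4 + p\<^sup>2 / J\<close> is integrated over an interval of length
  4; both parts give at most \<open>J\<close>.\<close>

lemma oscillation_on_line_le:
  fixes v :: "real^2 \<Rightarrow> real"
  assumes v: "smooth v" and J: "0 < J"
    and int: "integral {-2..2} (\<lambda>t. grad_sq v (x + t *\<^sub>R axis j 1)) \<le> J\<^sup>2"
    and t: "s \<in> {-2..2}" "t \<in> {-2..2}"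
  shows "\<bar>v (x + t *\<^sub>R axis j 1) - v (x + s *\<^sub>R axis j 1)\<bar> \<le> 2 * J"
proof -
  have cline: "continuous_on S (\<lambda>t. f (x + t *\<^sub>R axis j 1))" if "smooth f" for f :: "real^2 \<Rightarrow> real" and S
    by (intro continuous_on_compose2[OF smooth_imp_continuous_on[OF that, of UNIV]] continuous_intros) auto
  have le: "\<bar>v (x + t *\<^sub>R axis j 1) - v (x + s *\<^sub>R axis j 1)\<bar> \<le> 2 * J"
    if st: "- 2 \<le> s" "s \<le> t" "t \<le> 2" for s t
  proof -
    let ?g = "\<lambda>t. J / 4 + grad_sq v (x + t *\<^sub>R axis j 1) / J"
    have cg: "continuous_on S ?g" for S
      by (intro continuous_intros cline smooth_grad_sq v) (use J in simp)
    have "((\<lambda>t. partial j v (x + t *\<^sub>R axis j 1)) has_integral v (x + t *\<^sub>R axis j 1) - v (x + s *\<^sub>R axis j 1)) {s..t}"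
      using smooth_has_real_derivative_axis[OF v] st(2)
      by (intro fundamental_theorem_of_calculus) (auto simp: has_real_derivative_iff_has_vector_derivative[symmetric] intro: DERIV_subset)
    then have "\<bar>v (x + t *\<^sub>R axis j 1) - v (x + s *\<^sub>R axis j 1)\<bar> = norm (integral {s..t} (\<lambda>t. partial j v (x + t *\<^sub>R axis j 1)))"
      by (simp add: integral_unique)
    also have "\<dots> \<le> integral {s..t} ?g"
    proof (rule integral_norm_bound_integral)
      fix t
      let ?p = "partial j v (x + t *\<^sub>R axis j 1)"
      have "?p\<^sup>2 \<le> grad_sq v (x + t *\<^sub>R axis j 1)"
        using exhaust_2[of j] by (auto simp: grad_sq_def)
      moreover have "J * \<bar>?p\<bar> \<le> J\<^sup>2 / 4 + ?p\<^sup>2"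
        using zero_le_power2[of "J / 2 - \<bar>?p\<bar>"] by (simp add: power2_eq_square algebra_simps)
      ultimately have "J * \<bar>?p\<bar> \<le> J * ?g t"
        using J by (simp add: distrib_left power2_eq_square)
      then show "norm ?p \<le> ?g t" using J by simp
    qed (intro integrable_continuous_real cline smooth_partial v cg)+
    also have "\<dots> \<le> integral {-2..2} ?g"
      using st J by (intro integral_subset_le integrable_continuous_real cg) auto
    also have "\<dots> = J + integral {-2..2} (\<lambda>t. grad_sq v (x + t *\<^sub>R axis j 1)) / J"
      using cline[OF smooth_grad_sq[OF v]] J
      by (subst integral_add) (auto intro!: integrable_continuous_real continuous_intros)
    also have "\<dots> \<le> J + J\<^sup>2 / J" using int J by (intro add_left_mono divide_right_mono) auto
    finally show ?thesis using J by (simp add: power2_eq_square)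
  qed
  show ?thesis
    using le[of s t] le[of t s] t by (cases "s \<le> t") (auto simp: abs_minus_commute)
qed

text \<open>The parametrisation \<open>e\<close> has \<open>s\<close> as its \<open>i\<close>-th
  coordinate, so that vertical and horizontal strips are covered by one lemma. The factor 6400/3 is
  1600 divided by the width 3/4 of the strip.\<close>

lemma exists_good_line_in_strip:
  fixes v b :: "real^2 \<Rightarrow> real" and e :: "real \<Rightarrow> real \<Rightarrow> real^2"
  assumes v: "smooth v" and b: "smooth b" "\<And>x. 0 \<le> b x" and \<delta>: "0 < \<delta>" "\<delta> \<le> 1" and a: "- 2 \<le> a" "a \<le> 5/4"
    and e: "\<And>S. continuous_on S (\<lambda>p. e (fst p) (snd p))" "\<And>s t. e s t $ i = s"
    and I: "integral {a..a+3/4} (\<lambda>s. integral {-2..2} (\<lambda>t. grad_sq v (e s t) * exp (potential b \<delta> (e s t)))) \<le> I"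
  shows "\<exists>s\<in>{a..a+3/4}. integral {-2..2} (\<lambda>t. grad_sq v (e s t)) \<le> 4/3 * exp (6400/3 * integral (cube 5) b) * I"
proof (rule exists_good_line)
  note sP = smooth_potential[OF \<delta>(1) b(1)]
  have c2: "continuous_on S (\<lambda>(s,t). f (e s t))" if "smooth f" for f S
    unfolding split_beta by (intro continuous_on_compose2[OF smooth_imp_continuous_on[OF that, of UNIV] e(1)]) auto
  have c1: "continuous_on S (\<lambda>t. f (e s t))" if "smooth f" for f s S
  proof -
    have "continuous_on S (\<lambda>t. (s, t))" by (intro continuous_intros)
    from continuous_on_compose2[OF c2[OF that, of UNIV] this] show ?thesis by simp
  qed
  have ch: "continuous_on S (\<lambda>s. integral {-2..2} (\<lambda>t. f (e s t)))" if "smooth f" for f S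
    using integral_continuous_on_param[OF c2[OF that], of S "-2" 2] by simp
  have sw: "smooth (\<lambda>x. grad_sq v x * exp (potential b \<delta> x))" by (intro smooth_intros v sP)
  show "continuous_on {a..a+3/4} (\<lambda>s. integral {-2..2} (\<lambda>t. grad_sq v (e s t)))"
    by (intro ch smooth_intros v)
  show "continuous_on {a..a+3/4} (line_potential i b \<delta>)" by (rule continuous_line_potential[OF b(1) \<delta>(1)])
  show "continuous_on {a..a+3/4} (\<lambda>s. integral {-2..2} (\<lambda>t. grad_sq v (e s t) * exp (potential b \<delta> (e s t))))"
    by (rule ch[OF sw])
  show "0 \<le> integral {-2..2} (\<lambda>t. grad_sq v (e s t))" for s
    by (intro integral_nonneg integrable_continuous_real c1 smooth_intros v) simp
  show "- (3/4) * (6400/3 * integral (cube 5) b) \<le> integral {a..a+3/4} (line_potential i b \<delta>)"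
    using integral_line_potential_ge[OF b \<delta> a, of i] by simp
  show "integral {-2..2} (\<lambda>t. grad_sq v (e s t)) * exp (line_potential i b \<delta> s)
     \<le> integral {-2..2} (\<lambda>t. grad_sq v (e s t) * exp (potential b \<delta> (e s t)))" for s
  proof -
    have "integral {-2..2} (\<lambda>t. grad_sq v (e s t) * exp (line_potential i b \<delta> s))
       \<le> integral {-2..2} (\<lambda>t. grad_sq v (e s t) * exp (potential b \<delta> (e s t)))"
      using line_potential_le[OF b \<delta>(1), of i "e s _"]
      by (intro integral_le integrable_continuous_real c1[OF sw] continuous_intros c1 smooth_intros v)
         (auto intro!: mult_left_mono simp: e(2))
    then show ?thesis by simp
  qed
qed (rule I)

text \<open>The strips \<open>{-2..-5/4}\<close> and \<open>{5/4..2}\<close> in either coordinate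
  stay outside the unit disc, and a good line in each gives a rectangle around the disc of radius
  5/4. From the corner \<open>(s1, t1)\<close> every boundary point is reached along at most two
  sides, each with oscillation at most \<open>2 * J\<close>, hence \<open>4 * J\<close>. The maximum
  principle for \<open>v\<close> and \<open>- v\<close> adds
  \<open>8 * (2 ^ N * \<epsilon>)\<close>, as \<open>N\<close> exceeds the mass of
  \<open>b\<close>.\<close>

lemma gradient_le_strips:
  fixes v b :: "real^2 \<Rightarrow> real"
  assumes v: "smooth v" and b: "smooth b" "\<And>x. 0 \<le> b x"
    and eq: "\<And>x. (lapl v x)\<^sup>2 \<le> b x * (grad_sq v x + \<epsilon>\<^sup>2)" and \<epsilon>: "0 < \<epsilon>"
    and \<delta>: "0 < \<delta>" "\<delta> \<le> 1"
    and I: "\<And>l u. cbox l u \<subseteq> cube 2 \<Longrightarrow> (\<And>x. x \<in> cbox l u \<Longrightarrow> 1 \<le> norm x) \<Longrightarrow>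
      integral (cbox l u) (\<lambda>x. grad_sq v x * exp (potential b \<delta> x)) \<le> I"
    and J: "0 < J" "4/3 * exp (6400/3 * integral (cube 5) b) * I \<le> J\<^sup>2"
    and N: "integral (cube 5) b < real N"
  shows "integral (cube 5) (\<lambda>x. (cutoff (6/5) (5/4) x)\<^sup>2 * grad_sq v x)
    \<le> (4 * J + 8 * (2 ^ N * \<epsilon>))\<^sup>2 * (21000 * step_lip\<^sup>2 + 2 * integral (cube 5) b) + 50 * \<epsilon>\<^sup>2"
proof -
  have norm1: "1 \<le> norm x" if "1 \<le> \<bar>x$i\<bar>" for x :: "real^2" and i
    using component_le_norm_cart[of x i] that by linarith
  have cw: "continuous_on UNIV (\<lambda>x. grad_sq v x * exp (potential b \<delta> x))"
    by (intro smooth_imp_continuous_on smooth_intros v smooth_potential[OF \<delta>(1) b(1)])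
  have V: "\<exists>s\<in>{a..a+3/4}. integral {-2..2} (\<lambda>t. grad_sq v (vec2 s t)) \<le> J\<^sup>2" if a: "a = -2 \<or> a = 5/4" for a
  proof -
    have "integral (cbox (vec2 a (-2)) (vec2 (a + 3/4) 2)) (\<lambda>x. grad_sq v x * exp (potential b \<delta> x)) \<le> I"
      using a by (intro I norm1[where i=1]) (auto simp: mem_cube mem_box_cart forall_2 vector_2)
    then have "\<exists>s\<in>{a..a+3/4}. integral {-2..2} (\<lambda>t. grad_sq v (vec2 s t)) \<le> 4/3 * exp (6400/3 * integral (cube 5) b) * I"
      using a integral_vec2(1)[OF cw, of a "-2" "a+3/4" 2]
      by (intro exists_good_line_in_strip[OF v b \<delta>, where i=1]) (auto simp: vector_2 intro!: continuous_intros)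
    then show ?thesis using J(2) by (meson order_trans)
  qed
  have H: "\<exists>t\<in>{a..a+3/4}. integral {-2..2} (\<lambda>s. grad_sq v (vec2 s t)) \<le> J\<^sup>2" if a: "a = -2 \<or> a = 5/4" for a
  proof -
    have "integral (cbox (vec2 (-2) a) (vec2 2 (a + 3/4))) (\<lambda>x. grad_sq v x * exp (potential b \<delta> x)) \<le> I"
      using a by (intro I norm1[where i=2]) (auto simp: mem_cube mem_box_cart forall_2 vector_2)
    then have "\<exists>t\<in>{a..a+3/4}. integral {-2..2} (\<lambda>s. grad_sq v (vec2 s t)) \<le> 4/3 * exp (6400/3 * integral (cube 5) b) * I"
      using a integral_vec2(2)[OF cw, of "-2" a 2 "a+3/4"]
      by (intro exists_good_line_in_strip[OF v b \<delta>, where i=2]) (auto simp: vector_2 intro!: continuous_intros)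
    then show ?thesis using J(2) by (meson order_trans)
  qed
  obtain s1 where s1: "-2 \<le> s1" "s1 \<le> -5/4" "integral {-2..2} (\<lambda>t. grad_sq v (vec2 s1 t)) \<le> J\<^sup>2"
    using V[of "-2"] by auto
  obtain s2 where s2: "5/4 \<le> s2" "s2 \<le> 2" "integral {-2..2} (\<lambda>t. grad_sq v (vec2 s2 t)) \<le> J\<^sup>2"
    using V[of "5/4"] by auto
  obtain t1 where t1: "-2 \<le> t1" "t1 \<le> -5/4" "integral {-2..2} (\<lambda>s. grad_sq v (vec2 s t1)) \<le> J\<^sup>2"
    using H[of "-2"] by auto
  obtain t2 where t2: "5/4 \<le> t2" "t2 \<le> 2" "integral {-2..2} (\<lambda>s. grad_sq v (vec2 s t2)) \<le> J\<^sup>2"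
    using H[of "5/4"] by auto
  have ov: "\<bar>v (vec2 s t) - v (vec2 s t')\<bar> \<le> 2 * J"
    if "integral {-2..2} (\<lambda>t. grad_sq v (vec2 s t)) \<le> J\<^sup>2" "t \<in> {-2..2}" "t' \<in> {-2..2}" for s t t'
    using oscillation_on_line_le[OF v J(1), of "s *\<^sub>R axis 1 1" 2 t' t] that unfolding vec2_axis by simp
  have oh: "\<bar>v (vec2 s t) - v (vec2 s' t)\<bar> \<le> 2 * J"
    if "integral {-2..2} (\<lambda>s. grad_sq v (vec2 s t)) \<le> J\<^sup>2" "s \<in> {-2..2}" "s' \<in> {-2..2}" for s s' t
    using oscillation_on_line_le[OF v J(1), of "t *\<^sub>R axis 2 1" 1 s' s] that unfolding vec2_axis
    by (simp add: add.commute)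
  define c where "c = v (vec2 s1 t1)"
  define l where "l = vec2 s1 t1"
  define u where "u = vec2 s2 t2"
  have R2: "cbox l u \<subseteq> cube 2"
    using s1 s2 t1 t2 by (auto simp: l_def u_def mem_cube mem_box_cart forall_2 vector_2)
  have bd: "\<bar>v y - c\<bar> \<le> 4 * J" if y: "y \<in> cbox l u" "y \<notin> box l u" for y
  proof -
    have yr: "s1 \<le> y$1" "y$1 \<le> s2" "t1 \<le> y$2" "y$2 \<le> t2"
      using y(1) by (auto simp: l_def u_def mem_box_cart forall_2 vector_2)
    have yi: "y$1 \<in> {-2..2}" "y$2 \<in> {-2..2}" using yr s1 s2 t1 t2 by auto
    have ci: "s1 \<in> {-2..2}" "s2 \<in> {-2..2}" "t1 \<in> {-2..2}" "t2 \<in> {-2..2}" using s1 s2 t1 t2 by auto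
    have "y$1 = s1 \<or> y$1 = s2 \<or> y$2 = t1 \<or> y$2 = t2"
      using y(2) yr by (auto simp: l_def u_def mem_box_cart forall_2 vector_2)
    then consider "y = vec2 s1 (y$2)" | "y = vec2 s2 (y$2)" | "y = vec2 (y$1) t1" | "y = vec2 (y$1) t2"
      using vec2_eta[of y] by metis
    then show ?thesis
    proof cases
      case 1
      have "\<bar>v y - c\<bar> \<le> 2 * J" unfolding c_def using ov[OF s1(3) yi(2) ci(3)] 1 by metis
      then show ?thesis using J by linarith
    next
      case 2
      have "\<bar>v y - v (vec2 s2 t1)\<bar> \<le> 2 * J" using ov[OF s2(3) yi(2) ci(3)] 2 by metis
      moreover have "\<bar>v (vec2 s2 t1) - c\<bar> \<le> 2 * J" unfolding c_def using oh[OF t1(3) ci(2) ci(1)] .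
      ultimately show ?thesis by linarith
    next
      case 3
      have "\<bar>v y - c\<bar> \<le> 2 * J" unfolding c_def using oh[OF t1(3) yi(1) ci(1)] 3 by metis
      then show ?thesis using J by linarith
    next
      case 4
      have "\<bar>v y - v (vec2 s1 t2)\<bar> \<le> 2 * J" using oh[OF t2(3) yi(1) ci(1)] 4 by metis
      moreover have "\<bar>v (vec2 s1 t2) - c\<bar> \<le> 2 * J" unfolding c_def using ov[OF s1(3) ci(4) ci(3)] .
      ultimately show ?thesis by linarith
    qed
  qed
  have up: "v x \<le> c + 4 * J + 8 * (2 ^ N * \<epsilon>)" if x: "x \<in> cbox l u" for x
  proof (rule ccontr)
    assume "\<not> ?thesis"
    then have "real N \<le> integral (cube 5) b"
      using abp_maximum_principle[OF v b eq \<epsilon> R2 x, of "c + 4 * J" N] bd by (force simp: abs_le_iff)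
    then show False using N by simp
  qed
  have lo: "c - 4 * J - 8 * (2 ^ N * \<epsilon>) \<le> v x" if x: "x \<in> cbox l u" for x
  proof (rule ccontr)
    have sm: "smooth (\<lambda>x. - v x)" using v by blast
    have p: "partial i (\<lambda>x. - v x) = (\<lambda>x. - partial i v x)" for i
      using v by (auto simp: partial_smooth_minus)
    have g: "grad_sq (\<lambda>x. - v x) x = grad_sq v x" "lapl (\<lambda>x. - v x) x = - lapl v x" for x
      unfolding grad_sq_def lapl_def p using v by (simp_all add: partial_smooth_minus smooth_partial smooth_partial_app)
    assume "\<not> ?thesis"
    then have "real N \<le> integral (cube 5) b"
      using abp_maximum_principle[OF sm b _ \<epsilon> R2 x, of "- c + 4 * J" N] bd eq unfolding g by (force simp: abs_le_iff)
    then show False using N by simp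
  qed
  let ?M = "4 * J + 8 * (2 ^ N * \<epsilon>)"
  have "integral (cube 5) (\<lambda>x. (cutoff (6/5) (5/4) x)\<^sup>2 * grad_sq v x)
    \<le> ?M\<^sup>2 * (32 * (2 * step_lip * (5/4) / ((5/4)\<^sup>2 - (6/5)\<^sup>2))\<^sup>2 * (5/4)\<^sup>2 + 2 * integral (cube 5) b) + 50 * \<epsilon>\<^sup>2"
  proof (rule caccioppoli_cutoff[OF v b eq])
    fix x :: "real^2" assume "norm x \<le> 5/4"
    then have "\<bar>x$1\<bar> \<le> 5/4" "\<bar>x$2\<bar> \<le> 5/4" using component_le_norm_cart[of x] order_trans by blast+
    then have "x \<in> cbox l u"
      using s1 s2 t1 t2 by (auto simp: l_def u_def mem_box_cart forall_2 vector_2 abs_le_iff)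
    from up[OF this] lo[OF this] show "\<bar>v x - c\<bar> \<le> ?M" by (simp add: abs_le_iff)
  qed auto
  also have "\<dots> \<le> ?M\<^sup>2 * (21000 * step_lip\<^sup>2 + 2 * integral (cube 5) b) + 50 * \<epsilon>\<^sup>2"
  proof (intro add_right_mono mult_left_mono)
    have "32 * (2 * step_lip * (5/4) / ((5/4)\<^sup>2 - (6/5)\<^sup>2))\<^sup>2 * (5/4)\<^sup>2 = 32 * (1000/49)\<^sup>2 * (5/4)\<^sup>2 * step_lip\<^sup>2"
      by (simp add: power2_eq_square)
    also have "\<dots> \<le> 21000 * step_lip\<^sup>2" by (intro mult_right_mono) (auto simp: power2_eq_square)
    finally show "32 * (2 * step_lip * (5/4) / ((5/4)\<^sup>2 - (6/5)\<^sup>2))\<^sup>2 * (5/4)\<^sup>2 \<le> 21000 * step_lip\<^sup>2" .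
  qed simp
  finally show ?thesis .
qed

section \<open>The smooth case\<close>

text \<open>The least \<open>b\<close> with \<open>(lapl v x)\<^sup>2 \<le> b x * (grad_sq v x +
  \<epsilon>\<^sup>2)\<close>. For a solution the Cauchy-Schwarz inequality bounds this quotient by
  the squared norm of \<open>A\<close>, so its integral is how the drift is measured in the smooth
  case.\<close>

definition drift_sq :: "real \<Rightarrow> (real^2 \<Rightarrow> real) \<Rightarrow> real^2 \<Rightarrow> real" where
  "drift_sq \<epsilon> v x = (lapl v x)\<^sup>2 / (grad_sq v x + \<epsilon>\<^sup>2)"

context
  fixes \<epsilon> :: real and v :: "real^2 \<Rightarrow> real"
  assumes \<epsilon>: "0 < \<epsilon>" and v: "smooth v"
begin

lemma drift_denom_pos: "0 < grad_sq v x + \<epsilon>\<^sup>2"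
  using \<epsilon> by (simp add: add_nonneg_pos)

lemma smooth_drift_sq: "smooth (drift_sq \<epsilon> v)"
  unfolding drift_sq_def by (intro smooth_divide smooth_intros v drift_denom_pos)

lemma drift_sq_nonneg: "0 \<le> drift_sq \<epsilon> v x"
  unfolding drift_sq_def using drift_denom_pos[of x] by simp

lemma lapl_sq_le: "(lapl v x)\<^sup>2 \<le> drift_sq \<epsilon> v x * (grad_sq v x + \<epsilon>\<^sup>2)"
  unfolding drift_sq_def using drift_denom_pos[of x] by simp

end

text \<open>Caccioppoli's inequality on the discs of radius \<open>2 * r\<close> and 24/5 converts
  the gradient terms of \<open>carleman_estimate\<close> into \<open>M\<close> and
  \<open>C0\<close>. All terms that carry \<epsilon> are gathered in the last line, so that one
  later choice of \<epsilon> disposes of them. In \<open>E\<close>, 4300 rounds up twice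
  \<open>6400/3 + 16\<close>, since the mass of \<open>b\<close> is at most
  \<open>2 * K\<^sup>2\<close>.\<close>

lemma quantitative_inequality:
  fixes v :: "real^2 \<Rightarrow> real" and L :: real
  assumes v: "smooth v" and \<epsilon>: "0 < \<epsilon>" and K: "integral (cube 5) (drift_sq \<epsilon> v) \<le> 2 * K\<^sup>2"
    and C0: "\<And>x. norm x \<le> 24/5 \<Longrightarrow> \<bar>v x\<bar> \<le> C0"
    and M: "\<And>x. norm x \<le> 2 * r \<Longrightarrow> \<bar>v x\<bar> \<le> M"
    and r: "0 < r" "r \<le> 1" and n: "0 \<le> n" and N: "2 * K\<^sup>2 < real N"
    and lower: "1/4 \<le> integral (cube 5) (\<lambda>x. (cutoff (6/5) (5/4) x)\<^sup>2 * grad_sq v x)"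
  defines "L \<equiv> step_lip\<^sup>2"
  defines "N1 \<equiv> exp (n * ln (4 / r\<^sup>2))" and "N2 \<equiv> exp (- n * ln 16)"
    and "E \<equiv> 4/3 * exp (4300 * K\<^sup>2 + 25 + n * ln 9)"
  shows "1/4 \<le> 32 * E * (21000 * L + 4 * K\<^sup>2) *
      (18 * L / r\<^sup>2 * N1 * (M\<^sup>2 * (228 * L + 4 * K\<^sup>2)) + 18 * L * N2 * (C0\<^sup>2 * (8800 * L + 4 * K\<^sup>2)))
    + \<epsilon>\<^sup>2 * ((32 * (E * (4 * K\<^sup>2 * N1 + 900 * L / r\<^sup>2 * N1 + 900 * L * N2) + 1) + 128 * 4 ^ N) * (21000 * L + 4 * K\<^sup>2) + 50)"
proof -
  define b where "b = drift_sq \<epsilon> v"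
  have b: "smooth b" "\<And>x. 0 \<le> b x" and eq: "\<And>x. (lapl v x)\<^sup>2 \<le> b x * (grad_sq v x + \<epsilon>\<^sup>2)"
    unfolding b_def using smooth_drift_sq[OF \<epsilon> v] drift_sq_nonneg[OF \<epsilon> v] lapl_sq_le[OF \<epsilon> v] by blast+
  define B where "B = integral (cube 5) b"
  have B: "B \<le> 2 * K\<^sup>2" "0 \<le> B"
    using K b by (auto simp: B_def b_def[symmetric] intro: integral_nonneg)
  have L0: "0 \<le> L" by (simp add: L_def)
  define z1 where "z1 = integral (cube 5) (\<lambda>x. (cutoff r (2 * r) x)\<^sup>2 * grad_sq v x)"
  define z2 where "z2 = integral (cube 5) (\<lambda>x. (cutoff (9/2) (24/5) x)\<^sup>2 * grad_sq v x)"
  have z1: "z1 \<le> M\<^sup>2 * (228 * L + 4 * K\<^sup>2) + 50 * \<epsilon>\<^sup>2"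
  proof -
    have "z1 \<le> M\<^sup>2 * (32 * (2 * step_lip * (2 * r) / ((2 * r)\<^sup>2 - r\<^sup>2))\<^sup>2 * (2 * r)\<^sup>2 + 2 * B) + 50 * \<epsilon>\<^sup>2"
      unfolding z1_def B_def using r M by (intro caccioppoli_cutoff[OF v b eq, where m=0]) auto
    also have "32 * (2 * step_lip * (2 * r) / ((2 * r)\<^sup>2 - r\<^sup>2))\<^sup>2 * (2 * r)\<^sup>2 = 2048 / 9 * L"
      using r by (simp add: L_def power2_eq_square field_simps)
    also have "M\<^sup>2 * (2048 / 9 * L + 2 * B) + 50 * \<epsilon>\<^sup>2 \<le> M\<^sup>2 * (228 * L + 4 * K\<^sup>2) + 50 * \<epsilon>\<^sup>2"
      using B L0 by (intro add_right_mono mult_left_mono add_mono) auto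
    finally show ?thesis .
  qed
  have z2: "z2 \<le> C0\<^sup>2 * (8800 * L + 4 * K\<^sup>2) + 50 * \<epsilon>\<^sup>2"
  proof -
    have "z2 \<le> C0\<^sup>2 * (32 * (2 * step_lip * (24/5) / ((24/5)\<^sup>2 - (9/2)\<^sup>2))\<^sup>2 * (24/5)\<^sup>2 + 2 * B) + 50 * \<epsilon>\<^sup>2"
      unfolding z2_def B_def using C0 by (intro caccioppoli_cutoff[OF v b eq, where m=0]) auto
    also have "32 * (2 * step_lip * (24/5) / ((24/5)\<^sup>2 - (9/2)\<^sup>2))\<^sup>2 * (24/5)\<^sup>2 = 32 * (48 / 5 / (279/100))\<^sup>2 * (24/5)\<^sup>2 * L"
      by (simp add: L_def power2_eq_square)
    also have "C0\<^sup>2 * (32 * (48 / 5 / (279/100))\<^sup>2 * (24/5)\<^sup>2 * L + 2 * B) + 50 * \<epsilon>\<^sup>2 \<le> C0\<^sup>2 * (8800 * L + 4 * K\<^sup>2) + 50 * \<epsilon>\<^sup>2"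
      using B L0 by (intro add_right_mono mult_left_mono add_mono mult_right_mono) (auto simp: power2_eq_square)
    finally show ?thesis .
  qed
  define S where "S = 2 * \<epsilon>\<^sup>2 * N1 * B + 18 * L / r\<^sup>2 * N1 * z1 + 18 * L * N2 * z2"
  obtain \<delta> where \<delta>: "0 < \<delta>" "\<delta> \<le> 1" and car: "\<And>l u. cbox l u \<subseteq> cube 2 \<Longrightarrow> (\<forall>x\<in>cbox l u. 1 \<le> norm x) \<Longrightarrow>
    exp (- n * ln 9) * integral (cbox l u) (\<lambda>x. grad_sq v x * exp (potential b \<delta> x)) \<le> exp (16 * B + 25) * S"
    using carleman_estimate[OF v b eq r n] unfolding B_def S_def L_def N1_def N2_def z1_def z2_def by blast
  define I where "I = exp (n * ln 9) * (exp (16 * B + 25) * S)"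
  have I: "integral (cbox l u) (\<lambda>x. grad_sq v x * exp (potential b \<delta> x)) \<le> I"
    if "cbox l u \<subseteq> cube 2" "\<And>x. x \<in> cbox l u \<Longrightarrow> 1 \<le> norm x" for l u
  proof -
    have "exp (n * ln 9) * (exp (- n * ln 9) * integral (cbox l u) (\<lambda>x. grad_sq v x * exp (potential b \<delta> x))) \<le> I"
      unfolding I_def using that by (intro mult_left_mono car) auto
    then show ?thesis by (simp add: mult.assoc[symmetric] exp_add[symmetric])
  qed
  have z0: "0 \<le> z1" "0 \<le> z2"
    unfolding z1_def z2_def by (intro integral_nonneg smooth_integrable_cube smooth_intros smooth_cutoff v; simp)+
  have NN: "0 \<le> N1" "0 \<le> N2" by (simp_all add: N1_def N2_def)
  have S0: "0 \<le> S" unfolding S_def using z0 B L0 NN by (intro add_nonneg_nonneg mult_nonneg_nonneg divide_nonneg_nonneg) auto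
  \<comment> \<open>The summand with \<epsilon> keeps \<open>J\<close> positive even if
    \<open>S\<close> is 0; the oscillation bound divides by \<open>J\<close>.\<close>
  define J where "J = sqrt (E * S + \<epsilon>\<^sup>2)"
  have E0: "0 \<le> E" by (simp add: E_def)
  have J2: "J\<^sup>2 = E * S + \<epsilon>\<^sup>2" unfolding J_def using E0 S0 by simp
  have J0: "0 < J" unfolding J_def using E0 S0 \<epsilon> by (simp add: add_nonneg_pos)
  have "4/3 * exp (6400/3 * B) * I \<le> J\<^sup>2"
  proof -
    have "4/3 * exp (6400/3 * B) * I = 4/3 * exp (6400/3 * B + (16 * B + 25) + n * ln 9) * S"
      unfolding I_def exp_add by simp
    also have "\<dots> \<le> E * S"
      unfolding E_def using B S0 by (intro mult_right_mono mult_left_mono) auto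
    finally show ?thesis unfolding J2 using zero_le_power2[of \<epsilon>] by linarith
  qed
  then have G: "integral (cube 5) (\<lambda>x. (cutoff (6/5) (5/4) x)\<^sup>2 * grad_sq v x)
    \<le> (4 * J + 8 * (2 ^ N * \<epsilon>))\<^sup>2 * (21000 * L + 2 * B) + 50 * \<epsilon>\<^sup>2"
    unfolding B_def L_def using gradient_le_strips[OF v b eq \<epsilon> \<delta> I J0] N B(1) unfolding B_def by fastforce
  have "(4 * J + 8 * (2 ^ N * \<epsilon>))\<^sup>2 \<le> 32 * J\<^sup>2 + 128 * 4 ^ N * \<epsilon>\<^sup>2"
  proof -
    have "(x + y)\<^sup>2 \<le> 2 * x\<^sup>2 + 2 * y\<^sup>2" for x y :: real
      using zero_le_power2[of "x - y"] by (simp add: power2_eq_square algebra_simps)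
    from this[of "4 * J" "8 * (2 ^ N * \<epsilon>)"] have "(4 * J + 8 * (2 ^ N * \<epsilon>))\<^sup>2 \<le> 2 * (4 * J)\<^sup>2 + 2 * (8 * (2 ^ N * \<epsilon>))\<^sup>2" .
    also have "\<dots> = 32 * J\<^sup>2 + 128 * 4 ^ N * \<epsilon>\<^sup>2"
    proof -
      have "((2::real) ^ N)\<^sup>2 = 4 ^ N" by (simp add: power2_eq_square flip: power_mult_distrib)
      then show ?thesis by (simp add: power_mult_distrib)
    qed
    finally show ?thesis .
  qed
  then have "1/4 \<le> (32 * J\<^sup>2 + 128 * 4 ^ N * \<epsilon>\<^sup>2) * (21000 * L + 4 * K\<^sup>2) + 50 * \<epsilon>\<^sup>2"
    using B L0 by (intro order_trans[OF lower order_trans[OF G]] add_right_mono mult_mono) auto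
  also have "J\<^sup>2 \<le> E * (2 * \<epsilon>\<^sup>2 * N1 * (2 * K\<^sup>2) + 18 * L / r\<^sup>2 * N1 * (M\<^sup>2 * (228 * L + 4 * K\<^sup>2) + 50 * \<epsilon>\<^sup>2)
      + 18 * L * N2 * (C0\<^sup>2 * (8800 * L + 4 * K\<^sup>2) + 50 * \<epsilon>\<^sup>2)) + \<epsilon>\<^sup>2"
    unfolding J2 S_def using z1 z2 B NN L0
    by (intro add_right_mono mult_left_mono[OF _ E0] add_mono mult_left_mono mult_nonneg_nonneg divide_nonneg_nonneg) auto
  finally have F: "1/4 \<le> (32 * (E * (2 * \<epsilon>\<^sup>2 * N1 * (2 * K\<^sup>2) + 18 * L / r\<^sup>2 * N1 * (M\<^sup>2 * (228 * L + 4 * K\<^sup>2) + 50 * \<epsilon>\<^sup>2)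
      + 18 * L * N2 * (C0\<^sup>2 * (8800 * L + 4 * K\<^sup>2) + 50 * \<epsilon>\<^sup>2)) + \<epsilon>\<^sup>2) + 128 * 4 ^ N * \<epsilon>\<^sup>2) * (21000 * L + 4 * K\<^sup>2) + 50 * \<epsilon>\<^sup>2"
    using L0 by (simp add: mult_right_mono)
  define P where "P = 18 * L / r\<^sup>2 * N1"
  define Q where "Q = 18 * L * N2"
  have P': "900 * L / r\<^sup>2 * N1 = 50 * P" and Q': "900 * L * N2 = 50 * Q" by (simp_all add: P_def Q_def)
  show ?thesis
    using F unfolding P_def[symmetric] Q_def[symmetric] P' Q' by (simp add: algebra_simps)
qed

text \<open>Here \<epsilon> is fixed before \<open>v\<close>: the mollification radius will depend
  on \<epsilon>, and the bound has to hold for whichever mollified function results. Asking for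
  \<open>M\<close> on the disc of radius \<open>r/2\<close> only leaves room for a mollification
  radius up to \<open>r/2\<close>.\<close>

definition lower_bound_at :: "real \<Rightarrow> real \<Rightarrow> real \<Rightarrow> real \<Rightarrow> real \<Rightarrow> bool" where
  "lower_bound_at r \<epsilon> C0 K m \<longleftrightarrow> (\<forall>v M. smooth v \<and> integral (cube 5) (drift_sq \<epsilon> v) \<le> 2 * K\<^sup>2 \<and>
     (\<forall>x. norm x \<le> 24/5 \<longrightarrow> \<bar>v x\<bar> \<le> C0) \<and> (\<forall>x. norm x \<le> r/2 \<longrightarrow> \<bar>v x\<bar> \<le> M) \<and> 0 \<le> M \<and>
     1/4 \<le> integral (cube 5) (\<lambda>x. (cutoff (6/5) (5/4) x)\<^sup>2 * grad_sq v x)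
     \<longrightarrow> m \<le> M)"

text \<open>Two terms compete. \<open>n\<close> is so large that the outer one is at most 1/16; the
  inner one must then be at least 1/8, which reads
  \<open>1 \<le> exp (T - (2 * n + 2) * ln r) * M\<^sup>2\<close>. The condition
  \<open>r \<le> exp (- \<bar>T\<bar>)\<close> hides \<open>T\<close> in two extra powers of
  \<open>r\<close>, so \<open>M\<close> is at least \<open>r powr (n + 2)\<close>. Finally
  \<open>R \<le> 1/4\<close> gives \<open>R\<^sup>2 \<le> R / 4\<close>, which doubles the
  exponent.\<close>

lemma vanishing_order_smooth:
  "\<exists>C2>0. \<forall>C0>0. \<exists>C1>0. \<forall>K\<ge>1. \<exists>r0. 0 < r0 \<and> r0 < 1 \<and>
     (\<forall>r. 0 < r \<and> r \<le> r0 \<longrightarrow> (\<exists>\<epsilon>>0. lower_bound_at r \<epsilon> C0 K (r powr (C1 + C2 * K\<^sup>2))))"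
proof -
  define L where "L = step_lip\<^sup>2"
  have L: "L > 0" using step_lip_pos by (simp add: L_def)
  \<comment> \<open>The factors free of \<open>K\<close>, \<open>n\<close> and \<open>r\<close>: 43
    rounds up 128/3, and the square comes from two factors that are each bounded by
    \<open>(21000 * L + 4) * K\<^sup>2\<close>.\<close>
  define Z where "Z = 43 * (18 * L) * (21000 * L + 4)\<^sup>2"
  have Z: "Z > 0" unfolding Z_def using L by (intro mult_pos_pos zero_less_power add_pos_pos) auto
  \<comment> \<open>The gain of the Carleman weight per unit of \<open>n\<close>: base 16 at the
    outer cutoff against base 9 on the rectangle.\<close>
  define \<gamma> :: real where "\<gamma> = ln (16/9)"
  have \<gamma>: "\<gamma> > 0" by (simp add: \<gamma>_def)
  \<comment> \<open>4302 is the 4300 of \<open>quantitative_inequality\<close> plus 2, because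
    \<open>(K\<^sup>2)\<^sup>2 \<le> exp (2 * K\<^sup>2)\<close> absorbs the polynomial
    factor.\<close>
  define a2 where "a2 = 4302 / \<gamma>"
  have a2: "a2 > 0" using \<gamma> by (simp add: a2_def)
  show ?thesis
  proof (rule exI[of _ "2 * a2"], intro conjI allI impI)
    show "0 < 2 * a2" using a2 by simp
    fix C0 :: real assume C0: "C0 > 0"
    \<comment> \<open>\<open>a1\<close> compensates the constants and \<open>C0\<close> in the outer
      term, as \<open>a2\<close> compensates the exponential of \<open>K\<^sup>2\<close>.\<close>
    define a1 where "a1 = (25 + \<bar>ln (16 * Z * C0\<^sup>2)\<bar>) / \<gamma>"
    have a1: "a1 > 0" using \<gamma> by (simp add: a1_def)
    show "\<exists>C1>0. \<forall>K\<ge>1. \<exists>r0. 0 < r0 \<and> r0 < 1 \<and>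
      (\<forall>r. 0 < r \<and> r \<le> r0 \<longrightarrow> (\<exists>\<epsilon>>0. lower_bound_at r \<epsilon> C0 K (r powr (C1 + 2 * a2 * K\<^sup>2))))"
    proof (rule exI[of _ "2 * a1 + 4"], intro conjI allI impI)
      show "0 < 2 * a1 + 4" using a1 by simp
      fix K :: real assume K: "1 \<le> K"
      define n where "n = a1 + a2 * K\<^sup>2"
      have n: "n > 0" using a1 a2 by (simp add: n_def add_pos_nonneg)
      define T where "T = ln (8 * Z) + 4302 * K\<^sup>2 + 25 + n * ln 36"
      define r0 where "r0 = min (1/4) (exp (- \<bar>T\<bar>))"
      have r0: "0 < r0" "r0 < 1" by (auto simp: r0_def)
      \<comment> \<open>More doublings than the mass of \<open>b\<close> allows in the maximum
        principle; \<open>N\<close> influences only the size of \<epsilon>.\<close>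
      obtain N :: nat where N: "2 * K\<^sup>2 < real N" using reals_Archimedean2 by blast
      show "\<exists>r0. 0 < r0 \<and> r0 < 1 \<and>
        (\<forall>r. 0 < r \<and> r \<le> r0 \<longrightarrow> (\<exists>\<epsilon>>0. lower_bound_at r \<epsilon> C0 K (r powr (2 * a1 + 4 + 2 * a2 * K\<^sup>2))))"
      proof (rule exI[of _ r0], intro conjI r0 allI impI, elim conjE)
        fix R :: real assume R: "0 < R" "R \<le> r0"
        \<comment> \<open>The estimate takes its bound \<open>M\<close> on the disc of radius
          \<open>2 * r\<close>, which is \<open>R / 2\<close>.\<close>
        define r where "r = R / 4"
        have r: "0 < r" "r \<le> 1" "r \<le> exp (- \<bar>T\<bar>)" using R by (auto simp: r_def r0_def)
        define N1 where "N1 = exp (n * ln (4 / r\<^sup>2))"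
        define N2 where "N2 = exp (- n * ln 16)"
        define E where "E = 4/3 * exp (4300 * K\<^sup>2 + 25 + n * ln 9)"
        define X where "X = ((32 * (E * (4 * K\<^sup>2 * N1 + 900 * L / r\<^sup>2 * N1 + 900 * L * N2) + 1) + 128 * 4 ^ N) * (21000 * L + 4 * K\<^sup>2) + 50)"
        have X: "X > 0"
        proof -
          have "0 \<le> E" "0 \<le> N1" "0 \<le> N2" by (simp_all add: E_def N1_def N2_def)
          then show ?thesis
            unfolding X_def using L
            by (intro add_nonneg_pos mult_nonneg_nonneg add_nonneg_nonneg divide_nonneg_nonneg) auto
        qed
        \<comment> \<open>The part with \<epsilon> becomes exactly 1/16. Of the initial 1/4 this
          leaves 3/16, and 1/8 after the outer term.\<close>
        define \<epsilon> where "\<epsilon> = sqrt (1 / (16 * X))"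
        have \<epsilon>: "\<epsilon> > 0" "\<epsilon>\<^sup>2 * X = 1/16" using X by (simp_all add: \<epsilon>_def)
        show "\<exists>\<epsilon>>0. lower_bound_at R \<epsilon> C0 K (R powr (2 * a1 + 4 + 2 * a2 * K\<^sup>2))"
          unfolding lower_bound_at_def
        proof (rule exI[of _ \<epsilon>], intro conjI \<epsilon>(1) allI impI, elim conjE)
          fix v :: "real^2 \<Rightarrow> real" and M :: real
          assume v: "smooth v" "integral (cube 5) (drift_sq \<epsilon> v) \<le> 2 * K\<^sup>2"
            "\<forall>x. norm x \<le> 24/5 \<longrightarrow> \<bar>v x\<bar> \<le> C0" "\<forall>x. norm x \<le> R/2 \<longrightarrow> \<bar>v x\<bar> \<le> M" "0 \<le> M"
            "1/4 \<le> integral (cube 5) (\<lambda>x. (cutoff (6/5) (5/4) x)\<^sup>2 * grad_sq v x)"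
          have "1/4 \<le> 32 * E * (21000 * L + 4 * K\<^sup>2) *
            (18 * L / r\<^sup>2 * N1 * (M\<^sup>2 * (228 * L + 4 * K\<^sup>2)) + 18 * L * N2 * (C0\<^sup>2 * (8800 * L + 4 * K\<^sup>2)))
            + \<epsilon>\<^sup>2 * X"
            unfolding X_def E_def N1_def N2_def L_def
            using v r n N by (intro quantitative_inequality \<epsilon>) (auto simp: r_def)
          then have q: "3/16 \<le> 32 * E * (21000 * L + 4 * K\<^sup>2) *
            (18 * L / r\<^sup>2 * N1 * (M\<^sup>2 * (228 * L + 4 * K\<^sup>2)) + 18 * L * N2 * (C0\<^sup>2 * (8800 * L + 4 * K\<^sup>2)))"
            using \<epsilon>(2) by simp
          define Y where "Y = exp (4302 * K\<^sup>2 + 25)"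
          define U where "U = exp (n * ln 9)"
          have K2: "1 \<le> K\<^sup>2" using K by simp
          have NN: "0 \<le> N1" "0 \<le> N2" "0 \<le> U" by (simp_all add: N1_def N2_def U_def)
          have "32 * E * (21000 * L + 4 * K\<^sup>2) *
            (18 * L / r\<^sup>2 * N1 * (M\<^sup>2 * (228 * L + 4 * K\<^sup>2)) + 18 * L * N2 * (C0\<^sup>2 * (8800 * L + 4 * K\<^sup>2)))
             \<le> Z * Y * U * (N1 / r\<^sup>2 * M\<^sup>2 + N2 * C0\<^sup>2)"
          proof -
            define D where "D = (21000 * L + 4) * K\<^sup>2"
            have D: "21000 * L + 4 * K\<^sup>2 \<le> D" "228 * L + 4 * K\<^sup>2 \<le> D" "8800 * L + 4 * K\<^sup>2 \<le> D"
            proof -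
              have "L \<le> L * K\<^sup>2" using L K2 by simp
              then show "21000 * L + 4 * K\<^sup>2 \<le> D" "228 * L + 4 * K\<^sup>2 \<le> D" "8800 * L + 4 * K\<^sup>2 \<le> D"
                using L by (simp_all add: D_def algebra_simps)
            qed
            have E0: "0 \<le> E" by (simp add: E_def)
            have D0: "0 \<le> D" using L by (simp add: D_def)
            have "32 * E * (21000 * L + 4 * K\<^sup>2) *
              (18 * L / r\<^sup>2 * N1 * (M\<^sup>2 * (228 * L + 4 * K\<^sup>2)) + 18 * L * N2 * (C0\<^sup>2 * (8800 * L + 4 * K\<^sup>2)))
              \<le> 32 * E * D * (18 * L / r\<^sup>2 * N1 * (M\<^sup>2 * D) + 18 * L * N2 * (C0\<^sup>2 * D))"
              using D L NN E0 D0
              by (intro mult_mono add_mono mult_left_mono mult_nonneg_nonneg divide_nonneg_nonneg add_nonneg_nonneg) auto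
            also have "\<dots> = 32 * (18 * L) * E * D\<^sup>2 * (N1 / r\<^sup>2 * M\<^sup>2 + N2 * C0\<^sup>2)"
              by (simp add: algebra_simps power2_eq_square)
            also have "\<dots> \<le> Z * Y * U * (N1 / r\<^sup>2 * M\<^sup>2 + N2 * C0\<^sup>2)"
            proof (rule mult_right_mono)
              have "K\<^sup>2 \<le> exp (K\<^sup>2)" using exp_ge_add_one_self[of "K\<^sup>2"] by linarith
              then have "(K\<^sup>2)\<^sup>2 \<le> (exp (K\<^sup>2))\<^sup>2" by (intro power_mono) auto
              also have "(exp (K\<^sup>2))\<^sup>2 = exp (2 * K\<^sup>2)" by (simp add: power2_eq_square exp_add[symmetric])
              finally have K4: "(K\<^sup>2)\<^sup>2 \<le> exp (2 * K\<^sup>2)" .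
              have "32 * (18 * L) * E * D\<^sup>2 = 128/3 * (18 * L) * (21000 * L + 4)\<^sup>2 * (exp (4300 * K\<^sup>2 + 25) * U) * (K\<^sup>2)\<^sup>2"
                unfolding E_def D_def U_def exp_add[of _ "n * ln 9"] by (simp add: power_mult_distrib)
              also have "\<dots> \<le> 43 * (18 * L) * (21000 * L + 4)\<^sup>2 * (exp (4300 * K\<^sup>2 + 25) * U) * exp (2 * K\<^sup>2)"
                using L NN by (intro mult_mono K4 mult_nonneg_nonneg) auto
              also have "\<dots> = Z * (exp (2 * K\<^sup>2) * exp (4300 * K\<^sup>2 + 25)) * U" by (simp add: Z_def)
              also have "exp (2 * K\<^sup>2) * exp (4300 * K\<^sup>2 + 25) = Y"
                unfolding Y_def exp_add[symmetric] by simp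
              finally show "32 * (18 * L) * E * D\<^sup>2 \<le> Z * Y * U" .
              show "0 \<le> N1 / r\<^sup>2 * M\<^sup>2 + N2 * C0\<^sup>2" using NN by simp
            qed
            finally show ?thesis .
          qed
          from order_trans[OF q this] have q2: "3/16 \<le> Z * Y * U * (N1 / r\<^sup>2 * M\<^sup>2) + Z * Y * U * (N2 * C0\<^sup>2)"
            unfolding distrib_left .
          have small: "Z * Y * U * (N2 * C0\<^sup>2) \<le> 1/16"
          proof -
            have "U * N2 = exp (- (n * \<gamma>))"
              unfolding U_def N2_def exp_add[symmetric] \<gamma>_def by (simp add: ln_div algebra_simps)
            moreover have "n * \<gamma> = 25 + \<bar>ln (16 * Z * C0\<^sup>2)\<bar> + 4302 * K\<^sup>2"
              using \<gamma> by (simp add: n_def a1_def a2_def field_simps)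
            ultimately have "U * N2 * Y = exp (- (25 + \<bar>ln (16 * Z * C0\<^sup>2)\<bar> + 4302 * K\<^sup>2) + (4302 * K\<^sup>2 + 25))"
              unfolding Y_def exp_add by simp
            also have "\<dots> = exp (- \<bar>ln (16 * Z * C0\<^sup>2)\<bar>)" by simp
            finally have "U * N2 * Y = exp (- \<bar>ln (16 * Z * C0\<^sup>2)\<bar>)" .
            also have "\<dots> \<le> exp (- ln (16 * Z * C0\<^sup>2))" by simp
            also have "\<dots> = 1 / (16 * Z * C0\<^sup>2)" using Z C0 by (simp add: exp_minus inverse_eq_divide)
            finally have "Z * C0\<^sup>2 * (U * N2 * Y) \<le> Z * C0\<^sup>2 * (1 / (16 * Z * C0\<^sup>2))"
              using Z by (intro mult_left_mono) auto
            also have "\<dots> = 1/16" using Z C0 by simp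
            finally show ?thesis by (simp add: mult_ac)
          qed
          have "3/16 \<le> p + q \<Longrightarrow> q \<le> 1/16 \<Longrightarrow> 1/8 \<le> p" for p q :: real by simp
          from this[OF q2 small] have q3: "1/8 \<le> Z * Y * U * (N1 / r\<^sup>2 * M\<^sup>2)" .
          have YUN: "8 * Z * Y * U * N1 / r\<^sup>2 = exp (T - (2 * n + 2) * ln r)"
          proof -
            have lnr: "ln (4 / r\<^sup>2) = ln 4 - 2 * ln r" using r by (simp add: ln_div ln_realpow)
            have N1: "N1 = exp (n * ln 4 - 2 * n * ln r)"
              unfolding N1_def lnr by (simp add: algebra_simps)
            have ln36: "ln (36::real) = ln 9 + ln 4" using ln_mult[of 9 "4::real"] by simp
            have r2: "1 / r\<^sup>2 = exp (- 2 * ln r)"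
              using r by (simp add: exp_minus inverse_eq_divide exp_double power2_eq_square)
            have "8 * Z * Y * U * N1 / r\<^sup>2 = exp (ln (8 * Z)) * Y * U * N1 * (1 / r\<^sup>2)"
              using Z by simp
            also have "\<dots> = exp (ln (8 * Z) + (4302 * K\<^sup>2 + 25) + n * ln 9 + (n * ln 4 - 2 * n * ln r) + - 2 * ln r)"
              unfolding Y_def U_def N1 r2 exp_add ..
            also have "ln (8 * Z) + (4302 * K\<^sup>2 + 25) + n * ln 9 + (n * ln 4 - 2 * n * ln r) + - 2 * ln r = T - (2 * n + 2) * ln r"
              unfolding T_def ln36 by (simp add: algebra_simps)
            finally show ?thesis .
          qed
          have "1 \<le> exp (T - (2 * n + 2) * ln r) * M\<^sup>2"
            using q3 unfolding YUN[symmetric] by (simp add: mult_ac)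
          then have "exp ((2 * n + 2) * ln r - T) * 1 \<le> exp ((2 * n + 2) * ln r - T) * (exp (T - (2 * n + 2) * ln r) * M\<^sup>2)"
            by (intro mult_left_mono) auto
          also have "\<dots> = M\<^sup>2" by (simp add: mult.assoc[symmetric] exp_add[symmetric])
          finally have M2: "exp ((2 * n + 2) * ln r - T) \<le> M\<^sup>2" by simp
          have lr: "ln r \<le> - \<bar>T\<bar>" using r ln_mono[of r "exp (- \<bar>T\<bar>)"] by simp
          have "(2 * n + 4) * ln r = (2 * n + 2) * ln r + 2 * ln r" by (simp add: algebra_simps)
          also have "\<dots> \<le> (2 * n + 2) * ln r - T" using lr by linarith
          finally have "exp ((2 * n + 4) * ln r) \<le> M\<^sup>2"
            using M2 exp_le_cancel_iff order_trans by blast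
          moreover have "(2 * n + 4) * ln r = 2 * ((n + 2) * ln r)" by (simp add: algebra_simps)
          ultimately have "exp (2 * ((n + 2) * ln r)) \<le> M\<^sup>2" by simp
          then have "(exp ((n + 2) * ln r))\<^sup>2 \<le> M\<^sup>2"
            by (simp only: exp_double)
          then have M1: "exp ((n + 2) * ln r) \<le> M" using v(5) power2_le_imp_le by blast
          have "ln R \<le> ln (1/4)" using R by (subst ln_le_cancel_iff) (auto simp: r0_def)
          then have "2 * ln R \<le> ln r" using R by (simp add: r_def ln_div)
          then have "(n + 2) * (2 * ln R) \<le> (n + 2) * ln r" using n by (intro mult_left_mono) auto
          moreover have "(n + 2) * (2 * ln R) = (2 * n + 4) * ln R" by (simp add: algebra_simps)
          ultimately have "exp ((2 * n + 4) * ln R) \<le> exp ((n + 2) * ln r)" by simp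
          then have "exp ((2 * n + 4) * ln R) \<le> M" using M1 by linarith
          moreover have "R powr (2 * a1 + 4 + 2 * a2 * K\<^sup>2) = exp ((2 * n + 4) * ln R)"
            using R by (simp add: powr_def n_def algebra_simps)
          ultimately show "R powr (2 * a1 + 4 + 2 * a2 * K\<^sup>2) \<le> M" by simp
        qed
      qed
    qed
  qed
qed

section \<open>Mollification\<close>

text \<open>Exponents 1 and 2 are carried along together: 1 for the uniqueness of weak derivatives,
  which are only locally integrable, and 2 for the convergence of mollified derivatives.\<close>

lemma abs_add_pow_le:
  fixes a b :: real
  assumes "p = 1 \<or> p = (2::nat)"
  shows "\<bar>a + b\<bar> ^ p \<le> 2 * (\<bar>a\<bar> ^ p + \<bar>b\<bar> ^ p)"
  using assms
proof
  assume "p = 2"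
  then show ?thesis using zero_le_power2[of "a - b"] by (simp add: power2_eq_square algebra_simps)
qed simp

lemma lborel_distr_reflect: "distr lborel borel (\<lambda>t. x - t) = (lborel :: 'a::euclidean_space measure)"
  using lborel_affine[of "-1" x] by (simp add: density_1)

section \<open>Mollifiers, Young's inequality and convergence in L^p\<close>

definition bump :: "real \<Rightarrow> real^2 \<Rightarrow> real" where
  "bump h x = flat 1 (1 - (norm x)\<^sup>2 / h\<^sup>2)"

definition moll :: "real \<Rightarrow> real^2 \<Rightarrow> real" where
  "moll h x = bump h x / (LINT t|lborel. bump h t)"

text \<open>Convolution of a Borel function over the whole plane, the version for measure-theoretic
  estimates. Smoothness is obtained from \<open>mollify\<close>, which integrates a continuous
  function over a box; \<open>partial_mollify\<close> connects the two.\<close>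

definition conv :: "(real^2 \<Rightarrow> real) \<Rightarrow> real \<Rightarrow> real^2 \<Rightarrow> real" where
  "conv f h x = (LINT t|lborel. f t * moll h (x - t))"

lemma bump_nonneg: "0 \<le> bump h x"
  by (simp add: bump_def flat_1_nonneg)

lemma bump_le_1: "bump h x \<le> 1"
  by (simp add: bump_def flat_def)

lemma smooth_bump: "smooth (bump h)"
  unfolding bump_def by (intro smooth_flat smooth_diff smooth_const smooth_divide_const smooth_norm_sq)

lemma smooth_moll: "smooth (moll h)"
  unfolding moll_def by (intro smooth_divide_const smooth_bump)

lemma borel_measurable_smooth: "smooth f \<Longrightarrow> f \<in> borel_measurable borel"
  by (intro borel_measurable_continuous_onI smooth_imp_continuous_on)

lemma borel_measurable_moll [measurable]: "moll h \<in> borel_measurable borel"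
  by (intro borel_measurable_smooth smooth_moll)

context
  fixes h :: real
  assumes h: "0 < h"
begin

lemma bump_eq_0: "h \<le> norm x \<Longrightarrow> bump h x = 0"
  using h by (simp add: bump_def flat_def power_mono)

lemma bump_pos: "norm x < h \<Longrightarrow> 0 < bump h x"
  using h by (simp add: bump_def flat_1_pos_iff power_strict_mono)

lemma integrable_bump: "integrable lborel (bump h)"
proof -
  have "integrable lborel (\<lambda>x. indicator (cball 0 h) x *\<^sub>R bump h x)"
    by (intro borel_integrable_compact smooth_imp_continuous_on smooth_bump) simp
  also have "(\<lambda>x. indicator (cball 0 h) x *\<^sub>R bump h x) = bump h"
    by (auto simp: fun_eq_iff indicator_def bump_eq_0)
  finally show ?thesis .
qed

lemma integral_bump_pos: "0 < (LINT t|lborel. bump h t)"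
proof (rule ccontr)
  assume "\<not> ?thesis"
  then have "(LINT t|lborel. bump h t) = 0"
    using Bochner_Integration.integral_nonneg[of lborel "bump h"] bump_nonneg by (simp add: antisym)
  then have "AE x in lborel. bump h x = 0"
    using integral_nonneg_eq_0_iff_AE[OF integrable_bump] bump_nonneg by simp
  then have "AE x in lborel. x \<notin> ball (0::real^2) h"
  proof eventually_elim
    case (elim x)
    then show ?case using bump_pos[of x] by auto
  qed
  then have "emeasure lborel (ball (0::real^2) h) = 0"
    by (subst (asm) AE_iff_measurable[of "ball 0 h"]) auto
  then have "measure lborel (ball (0::real^2) h) = 0" by (simp add: measure_def)
  then show False using h content_ball_gt_0_iff[of "0::real^2" h] by simp
qed

lemma moll_nonneg: "0 \<le> moll h x"
  unfolding moll_def using bump_nonneg integral_bump_pos by (simp add: less_imp_le)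

lemma moll_le: "moll h x \<le> 1 / (LINT t|lborel. bump h t)"
  unfolding moll_def using bump_le_1 integral_bump_pos by (intro divide_right_mono) (auto simp: less_imp_le)

lemma moll_eq_0: "h \<le> norm x \<Longrightarrow> moll h x = 0"
  by (simp add: moll_def bump_eq_0)

lemma moll_commute: "moll h (x - t) = moll h (t - x)"
  by (simp add: moll_def bump_def norm_minus_commute)

lemma nn_integral_moll: "(\<integral>\<^sup>+t. ennreal (moll h (x - t)) \<partial>lborel) = 1"
proof -
  have "(\<integral>\<^sup>+t. ennreal (moll h (x - t)) \<partial>lborel) = (\<integral>\<^sup>+t. ennreal (moll h t) \<partial>distr lborel borel (\<lambda>t. x - t))"
    by (subst nn_integral_distr) auto
  also have "\<dots> = (\<integral>\<^sup>+t. ennreal (moll h t) \<partial>lborel)" unfolding lborel_distr_reflect ..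
  also have "\<dots> = ennreal (LINT t|lborel. moll h t)"
    using moll_nonneg integrable_bump unfolding moll_def by (intro nn_integral_eq_integral) auto
  also have "(LINT t|lborel. moll h t) = 1"
    using integral_bump_pos by (simp add: moll_def)
  finally show ?thesis by simp
qed

lemma integrable_moll: "integrable lborel (\<lambda>t. moll h (x - t))"
  by (rule integrableI_nonneg) (auto simp: moll_nonneg nn_integral_moll)

lemma integral_moll: "(LINT t|lborel. moll h (x - t)) = 1"
proof -
  have "ennreal (LINT t|lborel. moll h (x - t)) = 1"
    using nn_integral_eq_integral[OF integrable_moll[of x]] moll_nonneg nn_integral_moll[of x] by simp
  then show ?thesis by (simp only: ennreal_eq_1)
qed

lemma integrable_mult_moll:
  assumes "integrable lborel f"
  shows "integrable lborel (\<lambda>t. f t * moll h (x - t))"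
proof -
  define C where "C = 1 / (LINT t|lborel. bump h t)"
  have C: "0 \<le> C" "\<And>z. moll h z \<le> C"
    using integral_bump_pos moll_le by (auto simp: C_def)
  have [measurable]: "f \<in> borel_measurable borel" using assms by auto
  show ?thesis
  proof (rule Bochner_Integration.integrable_bound)
    show "integrable lborel (\<lambda>t. C * f t)" using assms by simp
    show "AE t in lborel. norm (f t * moll h (x - t)) \<le> norm (C * f t)"
    proof (intro AE_I2)
      fix t
      have "\<bar>f t\<bar> * moll h (x - t) \<le> \<bar>f t\<bar> * C" by (intro mult_left_mono C) auto
      then show "norm (f t * moll h (x - t)) \<le> norm (C * f t)"
        using C(1) moll_nonneg by (simp add: abs_mult mult.commute)
    qed
  qed measurable
qed

text \<open>Jensen's inequality for the probability density \<open>moll h (x - t)\<close>. For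
  exponent 2 it is the nonnegativity of the variance, the integral of
  \<open>(f t - F)\<^sup>2\<close> against that density.\<close>

lemma conv_pow_le:
  assumes p: "p = 1 \<or> p = (2::nat)" and f: "f \<in> borel_measurable borel" "integrable lborel (\<lambda>t. \<bar>f t\<bar> ^ p)"
  shows "ennreal (\<bar>conv f h x\<bar> ^ p) \<le> (\<integral>\<^sup>+t. ennreal (\<bar>f t\<bar> ^ p) * ennreal (moll h (x - t)) \<partial>lborel)"
proof -
  note f(1)[measurable]
  have i: "integrable lborel (\<lambda>t. \<bar>f t\<bar> ^ p * moll h (x - t))" by (rule integrable_mult_moll[OF f(2)])
  have "\<bar>conv f h x\<bar> ^ p \<le> (LINT t|lborel. \<bar>f t\<bar> ^ p * moll h (x - t))"
    using p
  proof
    assume p: "p = 1"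
    have "\<bar>conv f h x\<bar> \<le> (LINT t|lborel. \<bar>f t * moll h (x - t)\<bar>)"
      unfolding conv_def by (rule integral_abs_bound)
    then show ?thesis using p by (simp add: abs_mult moll_nonneg)
  next
    assume p: "p = 2"
    define F where "F = conv f h x"
    have i2: "integrable lborel (\<lambda>t. (f t)\<^sup>2 * moll h (x - t))" using i by (simp add: p)
    have i1: "integrable lborel (\<lambda>t. f t * moll h (x - t))"
    proof (rule Bochner_Integration.integrable_bound)
      show "integrable lborel (\<lambda>t. (f t)\<^sup>2 * moll h (x - t) + moll h (x - t))"
        by (intro Bochner_Integration.integrable_add i2 integrable_moll)
      show "AE t in lborel. norm (f t * moll h (x - t)) \<le> norm ((f t)\<^sup>2 * moll h (x - t) + moll h (x - t))"
      proof (intro AE_I2)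
        fix t
        have "\<bar>f t\<bar> \<le> (f t)\<^sup>2 + 1"
          using zero_le_power2[of "\<bar>f t\<bar> - 1/2"] by (simp add: power2_eq_square algebra_simps)
        from mult_right_mono[OF this moll_nonneg[of "x - t"]]
        show "norm (f t * moll h (x - t)) \<le> norm ((f t)\<^sup>2 * moll h (x - t) + moll h (x - t))"
          by (simp add: abs_mult moll_nonneg algebra_simps)
      qed
    qed simp
    have "0 \<le> (LINT t|lborel. (f t - F)\<^sup>2 * moll h (x - t))"
      by (intro Bochner_Integration.integral_nonneg) (simp add: moll_nonneg)
    also have "(\<lambda>t. (f t - F)\<^sup>2 * moll h (x - t)) = (\<lambda>t. (f t)\<^sup>2 * moll h (x - t) - (2 * F) * (f t * moll h (x - t)) + F\<^sup>2 * moll h (x - t))"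
      by (simp add: fun_eq_iff power2_eq_square algebra_simps)
    also have "(LINT t|lborel. (f t)\<^sup>2 * moll h (x - t) - (2 * F) * (f t * moll h (x - t)) + F\<^sup>2 * moll h (x - t))
      = (LINT t|lborel. (f t)\<^sup>2 * moll h (x - t)) - (2 * F) * F + F\<^sup>2"
      using i1 i2 integrable_moll[of x] integral_moll[of x] by (simp add: F_def conv_def)
    finally show ?thesis by (simp add: p F_def[symmetric] power2_eq_square)
  qed
  then have "ennreal (\<bar>conv f h x\<bar> ^ p) \<le> ennreal (LINT t|lborel. \<bar>f t\<bar> ^ p * moll h (x - t))"
    by (rule ennreal_leI)
  also have "\<dots> = (\<integral>\<^sup>+t. ennreal (\<bar>f t\<bar> ^ p * moll h (x - t)) \<partial>lborel)"
    by (rule nn_integral_eq_integral[OF i, symmetric]) (simp add: moll_nonneg)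
  finally show ?thesis by (simp add: ennreal_mult moll_nonneg)
qed

lemma borel_measurable_conv [measurable]:
  assumes [measurable]: "f \<in> borel_measurable borel"
  shows "conv f h \<in> borel_measurable borel"
proof -
  have "(\<lambda>x. LINT t|lborel. f t * moll h (x - t)) \<in> borel_measurable borel"
    by (rule lborel.borel_measurable_lebesgue_integral) simp
  then show ?thesis unfolding conv_def[abs_def] .
qed

lemma conv_young:
  assumes p: "p = 1 \<or> p = (2::nat)" and f: "f \<in> borel_measurable borel" "integrable lborel (\<lambda>t. \<bar>f t\<bar> ^ p)"
  shows "(\<integral>\<^sup>+x. ennreal (\<bar>conv f h x\<bar> ^ p) \<partial>lborel) \<le> (\<integral>\<^sup>+x. ennreal (\<bar>f x\<bar> ^ p) \<partial>lborel)"
proof -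
  note f(1)[measurable]
  have "(\<integral>\<^sup>+x. ennreal (\<bar>conv f h x\<bar> ^ p) \<partial>lborel)
     \<le> (\<integral>\<^sup>+x. (\<integral>\<^sup>+t. ennreal (\<bar>f t\<bar> ^ p) * ennreal (moll h (x - t)) \<partial>lborel) \<partial>lborel)"
    by (intro nn_integral_mono conv_pow_le p f)
  also have "\<dots> = (\<integral>\<^sup>+t. (\<integral>\<^sup>+x. ennreal (\<bar>f t\<bar> ^ p) * ennreal (moll h (x - t)) \<partial>lborel) \<partial>lborel)"
    by (rule lborel_pair.Fubini') simp
  also have "\<dots> = (\<integral>\<^sup>+t. ennreal (\<bar>f t\<bar> ^ p) * (\<integral>\<^sup>+x. ennreal (moll h (t - x)) \<partial>lborel) \<partial>lborel)"
    by (subst moll_commute) (simp add: nn_integral_cmult)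
  also have "\<dots> = (\<integral>\<^sup>+x. ennreal (\<bar>f x\<bar> ^ p) \<partial>lborel)" by (simp add: nn_integral_moll)
  finally show ?thesis .
qed

end

text \<open>Truncation at height \<open>m\<close> costs little by dominated convergence. A
  measurable function is an almost everywhere limit of continuous ones; truncating these too bounds
  the difference by \<open>2 * m\<close> on a square of finite measure, so dominated convergence
  applies again.\<close>

lemma exists_continuous_Lp_approx:
  fixes f :: "real^2 \<Rightarrow> real"
  assumes p: "p = 1 \<or> p = (2::nat)" and f: "f \<in> borel_measurable borel" "integrable lborel (\<lambda>t. \<bar>f t\<bar> ^ p)"
    and e: "0 < (e::real)"
  shows "\<exists>g. continuous_on UNIV g \<and> (\<integral>\<^sup>+x. ennreal (\<bar>f x - g x\<bar> ^ p) * indicator (cube d) x \<partial>lborel) < ennreal e"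
proof -
  note f(1)[measurable]
  have [measurable]: "cube d \<in> sets borel" by (simp add: cube_def)
  define cl :: "real \<Rightarrow> real \<Rightarrow> real" where "cl m x = max (- m) (min m x)" for m x
  have fin: "(\<integral>\<^sup>+x. ennreal (\<bar>f x\<bar> ^ p) \<partial>lborel) < \<infinity>"
    using f(2) by (simp add: integrable_iff_bounded)
  have "(\<lambda>n. \<integral>\<^sup>+x. ennreal (\<bar>f x - cl (real n) (f x)\<bar> ^ p) \<partial>lborel) \<longlonglongrightarrow> (\<integral>\<^sup>+x. 0 \<partial>(lborel::(real^2) measure))"
  proof (rule nn_integral_dominated_convergence[where w="\<lambda>x. ennreal (\<bar>f x\<bar> ^ p)"])
    show "AE x in lborel. ennreal (\<bar>f x - cl (real j) (f x)\<bar> ^ p) \<le> ennreal (\<bar>f x\<bar> ^ p)" for j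
      by (intro AE_I2 ennreal_leI power_mono) (auto simp: cl_def)
    show "AE x in lborel. (\<lambda>i. ennreal (\<bar>f x - cl (real i) (f x)\<bar> ^ p)) \<longlonglongrightarrow> 0"
    proof (intro AE_I2 tendsto_eventually)
      fix x
      obtain n where n: "\<bar>f x\<bar> \<le> real n" using real_arch_simple by blast
      show "\<forall>\<^sub>F i in sequentially. ennreal (\<bar>f x - cl (real i) (f x)\<bar> ^ p) = 0"
        using eventually_ge_at_top[of n]
      proof eventually_elim
        case (elim i)
        then have "cl (real i) (f x) = f x" using n by (auto simp: cl_def)
        then show ?case using p by auto
      qed
    qed
  qed (use fin in \<open>auto simp: cl_def\<close>)
  then have "\<forall>\<^sub>F n in sequentially. (\<integral>\<^sup>+x. ennreal (\<bar>f x - cl (real n) (f x)\<bar> ^ p) \<partial>lborel) < ennreal (e / 4)"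
    using e by (intro order_tendstoD) auto
  then obtain m where m: "(\<integral>\<^sup>+x. ennreal (\<bar>f x - cl (real m) (f x)\<bar> ^ p) \<partial>lborel) < ennreal (e / 4)"
    using eventually_happens by force
  have "f measurable_on UNIV"
    by (intro lebesgue_measurable_imp_measurable_on measurable_completion) auto
  then obtain N and g :: "nat \<Rightarrow> real^2 \<Rightarrow> real" where N: "negligible N" and cg: "\<And>n. continuous_on UNIV (g n)"
    and g: "\<And>x. x \<notin> N \<Longrightarrow> (\<lambda>n. g n x) \<longlonglongrightarrow> f x"
    unfolding measurable_on_def by auto
  have [measurable]: "g n \<in> borel_measurable borel" for n
    using cg by (rule borel_measurable_continuous_onI)
  have aeN: "AE x in lborel. x \<notin> N"
    using AE_not_in[of N lebesgue] N by (simp add: negligible_iff_null_sets AE_completion_iff)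
  have "(\<lambda>n. \<integral>\<^sup>+x. ennreal (\<bar>cl (real m) (f x) - cl (real m) (g n x)\<bar> ^ p) * indicator (cube d) x \<partial>lborel) \<longlonglongrightarrow> (\<integral>\<^sup>+x. 0 \<partial>(lborel::(real^2) measure))"
  proof (rule nn_integral_dominated_convergence[where w="\<lambda>x. ennreal ((2 * real m) ^ p) * indicator (cube d) x"])
    show "AE x in lborel. ennreal (\<bar>cl (real m) (f x) - cl (real m) (g j x)\<bar> ^ p) * indicator (cube d) x
       \<le> ennreal ((2 * real m) ^ p) * indicator (cube d) x" for j
      by (intro AE_I2 mult_right_mono ennreal_leI power_mono) (auto simp: cl_def)
    show "(\<integral>\<^sup>+x. ennreal ((2 * real m) ^ p) * indicator (cube d) x \<partial>lborel) < \<infinity>"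
      using emeasure_bounded_finite[OF bounded_cbox, of "vec (- d) :: real^2" "vec d"]
      by (simp add: nn_integral_cmult ennreal_mult_less_top cube_def)
    show "AE x in lborel. (\<lambda>n. ennreal (\<bar>cl (real m) (f x) - cl (real m) (g n x)\<bar> ^ p) * indicator (cube d) x) \<longlonglongrightarrow> 0"
      using aeN
    proof eventually_elim
      case (elim x)
      have "(\<lambda>n. \<bar>cl (real m) (f x) - cl (real m) (g n x)\<bar> ^ p) \<longlonglongrightarrow> \<bar>cl (real m) (f x) - cl (real m) (f x)\<bar> ^ p"
        unfolding cl_def by (intro tendsto_intros g elim)
      then have "(\<lambda>n. ennreal (\<bar>cl (real m) (f x) - cl (real m) (g n x)\<bar> ^ p)) \<longlonglongrightarrow> ennreal 0"
        using p by (intro tendsto_ennrealI) auto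
      then show ?case by (cases "x \<in> cube d") auto
    qed
  qed (auto simp: cl_def)
  then have "\<forall>\<^sub>F n in sequentially. (\<integral>\<^sup>+x. ennreal (\<bar>cl (real m) (f x) - cl (real m) (g n x)\<bar> ^ p) * indicator (cube d) x \<partial>lborel) < ennreal (e / 4)"
    using e by (intro order_tendstoD) auto
  then obtain n where n: "(\<integral>\<^sup>+x. ennreal (\<bar>cl (real m) (f x) - cl (real m) (g n x)\<bar> ^ p) * indicator (cube d) x \<partial>lborel) < ennreal (e / 4)"
    using eventually_happens by force
  define G where "G x = cl (real m) (g n x)" for x
  have cG: "continuous_on UNIV G" unfolding G_def cl_def by (intro continuous_intros cg)
  have "(\<integral>\<^sup>+x. ennreal (\<bar>f x - G x\<bar> ^ p) * indicator (cube d) x \<partial>lborel)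
    \<le> (\<integral>\<^sup>+x. 2 * ennreal (\<bar>f x - cl (real m) (f x)\<bar> ^ p) + 2 * (ennreal (\<bar>cl (real m) (f x) - G x\<bar> ^ p) * indicator (cube d) x) \<partial>lborel)"
  proof (rule nn_integral_mono)
    fix x
    have "\<bar>f x - G x\<bar> ^ p \<le> 2 * (\<bar>f x - cl (real m) (f x)\<bar> ^ p + \<bar>cl (real m) (f x) - G x\<bar> ^ p)"
      using abs_add_pow_le[OF p, of "f x - cl (real m) (f x)" "cl (real m) (f x) - G x"] by simp
    then have "ennreal (\<bar>f x - G x\<bar> ^ p) \<le> ennreal (2 * (\<bar>f x - cl (real m) (f x)\<bar> ^ p + \<bar>cl (real m) (f x) - G x\<bar> ^ p))"
      by (rule ennreal_leI)
    also have "\<dots> = 2 * ennreal (\<bar>f x - cl (real m) (f x)\<bar> ^ p) + 2 * ennreal (\<bar>cl (real m) (f x) - G x\<bar> ^ p)"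
      by (simp add: ennreal_mult distrib_left)
    finally show "ennreal (\<bar>f x - G x\<bar> ^ p) * indicator (cube d) x
       \<le> 2 * ennreal (\<bar>f x - cl (real m) (f x)\<bar> ^ p) + 2 * (ennreal (\<bar>cl (real m) (f x) - G x\<bar> ^ p) * indicator (cube d) x)"
      by (cases "x \<in> cube d") auto
  qed
  also have "\<dots> = 2 * (\<integral>\<^sup>+x. ennreal (\<bar>f x - cl (real m) (f x)\<bar> ^ p) \<partial>lborel)
     + 2 * (\<integral>\<^sup>+x. ennreal (\<bar>cl (real m) (f x) - G x\<bar> ^ p) * indicator (cube d) x \<partial>lborel)"
    by (simp add: nn_integral_add nn_integral_cmult G_def cl_def)
  also have "\<dots> < 2 * ennreal (e / 4) + 2 * ennreal (e / 4)"
    using m n unfolding G_def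
    by (intro add_strict_mono) (auto intro!: ennreal_mult_strict_left_mono)
  also have "\<dots> = ennreal e"
    using e by (simp flip: ennreal_numeral ennreal_mult ennreal_plus)
  finally show ?thesis using cG by blast
qed

lemma borel_cube [measurable]: "cube d \<in> sets borel"
  by (simp add: cube_def)

lemma nn_integral_const_cube: "0 \<le> c \<Longrightarrow> 0 \<le> d \<Longrightarrow> (\<integral>\<^sup>+x. ennreal c * indicator (cube d) x \<partial>lborel) = ennreal (c * (2 * d)\<^sup>2)"
proof -
  assume "0 \<le> c" "0 \<le> d"
  have "emeasure lborel (cube d) = ennreal ((2 * d)\<^sup>2)"
  proof -
    have "emeasure lborel (cube d) \<noteq> top"
      using emeasure_bounded_finite[OF bounded_cbox, of "vec (- d) :: real^2" "vec d"] by (auto simp: cube_def)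
    then show ?thesis using content_cube[OF \<open>0 \<le> d\<close>] by (simp add: emeasure_eq_ennreal_measure)
  qed
  then show ?thesis using \<open>0 \<le> c\<close> by (simp add: nn_integral_cmult_indicator ennreal_mult)
qed

lemma integrable_of_pow:
  fixes f :: "real^2 \<Rightarrow> real"
  assumes p: "p = 1 \<or> p = (2::nat)" and f: "f \<in> borel_measurable borel" "integrable lborel (\<lambda>t. \<bar>f t\<bar> ^ p)"
    and supp: "\<And>x. x \<notin> cube d \<Longrightarrow> f x = 0"
  shows "integrable lborel f"
proof (rule Bochner_Integration.integrable_bound)
  have "integrable lborel (\<lambda>x. indicator (cube d) x :: real)"
    unfolding cube_def using emeasure_bounded_finite[OF bounded_cbox, of "vec (- d) :: real^2" "vec d"]
    by (intro integrable_real_indicator) (auto simp: less_top)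
  then show "integrable lborel (\<lambda>t. \<bar>f t\<bar> ^ p + indicator (cube d) t)"
    using f(2) by (rule Bochner_Integration.integrable_add[rotated])
  show "AE t in lborel. norm (f t) \<le> norm (\<bar>f t\<bar> ^ p + indicator (cube d) t)"
  proof (intro AE_I2)
    fix t
    have "\<bar>f t\<bar> \<le> \<bar>f t\<bar> ^ p + 1"
      using p zero_le_power2[of "\<bar>f t\<bar> - 1/2"] by (auto simp: power2_eq_square algebra_simps)
    then show "norm (f t) \<le> norm (\<bar>f t\<bar> ^ p + indicator (cube d) t)"
      using supp[of t] by (cases "t \<in> cube d") auto
  qed
qed (use f in auto)

text \<open>Density argument: mollification is uniformly close to the identity for a continuous
  \<open>g\<close> near \<open>f\<close>, and Young's inequality transfers the smallness of
  \<open>f - g\<close>. Cutting \<open>g\<close> off at the edge of \<open>cube (11/2)\<close> may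
  make it discontinuous there, which points of \<open>cube 5\<close> do not notice at radii up to
  1/2.\<close>

lemma conv_tendsto:
  assumes p: "p = 1 \<or> p = (2::nat)" and f: "f \<in> borel_measurable borel" "integrable lborel (\<lambda>t. \<bar>f t\<bar> ^ p)"
    and supp: "\<And>x. x \<notin> cube (11/2) \<Longrightarrow> f x = 0" and e: "0 < (e::real)"
  shows "\<exists>h0>0. \<forall>h. 0 < h \<and> h \<le> h0 \<longrightarrow>
     (\<integral>\<^sup>+x. ennreal (\<bar>conv f h x - f x\<bar> ^ p) * indicator (cube 5) x \<partial>lborel) < ennreal e"
proof -
  note f(1)[measurable]
  obtain g where g: "continuous_on UNIV g"
    "(\<integral>\<^sup>+x. ennreal (\<bar>f x - g x\<bar> ^ p) * indicator (cube (11/2)) x \<partial>lborel) < ennreal (e / 16)"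
    using exists_continuous_Lp_approx[OF p f, of "e / 16"] e by auto
  have [measurable]: "g \<in> borel_measurable borel" using g(1) by (rule borel_measurable_continuous_onI)
  \<comment> \<open>\<open>cube 5\<close> has area 100, so \<open>4 * k\<close> integrates to at
    most \<open>e / 4\<close>; with 2 + 4 times \<open>e / 16\<close> the total is
    \<open>5/8 * e\<close>.\<close>
  define k where "k = min 1 (e / 1600)"
  have k: "0 < k" "k \<le> 1" "k \<le> e / 1600" using e by (auto simp: k_def)
  have kp: "k ^ p \<le> k" using p k by (auto simp: power2_eq_square mult_left_le)
  have "uniformly_continuous_on (cube (11/2)) g"
    unfolding cube_def by (intro compact_uniformly_continuous continuous_on_subset[OF g(1)] compact_cbox) auto
  then obtain d where d: "d > 0" "\<And>x t. x \<in> cube (11/2) \<Longrightarrow> t \<in> cube (11/2) \<Longrightarrow> dist t x < d \<Longrightarrow> dist (g t) (g x) < k"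
    using k(1) unfolding uniformly_continuous_on_def by metis
  define g1 where "g1 x = g x * indicator (cube (11/2)) x" for x
  have [measurable]: "g1 \<in> borel_measurable borel" unfolding g1_def by measurable
  have "integrable lborel (\<lambda>x. indicator (cube (11/2)) x *\<^sub>R g x)"
    unfolding cube_def by (intro borel_integrable_compact compact_cbox continuous_on_subset[OF g(1)]) auto
  then have ig1: "integrable lborel g1" by (simp add: g1_def[abs_def] mult.commute)
  define q where "q x = f x - g1 x" for x
  have [measurable]: "q \<in> borel_measurable borel" unfolding q_def by measurable
  have if1: "integrable lborel f" by (rule integrable_of_pow[OF p f supp])
  have qp: "\<bar>q x\<bar> ^ p = \<bar>f x - g x\<bar> ^ p * indicator (cube (11/2)) x" for x
    using p supp[of x] by (cases "x \<in> cube (11/2)") (auto simp: q_def g1_def)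
  then have Q: "(\<integral>\<^sup>+x. ennreal (\<bar>q x\<bar> ^ p) \<partial>lborel) < ennreal (e / 16)"
    using g(2) by (simp add: ennreal_mult ennreal_indicator)
  have iq: "integrable lborel (\<lambda>x. \<bar>q x\<bar> ^ p)"
    using Q by (intro integrableI_bounded) (auto intro: less_trans)
  define h0 where "h0 = min (1/2) d"
  have "(\<integral>\<^sup>+x. ennreal (\<bar>conv f h x - f x\<bar> ^ p) * indicator (cube 5) x \<partial>lborel) < ennreal e" if h: "0 < h" "h \<le> h0" for h
  proof -
    have split: "conv f h x = conv q h x + conv g1 h x" for x
    proof -
      have "conv q h x = conv f h x - conv g1 h x"
        unfolding conv_def q_def left_diff_distrib
        by (intro Bochner_Integration.integral_diff integrable_mult_moll[OF h(1)] if1 ig1)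
      then show ?thesis by simp
    qed
    have cg: "\<bar>conv g1 h x - g x\<bar> \<le> k" if x: "x \<in> cube 5" for x
    proof -
      have im: "integrable lborel (\<lambda>t. g1 t * moll h (x - t))" "integrable lborel (\<lambda>t. g x * moll h (x - t))"
        using integrable_mult_moll[OF h(1) ig1] integrable_moll[OF h(1)] by auto
      have "conv g1 h x - g x = (LINT t|lborel. g1 t * moll h (x - t)) - (LINT t|lborel. g x * moll h (x - t))"
        using integral_moll[OF h(1), of x] by (simp add: conv_def)
      also have "\<dots> = (LINT t|lborel. g1 t * moll h (x - t) - g x * moll h (x - t))"
        by (intro Bochner_Integration.integral_diff[symmetric] im)
      also have "\<bar>\<dots>\<bar> \<le> (LINT t|lborel. k * moll h (x - t))"
      proof (rule integral_abs_bound_integral)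
        show "integrable lborel (\<lambda>t. g1 t * moll h (x - t) - g x * moll h (x - t))"
          by (intro Bochner_Integration.integrable_diff im)
        show "integrable lborel (\<lambda>t. k * moll h (x - t))" using integrable_moll[OF h(1)] by simp
        fix t
        show "\<bar>g1 t * moll h (x - t) - g x * moll h (x - t)\<bar> \<le> k * moll h (x - t)"
        proof (cases "h \<le> norm (x - t)")
          case True
          then show ?thesis using moll_eq_0[OF h(1) True] by simp
        next
          case False
          have c: "\<bar>(x - t)$i\<bar> \<le> 1/2" for i
            using component_le_norm_cart[of "x - t" i] False h by (auto simp: h0_def)
          have t: "t \<in> cube (11/2)"
            using x c[of 1] c[of 2] unfolding mem_cube vector_minus_component by arith
          moreover have "x \<in> cube (11/2)" using x by (auto simp: mem_cube)
          moreover have "dist t x < d" using False h by (simp add: h0_def dist_norm norm_minus_commute)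
          ultimately have "dist (g t) (g x) < k" using d by blast
          then have "\<bar>g1 t - g x\<bar> \<le> k" using t by (simp add: g1_def dist_real_def)
          then have "\<bar>g1 t - g x\<bar> * moll h (x - t) \<le> k * moll h (x - t)"
            by (intro mult_right_mono moll_nonneg[OF h(1)])
          then show ?thesis
            using moll_nonneg[OF h(1)] by (simp add: left_diff_distrib[symmetric] abs_mult)
        qed
      qed
      also have "\<dots> = k" using integral_moll[OF h(1), of x] by simp
      finally show ?thesis .
    qed
    have pw: "ennreal (\<bar>conv f h x - f x\<bar> ^ p) * indicator (cube 5) x \<le>
       2 * ennreal (\<bar>conv q h x\<bar> ^ p) + (ennreal (4 * k) * indicator (cube 5) x + 4 * (ennreal (\<bar>f x - g x\<bar> ^ p) * indicator (cube (11/2)) x))" for x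
    proof (cases "x \<in> cube 5")
      case True
      then have x': "x \<in> cube (11/2)" by (auto simp: mem_cube)
      have 1: "\<bar>conv f h x - f x\<bar> ^ p \<le> 2 * (\<bar>conv q h x\<bar> ^ p + \<bar>conv g1 h x - f x\<bar> ^ p)"
        using abs_add_pow_le[OF p, of "conv q h x" "conv g1 h x - f x"] unfolding split by (simp add: add_diff_eq)
      have 2: "\<bar>conv g1 h x - f x\<bar> ^ p \<le> 2 * (\<bar>conv g1 h x - g x\<bar> ^ p + \<bar>g x - f x\<bar> ^ p)"
        using abs_add_pow_le[OF p, of "conv g1 h x - g x" "g x - f x"] by simp
      have 3: "\<bar>conv g1 h x - g x\<bar> ^ p \<le> k"
        using power_mono[OF cg[OF True], of p] kp by simp
      have "a \<le> 2 * (b + c) \<Longrightarrow> c \<le> 2 * (d + e) \<Longrightarrow> d \<le> k \<Longrightarrow> a \<le> 2 * b + (4 * k + 4 * e)" for a b c d e :: real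
        by simp
      from this[OF 1 2[unfolded abs_minus_commute[of "g x"]] 3]
      have "\<bar>conv f h x - f x\<bar> ^ p \<le> 2 * \<bar>conv q h x\<bar> ^ p + (4 * k + 4 * \<bar>f x - g x\<bar> ^ p)" .
      then have "ennreal (\<bar>conv f h x - f x\<bar> ^ p) \<le> ennreal (2 * \<bar>conv q h x\<bar> ^ p + (4 * k + 4 * \<bar>f x - g x\<bar> ^ p))"
        by (rule ennreal_leI)
      also have "\<dots> = 2 * ennreal (\<bar>conv q h x\<bar> ^ p) + (ennreal (4 * k) + 4 * ennreal (\<bar>f x - g x\<bar> ^ p))"
        using k by (simp add: ennreal_plus ennreal_mult)
      finally show ?thesis using True x' by simp
    qed simp
    have "(\<integral>\<^sup>+x. ennreal (\<bar>conv f h x - f x\<bar> ^ p) * indicator (cube 5) x \<partial>lborel)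
      \<le> (\<integral>\<^sup>+x. 2 * ennreal (\<bar>conv q h x\<bar> ^ p) + (ennreal (4 * k) * indicator (cube 5) x + 4 * (ennreal (\<bar>f x - g x\<bar> ^ p) * indicator (cube (11/2)) x)) \<partial>lborel)"
      by (intro nn_integral_mono pw)
    also have "\<dots> = 2 * (\<integral>\<^sup>+x. ennreal (\<bar>conv q h x\<bar> ^ p) \<partial>lborel) + ((\<integral>\<^sup>+x. ennreal (4 * k) * indicator (cube 5) x \<partial>lborel)
       + 4 * (\<integral>\<^sup>+x. ennreal (\<bar>f x - g x\<bar> ^ p) * indicator (cube (11/2)) x \<partial>lborel))"
      using borel_measurable_conv[OF h(1), of q]
      by (simp add: nn_integral_add nn_integral_cmult)
    also have "\<dots> \<le> 2 * ennreal (e / 16) + (ennreal (e / 4) + 4 * ennreal (e / 16))"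
    proof (intro add_mono mult_left_mono)
      show "(\<integral>\<^sup>+x. ennreal (\<bar>conv q h x\<bar> ^ p) \<partial>lborel) \<le> ennreal (e / 16)"
        using conv_young[OF h(1) p _ iq] Q by (meson \<open>q \<in> borel_measurable borel\<close> less_imp_le order_trans)
      show "(\<integral>\<^sup>+x. ennreal (4 * k) * indicator (cube 5) x \<partial>lborel) \<le> ennreal (e / 4)"
        using k nn_integral_const_cube[of "4 * k" 5] by (simp add: ennreal_leI)
    qed (use g(2) in \<open>auto simp: less_imp_le\<close>)
    also have "\<dots> = ennreal (5/8 * e)"
      using e by (simp flip: ennreal_numeral ennreal_mult ennreal_plus)
    also have "\<dots> < ennreal e" using e by (simp add: ennreal_lessI)
    finally show ?thesis .
  qed
  moreover have "h0 > 0" using d by (simp add: h0_def)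
  ultimately show ?thesis by blast
qed

section \<open>Borel representatives and uniqueness of weak derivatives\<close>

lemma cube_subset_ball: "cube (11/2) \<subseteq> ball (0::real^2) 8"
proof
  fix x :: "real^2" assume x: "x \<in> cube (11/2)"
  then have "(x$1)\<^sup>2 \<le> (11/2)\<^sup>2" "(x$2)\<^sup>2 \<le> (11/2)\<^sup>2"
    by (auto simp: mem_cube abs_le_square_iff[symmetric])
  \<comment> \<open>11/2 is 5 plus the largest mollification radius 1/2; the corners of the square
    have norm about 7.78.\<close>
  then have "(norm x)\<^sup>2 < 8\<^sup>2" unfolding norm_sq_2 by (simp add: power2_eq_square)
  then have "norm x < 8" by (rule power2_less_imp_less) simp
  then show "x \<in> ball 0 8" by simp
qed

text \<open>Tonelli and convolution with respect to \<open>lborel\<close> call for Borel functions,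
  while weak derivatives are only Lebesgue measurable on the domain. The value 0 outside the square
  makes the representative a function on the whole plane.\<close>

lemma exists_borel_representative:
  fixes f :: "real^2 \<Rightarrow> real"
  assumes "integrable (lebesgue_on (cube (11/2))) f"
  shows "\<exists>f'. f' \<in> borel_measurable borel \<and> (\<forall>x. x \<notin> cube (11/2) \<longrightarrow> f' x = 0) \<and>
     (AE x in lborel. x \<in> cube (11/2) \<longrightarrow> f' x = f x)"
proof -
  have "(\<lambda>x. indicator (cube (11/2)) x *\<^sub>R f x) \<in> borel_measurable lebesgue"
    using assms by (subst borel_measurable_restrict_space_iff[symmetric]) auto
  then obtain g where g: "g \<in> borel_measurable lborel" "AE x in lborel. indicator (cube (11/2)) x *\<^sub>R f x = g x"
    using completion_ex_borel_measurable_real by blast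
  have [measurable]: "g \<in> borel_measurable borel" using g(1) by simp
  have "AE x in lborel. x \<in> cube (11/2) \<longrightarrow> indicator (cube (11/2)) x * g x = f x"
    using g(2) by eventually_elim auto
  then show ?thesis
    by (intro exI[of _ "\<lambda>x. indicator (cube (11/2)) x * g x"]) auto
qed

text \<open>The passage from the Lebesgue integrals over the ball in \<open>has_weak_partial\<close>
  to the \<open>lborel\<close> integrals in \<open>conv\<close>; the support of \<open>k\<close>
  hides the values of \<open>f\<close> outside the square.\<close>

lemma integral_lebesgue_on_eq_representative:
  fixes f f' k :: "real^2 \<Rightarrow> real"
  assumes f': "f' \<in> borel_measurable borel" "\<And>x. x \<notin> cube (11/2) \<Longrightarrow> f' x = 0"
     "AE x in lborel. x \<in> cube (11/2) \<longrightarrow> f' x = f x"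
    and f: "f \<in> borel_measurable (lebesgue_on (cube (11/2)))"
    and k: "k \<in> borel_measurable borel" "\<And>x. x \<notin> cube (11/2) \<Longrightarrow> k x = 0"
  shows "(LINT x|lebesgue_on (ball 0 8). f x * k x) = (LINT x|lborel. f' x * k x)"
proof -
  have "(LINT x|lebesgue_on (ball 0 8). f x * k x) = (LINT x|lebesgue. indicator (ball 0 8) x *\<^sub>R (f x * k x))"
    by (rule integral_restrict_space) simp
  also have "\<dots> = (LINT x|lebesgue. f' x * k x)"
  proof (rule integral_cong_AE)
    have "(\<lambda>x. indicator (cube (11/2)) x *\<^sub>R f x) \<in> borel_measurable lebesgue"
      using f by (subst borel_measurable_restrict_space_iff[symmetric]) auto
    moreover have km: "k \<in> borel_measurable lebesgue" using k(1) by (intro measurable_completion) simp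
    ultimately have "(\<lambda>x. indicator (cube (11/2)) x *\<^sub>R f x * k x) \<in> borel_measurable lebesgue" by measurable
    also have "(\<lambda>x. indicator (cube (11/2)) x *\<^sub>R f x * k x) = (\<lambda>x. indicator (ball 0 8) x *\<^sub>R (f x * k x))"
      using cube_subset_ball k(2) by (auto simp: fun_eq_iff indicator_def)
    finally show "(\<lambda>x. indicator (ball 0 8) x *\<^sub>R (f x * k x)) \<in> borel_measurable lebesgue" .
    have "f' \<in> borel_measurable lebesgue" using f'(1) by (intro measurable_completion) simp
    then show "(\<lambda>x. f' x * k x) \<in> borel_measurable lebesgue" using km by measurable
    have "AE x in lborel. indicator (ball 0 8) x *\<^sub>R (f x * k x) = f' x * k x"
      using f'(3)
    proof eventually_elim
      case (elim x)
      then show ?case using f'(2)[of x] k(2)[of x] cube_subset_ball by (cases "x \<in> cube (11/2)") auto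
    qed
    then show "AE x in lebesgue. indicator (ball 0 8) x *\<^sub>R (f x * k x) = f' x * k x"
      by (simp add: AE_completion_iff)
  qed
  also have "\<dots> = (LINT x|lborel. f' x * k x)"
    using f'(1) k(1) by (intro integral_completion) simp
  finally show ?thesis .
qed

lemma partial_reflect:
  assumes "smooth k"
  shows "partial i (\<lambda>t. k (x - t)) t = - partial i k (x - t)"
    and "(\<lambda>t. k (x - t)) differentiable (at t)"
proof -
  have "((\<lambda>t. x - t) has_derivative (\<lambda>h. - h)) (at t)"
    by (auto intro!: derivative_eq_intros)
  from has_derivative_compose[OF this smooth_has_derivative[OF assms]]
  have d: "((\<lambda>t. k (x - t)) has_derivative (\<lambda>h. \<Sum>i\<in>UNIV. (- h)$i * partial i k (x - t))) (at t)" .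
  from partial_eqI[OF d] show "partial i (\<lambda>t. k (x - t)) t = - partial i k (x - t)"
    by (simp add: axis_def if_distrib[of uminus] if_distrib[of "\<lambda>x. x * _"] cong: if_cong)
  show "(\<lambda>t. k (x - t)) differentiable (at t)" using d differentiableI by blast
qed

lemma smooth_reflect:
  assumes "smooth k"
  shows "smooth (\<lambda>t. k (x - t))"
proof (rule smooth_coinduct[where P="\<lambda>f. \<exists>k. smooth k \<and> f = (\<lambda>t. k (x - t))"])
  fix f i assume "\<exists>k. smooth k \<and> f = (\<lambda>t. k (x - t))"
  then obtain k where k: "smooth k" "f = (\<lambda>t. k (x - t))" by blast
  have "partial i f = (\<lambda>t. (\<lambda>z. - partial i k z) (x - t))"
    unfolding k(2) using partial_reflect(1)[OF k(1)] by blast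
  moreover have "smooth (\<lambda>z. - partial i k z)" using k(1) by (intro smooth_intros)
  ultimately show "\<exists>k. smooth k \<and> partial i f = (\<lambda>t. k (x - t))"
    by (intro exI[of _ "\<lambda>z. - partial i k z"]) simp
next
  show "f differentiable (at t)" if "\<exists>k. smooth k \<and> f = (\<lambda>t. k (x - t))" for f t
    using that by (auto intro: partial_reflect(2))
  show "\<exists>k'. smooth k' \<and> (\<lambda>t. k (x - t)) = (\<lambda>t. k' (x - t))"
    by (intro exI[of _ k] conjI assms refl)
qed

lemma partial_eq_0_outside:
  assumes "\<And>z. h < norm z \<Longrightarrow> k z = 0" "h < norm z"
  shows "partial i k z = 0"
proof -
  have "(k has_derivative (\<lambda>h. 0)) (at z)"
  proof (rule has_derivative_transform_within_open[where f="\<lambda>z. 0"])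
    show "open {z. h < norm z}" by (intro open_Collect_less continuous_intros)
  qed (use assms in auto)
  from partial_eqI[OF this] show ?thesis by simp
qed

text \<open>This is how weak derivatives meet convolutions: for \<open>x\<close> in
  \<open>cube 5\<close> a kernel supported within radius 1/2, reflected and centred at
  \<open>x\<close>, is a legitimate test function.\<close>

lemma reflect_test_function:
  fixes k :: "real^2 \<Rightarrow> real"
  assumes k: "smooth k" "\<And>z. h < norm z \<Longrightarrow> k z = 0" and h: "h \<le> 1/2" and x: "x \<in> cube 5"
  shows "(\<lambda>t. k (x - t)) \<in> test_functions (ball 0 8)" and "\<And>t. t \<notin> cube (11/2) \<Longrightarrow> k (x - t) = 0"
proof -
  have sub: "{t. k (x - t) \<noteq> 0} \<subseteq> cube (11/2)"
  proof
    fix t assume "t \<in> {t. k (x - t) \<noteq> 0}"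
    then have "norm (x - t) \<le> 1/2" using k(2)[of "x - t"] h by fastforce
    then have c: "\<bar>(x - t)$i\<bar> \<le> 1/2" for i
      using component_le_norm_cart[of "x - t" i] by linarith
    then show "t \<in> cube (11/2)"
      using x c[of 1] c[of 2] unfolding mem_cube vector_minus_component by arith
  qed
  then show "\<And>t. t \<notin> cube (11/2) \<Longrightarrow> k (x - t) = 0" by auto
  have cl: "closure {t. k (x - t) \<noteq> 0} \<subseteq> cube (11/2)"
    using sub by (intro closure_minimal) (auto simp: cube_def)
  then have "compact (closure {t. k (x - t) \<noteq> 0})"
    using bounded_subset[OF _ cl] by (simp add: compact_eq_bounded_closed cube_def bounded_cbox)
  then show "(\<lambda>t. k (x - t)) \<in> test_functions (ball 0 8)"
    using smooth_reflect[OF k(1), of x] cl cube_subset_ball by (auto simp: test_functions_def smooth_def)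
qed

text \<open>The minus sign of the reflection cancels the one in the definition of the weak
  derivative.\<close>

lemma weak_partial_kernel:
  fixes k :: "real^2 \<Rightarrow> real"
  assumes w: "has_weak_partial (ball 0 8) i f g"
    and k: "smooth k" "\<And>z. h < norm z \<Longrightarrow> k z = 0" and h: "h \<le> 1/2" and x: "x \<in> cube 5"
  shows "(LINT t|lebesgue_on (ball 0 8). f t * partial i k (x - t)) = (LINT t|lebesgue_on (ball 0 8). g t * k (x - t))"
proof -
  have "(LINT t|lebesgue_on (ball 0 8). f t * partial i (\<lambda>t. k (x - t)) t) = - (LINT t|lebesgue_on (ball 0 8). g t * k (x - t))"
    using w reflect_test_function(1)[OF k h x] unfolding has_weak_partial_def by blast
  then show ?thesis by (simp add: partial_reflect(1)[OF k(1)])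
qed

lemma L1_loc_integrable_cube:
  assumes "f \<in> L1_loc (ball 0 8)"
  shows "integrable (lebesgue_on (cube (11/2))) f"
  using assms cube_subset_ball unfolding L1_loc_def by (simp add: cube_def)

text \<open>The fundamental lemma of the calculus of variations: mollification kernels are test
  functions, so the mollifications of the difference vanish on \<open>cube 5\<close>, and they
  converge to the difference in L^1.\<close>

lemma weak_integral_eq_imp_AE_eq:
  assumes ab: "a \<in> L1_loc (ball 0 8)" "b \<in> L1_loc (ball 0 8)"
    and eq: "\<And>\<phi>. \<phi> \<in> test_functions (ball 0 8) \<Longrightarrow>
      (LINT x|lebesgue_on (ball 0 8). a x * \<phi> x) = (LINT x|lebesgue_on (ball 0 8). b x * \<phi> x)"
  shows "AE x in lborel. x \<in> cube 5 \<longrightarrow> a x = b x"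
proof -
  note ia = L1_loc_integrable_cube[OF ab(1)] and ib = L1_loc_integrable_cube[OF ab(2)]
  obtain a' where a': "a' \<in> borel_measurable borel" "\<And>x. x \<notin> cube (11/2) \<Longrightarrow> a' x = 0"
    "AE x in lborel. x \<in> cube (11/2) \<longrightarrow> a' x = a x" using exists_borel_representative[OF ia] by blast
  obtain b' where b': "b' \<in> borel_measurable borel" "\<And>x. x \<notin> cube (11/2) \<Longrightarrow> b' x = 0"
    "AE x in lborel. x \<in> cube (11/2) \<longrightarrow> b' x = b x" using exists_borel_representative[OF ib] by blast
  note [measurable] = a'(1) b'(1)
  have int: "integrable lborel f'"
    if "integrable (lebesgue_on (cube (11/2))) f" "f' \<in> borel_measurable borel" "\<And>x. x \<notin> cube (11/2) \<Longrightarrow> f' x = 0"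
      "AE x in lborel. x \<in> cube (11/2) \<longrightarrow> f' x = f x" for f f' :: "real^2 \<Rightarrow> real"
  proof -
    have "integrable lebesgue (\<lambda>x. indicator (cube (11/2)) x *\<^sub>R f x)"
      using that(1) by (subst integrable_restrict_space[symmetric]) auto
    moreover have "f' \<in> borel_measurable lebesgue" using that(2) by (intro measurable_completion) simp
    moreover have "AE x in lebesgue. indicator (cube (11/2)) x *\<^sub>R f x = f' x"
      unfolding AE_completion_iff using that(4)
    proof eventually_elim
      case (elim x)
      then show ?case using that(3)[of x] by (cases "x \<in> cube (11/2)") auto
    qed
    ultimately have "integrable lebesgue f'"
      by (rule integrable_cong_AE_imp)
    then show ?thesis using that(2) by (simp add: integrable_completion)
  qed
  define d where "d x = a' x - b' x" for x
  have d: "d \<in> borel_measurable borel" "\<And>x. x \<notin> cube (11/2) \<Longrightarrow> d x = 0"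
    unfolding d_def[abs_def] using a'(2) b'(2) by simp_all
  note [measurable] = d(1)
  have ia': "integrable lborel a'" by (rule int[OF ia a'])
  have ib': "integrable lborel b'" by (rule int[OF ib b'])
  have id: "integrable lborel (\<lambda>t. \<bar>d t\<bar> ^ 1)"
    using ia' ib' by (auto simp: d_def)
  have conv0: "conv d h x = 0" if h: "0 < h" "h \<le> 1/2" and x: "x \<in> cube 5" for h x
  proof -
    have k: "smooth (moll h)" "\<And>z. h < norm z \<Longrightarrow> moll h z = 0" using h by (auto simp: smooth_moll moll_eq_0)
    note t = reflect_test_function[OF k h(2) x]
    have m: "(\<lambda>t. moll h (x - t)) \<in> borel_measurable borel" by measurable
    have "conv d h x = (LINT t|lborel. a' t * moll h (x - t)) - (LINT t|lborel. b' t * moll h (x - t))"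
      unfolding conv_def d_def left_diff_distrib
      by (intro Bochner_Integration.integral_diff integrable_mult_moll[OF h(1)] ia' ib')
    also have "(LINT t|lborel. a' t * moll h (x - t)) = (LINT t|lebesgue_on (ball 0 8). a t * moll h (x - t))"
      by (intro integral_lebesgue_on_eq_representative[symmetric] a' m t(2)) (use ia in auto)
    also have "(LINT t|lborel. b' t * moll h (x - t)) = (LINT t|lebesgue_on (ball 0 8). b t * moll h (x - t))"
      by (intro integral_lebesgue_on_eq_representative[symmetric] b' m t(2)) (use ib in auto)
    finally show ?thesis using eq[OF t(1)] by simp
  qed
  have small: "(\<integral>\<^sup>+x. ennreal \<bar>d x\<bar> * indicator (cube 5) x \<partial>lborel) \<le> ennreal e" if "0 < e" for e
  proof -
    obtain h0 where "h0 > 0" and h0: "\<And>h. 0 < h \<Longrightarrow> h \<le> h0 \<Longrightarrow>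
      (\<integral>\<^sup>+x. ennreal (\<bar>conv d h x - d x\<bar> ^ 1) * indicator (cube 5) x \<partial>lborel) < ennreal e"
      using conv_tendsto[OF _ d(1) id d(2) \<open>0 < e\<close>] by blast
    define h where "h = min h0 (1/2)"
    have h: "0 < h" "h \<le> h0" "h \<le> 1/2" using \<open>h0 > 0\<close> by (auto simp: h_def)
    have "(\<integral>\<^sup>+x. ennreal \<bar>d x\<bar> * indicator (cube 5) x \<partial>lborel) = (\<integral>\<^sup>+x. ennreal (\<bar>conv d h x - d x\<bar> ^ 1) * indicator (cube 5) x \<partial>lborel)"
      using conv0[OF h(1,3)] by (intro nn_integral_cong) (auto simp: indicator_def)
    then show ?thesis using h0[OF h(1,2)] by simp
  qed
  have "(\<integral>\<^sup>+x. ennreal \<bar>d x\<bar> * indicator (cube 5) x \<partial>lborel) \<le> 0"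
    by (rule ennreal_le_epsilon) (use small in simp)
  then have "(\<integral>\<^sup>+x. ennreal \<bar>d x\<bar> * indicator (cube 5) x \<partial>lborel) = 0" by simp
  then have "AE x in lborel. ennreal \<bar>d x\<bar> * indicator (cube 5) x = 0"
    by (subst (asm) nn_integral_0_iff_AE) auto
  then show ?thesis
    using a'(3) b'(3)
  proof eventually_elim
    case (elim x)
    have "x \<in> cube (11/2)" if "x \<in> cube 5" using that by (auto simp: mem_cube)
    then show ?case using elim by (auto simp: d_def)
  qed
qed

lemma partial_test_function:
  assumes "\<phi> \<in> test_functions \<Omega>"
  shows "partial i \<phi> \<in> test_functions \<Omega>"
proof -
  have s: "smooth \<phi>" and c: "compact (closure {x. \<phi> x \<noteq> 0})" "closure {x. \<phi> x \<noteq> 0} \<subseteq> \<Omega>"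
    using assms by (auto simp: test_functions_def smooth_def)
  have "{x. partial i \<phi> x \<noteq> 0} \<subseteq> closure {x. \<phi> x \<noteq> 0}"
  proof
    fix x assume x: "x \<in> {x. partial i \<phi> x \<noteq> 0}"
    show "x \<in> closure {x. \<phi> x \<noteq> 0}"
    proof (rule ccontr)
      assume nx: "x \<notin> closure {x. \<phi> x \<noteq> 0}"
      have "(\<phi> has_derivative (\<lambda>h. 0)) (at x)"
      proof (rule has_derivative_transform_within_open[where f="\<lambda>z. 0"])
        show "open (- closure {x. \<phi> x \<noteq> 0})" by (intro open_Compl closed_closure)
        show "0 = \<phi> z" if "z \<in> - closure {x. \<phi> x \<noteq> 0}" for z
          using that closure_subset[of "{x. \<phi> x \<noteq> 0}"] by auto
      qed (use nx in auto)
      from partial_eqI[OF this] show False using x by simp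
    qed
  qed
  then have sub: "closure {x. partial i \<phi> x \<noteq> 0} \<subseteq> closure {x. \<phi> x \<noteq> 0}"
    by (simp add: closure_minimal)
  then have "compact (closure {x. partial i \<phi> x \<noteq> 0})"
    using c(1) by (meson closed_closure closed_Int_compact compact_eq_bounded_closed bounded_subset)
  then show ?thesis using smooth_partial[OF s] sub c(2) by (auto simp: test_functions_def smooth_def)
qed

text \<open>Since \<open>weak_partial\<close> is a choice, its value is compared with the square integrable
  derivatives supplied by \<open>W22_loc\<close> through uniqueness of weak derivatives.\<close>

lemma W22_loc_representatives:
  assumes "v \<in> W22_loc (ball 0 8)"
  obtains g H where "\<And>i. has_weak_partial (ball 0 8) i v (g i)" "\<And>i. g i \<in> L2_loc (ball 0 8)"
    "\<And>i. AE x in lborel. x \<in> cube 5 \<longrightarrow> weak_partial (ball 0 8) i v x = g i x"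
    "\<And>i. has_weak_partial (ball 0 8) i (g i) (H i)" "\<And>i. H i \<in> L2_loc (ball 0 8)"
    "\<And>i. AE x in lborel. x \<in> cube 5 \<longrightarrow> weak_partial (ball 0 8) i (weak_partial (ball 0 8) i v) x = H i x"
proof -
  let ?B = "ball (0::real^2) 8"
  obtain g h where g: "\<And>i. has_weak_partial ?B i v (g i)" "\<And>i. g i \<in> L2_loc ?B"
    and h: "\<And>i j. has_weak_partial ?B j (g i) (h i j)" "\<And>i j. h i j \<in> L2_loc ?B"
    using assms unfolding W22_loc_def by blast
  have G: "has_weak_partial ?B i v (weak_partial ?B i v)" for i
    using someI[of "has_weak_partial ?B i v", OF g(1)] by (simp only: weak_partial_def)
  have Gg: "(LINT x|lebesgue_on ?B. weak_partial ?B i v x * \<phi> x) = (LINT x|lebesgue_on ?B. g i x * \<phi> x)"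
    if "\<phi> \<in> test_functions ?B" for i \<phi>
    using G[of i] g(1)[of i] that unfolding has_weak_partial_def by fastforce
  \<comment> \<open>A weak derivative of \<open>g i\<close> is also one of the chosen
    \<open>weak_partial\<close>: both agree against all test functions, and derivatives of test
    functions are test functions.\<close>
  have Gh: "has_weak_partial ?B i (weak_partial ?B i v) (h i i)" for i
    unfolding has_weak_partial_def
  proof (intro conjI ballI)
    fix \<phi> assume \<phi>: "\<phi> \<in> test_functions ?B"
    show "(LINT x|lebesgue_on ?B. weak_partial ?B i v x * partial i \<phi> x) = - (LINT x|lebesgue_on ?B. h i i x * \<phi> x)"
      using Gg[OF partial_test_function[OF \<phi>], of i i] h(1)[of i i] \<phi> unfolding has_weak_partial_def by simp
  qed (use G h in \<open>auto simp: has_weak_partial_def\<close>)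
  have H: "has_weak_partial ?B i (weak_partial ?B i v) (weak_partial ?B i (weak_partial ?B i v))" for i
    using someI[of "has_weak_partial ?B i (weak_partial ?B i v)", OF Gh]
    by (simp only: weak_partial_def[of ?B i "weak_partial ?B i v"])
  have 1: "AE x in lborel. x \<in> cube 5 \<longrightarrow> weak_partial ?B i v x = g i x" for i
    using G[of i] g(1)[of i] Gg by (intro weak_integral_eq_imp_AE_eq) (auto simp: has_weak_partial_def)
  have 2: "AE x in lborel. x \<in> cube 5 \<longrightarrow> weak_partial ?B i (weak_partial ?B i v) x = h i i x" for i
  proof (rule weak_integral_eq_imp_AE_eq)
    fix \<phi> assume "\<phi> \<in> test_functions ?B"
    then show "(LINT x|lebesgue_on ?B. weak_partial ?B i (weak_partial ?B i v) x * \<phi> x) = (LINT x|lebesgue_on ?B. h i i x * \<phi> x)"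
      using H[of i] Gh[of i] unfolding has_weak_partial_def by fastforce
  qed (use H Gh in \<open>auto simp: has_weak_partial_def\<close>)
  show ?thesis
    by (rule that[of g "\<lambda>i. h i i"]) (rule g h 1 2)+
qed

lemma L2_loc_representative:
  assumes "f \<in> L2_loc (ball 0 8)"
  shows "\<exists>f'. f' \<in> borel_measurable borel \<and> (\<forall>x. x \<notin> cube (11/2) \<longrightarrow> f' x = 0) \<and>
     (AE x in lborel. x \<in> cube (11/2) \<longrightarrow> f' x = f x) \<and> integrable lborel (\<lambda>x. \<bar>f' x\<bar>\<^sup>2)
     \<and> f \<in> borel_measurable (lebesgue_on (cube (11/2)))"
proof -
  have f: "f \<in> borel_measurable (lebesgue_on (cube (11/2)))" "integrable (lebesgue_on (cube (11/2))) (\<lambda>x. (norm (f x))\<^sup>2)"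
    using assms cube_subset_ball unfolding L2_loc_def L2_def by (auto simp: cube_def)
  have "(\<lambda>x. indicator (cube (11/2)) x *\<^sub>R f x) \<in> borel_measurable lebesgue"
    using f(1) by (subst borel_measurable_restrict_space_iff[symmetric]) auto
  then obtain g where g: "g \<in> borel_measurable lborel" "AE x in lborel. indicator (cube (11/2)) x *\<^sub>R f x = g x"
    using completion_ex_borel_measurable_real by blast
  have [measurable]: "g \<in> borel_measurable borel" using g(1) by simp
  define f' where "f' x = indicator (cube (11/2)) x * g x" for x
  have [measurable]: "f' \<in> borel_measurable borel" unfolding f'_def by measurable
  have ae: "AE x in lborel. x \<in> cube (11/2) \<longrightarrow> f' x = f x"
    using g(2) by eventually_elim (auto simp: f'_def)
  have "integrable lebesgue (\<lambda>x. indicator (cube (11/2)) x *\<^sub>R (norm (f x))\<^sup>2)"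
    using f(2) by (subst integrable_restrict_space[symmetric]) auto
  moreover have "(\<lambda>x. \<bar>f' x\<bar>\<^sup>2) \<in> borel_measurable lebesgue" by (intro measurable_completion) simp
  moreover have "AE x in lebesgue. indicator (cube (11/2)) x *\<^sub>R (norm (f x))\<^sup>2 = \<bar>f' x\<bar>\<^sup>2"
    unfolding AE_completion_iff using ae by eventually_elim (auto simp: f'_def indicator_def)
  ultimately have "integrable lebesgue (\<lambda>x. \<bar>f' x\<bar>\<^sup>2)"
    by (rule integrable_cong_AE_imp)
  then have "integrable lborel (\<lambda>x. \<bar>f' x\<bar>\<^sup>2)" by (subst (asm) integrable_completion) auto
  then show ?thesis using ae f(1) by (intro exI[of _ f']) (auto simp: f'_def)
qed

definition L2_rep :: "(real^2 \<Rightarrow> real) \<Rightarrow> real^2 \<Rightarrow> real" where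
  "L2_rep f = (SOME f'. f' \<in> borel_measurable borel \<and> (\<forall>x. x \<notin> cube (11/2) \<longrightarrow> f' x = 0) \<and>
     (AE x in lborel. x \<in> cube (11/2) \<longrightarrow> f' x = f x) \<and> integrable lborel (\<lambda>x. \<bar>f' x\<bar>\<^sup>2)
     \<and> f \<in> borel_measurable (lebesgue_on (cube (11/2))))"

lemma L2_rep:
  assumes "f \<in> L2_loc (ball 0 8)"
  shows "L2_rep f \<in> borel_measurable borel" "x \<notin> cube (11/2) \<Longrightarrow> L2_rep f x = 0"
    "AE x in lborel. x \<in> cube (11/2) \<longrightarrow> L2_rep f x = f x" "integrable lborel (\<lambda>x. \<bar>L2_rep f x\<bar>\<^sup>2)"
    "f \<in> borel_measurable (lebesgue_on (cube (11/2)))"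
  using someI_ex[OF L2_loc_representative[OF assms], folded L2_rep_def] by simp_all

definition mollify :: "(real^2 \<Rightarrow> real) \<Rightarrow> real \<Rightarrow> real^2 \<Rightarrow> real" where
  "mollify v h x = integral (cube (11/2)) (\<lambda>t. v t * moll h (x - t))"

lemma smooth_mollify:
  assumes "continuous_on (ball 0 8) v"
  shows "smooth (mollify v h)"
  unfolding mollify_def cube_def
  using cube_subset_ball by (intro smooth_convolution smooth_moll continuous_on_subset[OF assms]) (simp add: cube_def)

text \<open>Both derivatives first fall on the kernel. The weak derivatives then take them over one
  at a time: from \<open>k2\<close> with \<open>v\<close> to \<open>k1\<close> with
  \<open>g\<close>, and on to \<open>moll h\<close> with \<open>H\<close>.\<close>

lemma partial_mollify:
  assumes v: "continuous_on (ball 0 8) v"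
    and g: "has_weak_partial (ball 0 8) i v g" and H: "has_weak_partial (ball 0 8) i g H"
    and g': "g' \<in> borel_measurable borel" "\<And>x. x \<notin> cube (11/2) \<Longrightarrow> g' x = 0"
       "AE x in lborel. x \<in> cube (11/2) \<longrightarrow> g' x = g x" "g \<in> borel_measurable (lebesgue_on (cube (11/2)))"
    and H': "H' \<in> borel_measurable borel" "\<And>x. x \<notin> cube (11/2) \<Longrightarrow> H' x = 0"
       "AE x in lborel. x \<in> cube (11/2) \<longrightarrow> H' x = H x" "H \<in> borel_measurable (lebesgue_on (cube (11/2)))"
    and h: "0 < h" "h \<le> 1/2" and x: "x \<in> cube 5"
  shows "partial i (mollify v h) x = conv g' h x"
    and "partial i (partial i (mollify v h)) x = conv H' h x"
proof -
  have cv: "continuous_on (cbox (vec (- 11/2)) (vec (11/2))) v"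
    using cube_subset_ball by (intro continuous_on_subset[OF v]) (simp add: cube_def)
  define k1 where "k1 = partial i (moll h)"
  define k2 where "k2 = partial i k1"
  have k0: "smooth (moll h)" "\<And>z. h < norm z \<Longrightarrow> moll h z = 0" using h by (auto simp: smooth_moll moll_eq_0)
  have k1: "smooth k1" "\<And>z. h < norm z \<Longrightarrow> k1 z = 0"
    using k0 partial_eq_0_outside[of h "moll h"] by (auto simp: k1_def)
  have p1: "partial i (mollify v h) = (\<lambda>x. integral (cube (11/2)) (\<lambda>t. v t * k1 (x - t)))"
    unfolding mollify_def[abs_def] cube_def k1_def using partial_convolution[OF cv k0(1)] by simp
  have p2: "partial i (partial i (mollify v h)) = (\<lambda>x. integral (cube (11/2)) (\<lambda>t. v t * k2 (x - t)))"
    unfolding p1 unfolding cube_def k2_def using partial_convolution[OF cv k1(1)] by simp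
  have leb: "integral (cube (11/2)) (\<lambda>t. v t * k (x - t)) = (LINT t|lebesgue_on (ball 0 8). v t * k (x - t))"
    if k: "smooth k" "\<And>z. h < norm z \<Longrightarrow> k z = 0" for k
  proof -
    have "continuous_on (cube (11/2)) (\<lambda>t. v t * k (x - t))"
      using cv unfolding cube_def
      by (intro continuous_intros continuous_on_compose2[OF smooth_imp_continuous_on[OF k(1), of UNIV]]) auto
    then have ai: "(\<lambda>t. v t * k (x - t)) absolutely_integrable_on cube (11/2)"
      unfolding cube_def by (rule absolutely_integrable_continuous)
    have "(LINT t|lebesgue_on (ball 0 8). v t * k (x - t)) = (LINT t|lebesgue. indicator (ball 0 8) t *\<^sub>R (v t * k (x - t)))"
      by (rule integral_restrict_space) simp
    also have "\<dots> = (LINT t:cube (11/2)|lebesgue. v t * k (x - t))"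
      unfolding set_lebesgue_integral_def
      using cube_subset_ball reflect_test_function(2)[OF k h(2) x]
      by (intro Bochner_Integration.integral_cong) (auto simp: indicator_def)
    also have "\<dots> = integral (cube (11/2)) (\<lambda>t. v t * k (x - t))"
      using ai by (rule set_lebesgue_integral_eq_integral(2))
    finally show ?thesis by simp
  qed
  have m: "(\<lambda>t. moll h (x - t)) \<in> borel_measurable borel" by measurable
  have "partial i (mollify v h) x = (LINT t|lebesgue_on (ball 0 8). v t * k1 (x - t))"
    unfolding p1 by (rule leb[OF k1])
  also have "\<dots> = (LINT t|lebesgue_on (ball 0 8). g t * moll h (x - t))"
    unfolding k1_def by (rule weak_partial_kernel[OF g k0 h(2) x])
  also have "\<dots> = conv g' h x"
    unfolding conv_def by (intro integral_lebesgue_on_eq_representative g' m reflect_test_function(2)[OF k0 h(2) x])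
  finally show "partial i (mollify v h) x = conv g' h x" .
  have k2: "smooth k2" "\<And>z. h < norm z \<Longrightarrow> k2 z = 0"
    using k1 partial_eq_0_outside[of h k1] by (auto simp: k2_def)
  have "partial i (partial i (mollify v h)) x = (LINT t|lebesgue_on (ball 0 8). v t * k2 (x - t))"
    unfolding p2 by (rule leb[OF k2])
  also have "\<dots> = (LINT t|lebesgue_on (ball 0 8). g t * k1 (x - t))"
    unfolding k2_def by (rule weak_partial_kernel[OF g k1 h(2) x])
  also have "\<dots> = (LINT t|lebesgue_on (ball 0 8). H t * moll h (x - t))"
    unfolding k1_def by (rule weak_partial_kernel[OF H k0 h(2) x])
  also have "\<dots> = conv H' h x"
    unfolding conv_def by (intro integral_lebesgue_on_eq_representative H' m reflect_test_function(2)[OF k0 h(2) x])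
  finally show "partial i (partial i (mollify v h)) x = conv H' h x" .
qed

lemma abs_mollify_le:
  assumes v: "continuous_on (ball 0 8) v" and h: "0 < h" "h \<le> 1/2" and x: "x \<in> cube 5"
    and M: "\<And>t. norm (x - t) < h \<Longrightarrow> \<bar>v t\<bar> \<le> M"
  shows "\<bar>mollify v h x\<bar> \<le> M"
proof -
  have cv: "continuous_on (cube (11/2)) v"
    using cube_subset_ball by (intro continuous_on_subset[OF v])
  have M0: "0 \<le> M" using M[of x] h by fastforce
  have cm: "continuous_on S (\<lambda>t. moll h (x - t))" for S
    by (intro continuous_on_compose2[OF smooth_imp_continuous_on[OF smooth_moll, of UNIV]] continuous_intros) auto
  have "\<bar>mollify v h x\<bar> \<le> integral (cube (11/2)) (\<lambda>t. M * moll h (x - t))"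
    unfolding mollify_def real_norm_def[symmetric]
  proof (rule integral_norm_bound_integral)
    show "(\<lambda>t. v t * moll h (x - t)) integrable_on cube (11/2)"
      using cv unfolding cube_def by (intro integrable_continuous continuous_intros cm)
    show "(\<lambda>t. M * moll h (x - t)) integrable_on cube (11/2)"
      unfolding cube_def by (intro integrable_continuous continuous_intros cm)
    fix t
    show "norm (v t * moll h (x - t)) \<le> M * moll h (x - t)"
    proof (cases "norm (x - t) < h")
      case True
      then show ?thesis using M[OF True] moll_nonneg[OF h(1)] by (simp add: abs_mult mult_right_mono)
    next
      case False
      then show ?thesis using moll_eq_0[OF h(1), of "x - t"] by simp
    qed
  qed
  also have "\<dots> = M * integral (cube (11/2)) (\<lambda>t. moll h (x - t))" by simp
  also have "integral (cube (11/2)) (\<lambda>t. moll h (x - t)) = 1"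
  proof -
    have k: "smooth (moll h)" "\<And>z. h < norm z \<Longrightarrow> moll h z = 0" using h by (auto simp: smooth_moll moll_eq_0)
    have "integral (cube (11/2)) (\<lambda>t. moll h (x - t)) = integral UNIV (\<lambda>t. moll h (x - t))"
      by (rule integral_cbox_eq_UNIV) (rule reflect_test_function(2)[OF k h(2) x])
    also have "\<dots> = (LINT t|lborel. moll h (x - t))"
      using has_integral_integral_lborel[OF integrable_moll[OF h(1), of x]] by (simp add: integral_unique)
    finally show ?thesis using integral_moll[OF h(1)] by simp
  qed
  finally show ?thesis by simp
qed

section \<open>From the weak solution to a mollified one\<close>

lemma nn_integral_smooth_cube:
  assumes F: "smooth F" "\<And>x. 0 \<le> F x"
  shows "(\<integral>\<^sup>+x. ennreal (F x) * indicator (cube d) x \<partial>lborel) = ennreal (integral (cube d) F)"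
proof -
  have si: "set_integrable lborel (cube d) F"
    unfolding set_integrable_def cube_def
    by (intro borel_integrable_compact compact_cbox smooth_imp_continuous_on F)
  have "(\<integral>\<^sup>+x. ennreal (F x) * indicator (cube d) x \<partial>lborel) = (\<integral>\<^sup>+x. ennreal (indicator (cube d) x *\<^sub>R F x) \<partial>lborel)"
    by (intro nn_integral_cong) (auto simp: indicator_def)
  also have "\<dots> = ennreal (LINT x:cube d|lborel. F x)"
    unfolding set_lebesgue_integral_def
    by (intro nn_integral_eq_integral) (use si F in \<open>auto simp: set_integrable_def\<close>)
  also have "(LINT x:cube d|lborel. F x) = integral (cube d) F"
    using si by (rule set_borel_integral_eq_integral(2))
  finally show ?thesis .
qed

lemma AE_lebesgue_on_iff_lborel:
  "S \<in> sets lebesgue \<Longrightarrow> (AE x in lebesgue_on S. P x) \<longleftrightarrow> (AE x in lborel. x \<in> S \<longrightarrow> P x)"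
  by (simp add: AE_restrict_space_iff AE_completion_iff)

lemma nn_integral_L2_norm_sq:
  fixes f :: "real^'n \<Rightarrow> 'b::euclidean_space"
  assumes "f \<in> L2 S" "S \<in> sets lebesgue"
  shows "(\<integral>\<^sup>+x. ennreal ((norm (f x))\<^sup>2) * indicator S x \<partial>lebesgue) = ennreal ((L2_norm S f)\<^sup>2)"
proof -
  have "(\<integral>\<^sup>+x. ennreal ((norm (f x))\<^sup>2) * indicator S x \<partial>lebesgue) = (\<integral>\<^sup>+x. ennreal ((norm (f x))\<^sup>2) \<partial>lebesgue_on S)"
    using assms by (simp add: nn_integral_restrict_space)
  also have "\<dots> = ennreal (LINT x|lebesgue_on S. (norm (f x))\<^sup>2)"
    using assms by (intro nn_integral_eq_integral) (auto simp: L2_def)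
  also have "(LINT x|lebesgue_on S. (norm (f x))\<^sup>2) = (L2_norm S f)\<^sup>2"
    by (simp add: L2_norm_def integral_nonneg)
  finally show ?thesis .
qed

text \<open>Numerator and denominator of \<open>drift_sq\<close> are mollified separately and yet
  have to be compared with the square of \<open>A\<close>. The numerator converges in L^2 and is
  divided by at least \<open>\<epsilon>\<^sup>2\<close>; the denominator converges almost everywhere
  along a subsequence, with a dominated quotient. The two replacements are therefore made one after
  the other.\<close>

lemma exists_good_mollification:
  fixes A :: "real^2 \<Rightarrow> real^2" and v :: "real^2 \<Rightarrow> real"
  assumes A: "A \<in> L2 (ball 0 8)" "L2_norm (ball 0 8) A \<le> K" and K: "1 \<le> K"
    and W: "v \<in> W22_loc (ball 0 8)" and cont: "continuous_on (ball 0 8) v"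
    and pde: "AE x in lebesgue_on (ball 0 8). weak_laplacian (ball 0 8) v x + A x \<bullet> weak_grad (ball 0 8) v x = 0"
    and low: "1 \<le> L2_norm (ball 0 (6/5)) (weak_grad (ball 0 8) v)"
    and \<epsilon>: "0 < \<epsilon>" and hm: "0 < hm" "hm \<le> 1/2"
  shows "\<exists>h. 0 < h \<and> h \<le> hm \<and> integral (cube 5) (drift_sq \<epsilon> (mollify v h)) \<le> 2 * K\<^sup>2
     \<and> 1/4 \<le> integral (cube 5) (\<lambda>x. (cutoff (6/5) (5/4) x)\<^sup>2 * grad_sq (mollify v h) x)"
proof -
  let ?B = "ball (0::real^2) 8"
  obtain g H where gH: "\<And>i. has_weak_partial ?B i v (g i)" "\<And>i. g i \<in> L2_loc ?B"
    "\<And>i. AE x in lborel. x \<in> cube 5 \<longrightarrow> weak_partial ?B i v x = g i x"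
    "\<And>i. has_weak_partial ?B i (g i) (H i)" "\<And>i. H i \<in> L2_loc ?B"
    "\<And>i. AE x in lborel. x \<in> cube 5 \<longrightarrow> weak_partial ?B i (weak_partial ?B i v) x = H i x"
    by (rule W22_loc_representatives[OF W]) (rule that)
  define g' where "g' i = L2_rep (g i)" for i
  note g' = L2_rep[OF gH(2), folded g'_def]
  define H' where "H' i = L2_rep (H i)" for i
  note H' = L2_rep[OF gH(5), folded H'_def]
  note [measurable] = g'(1) H'(1)
  define f where "f x = H' 1 x + H' 2 x" for x
  define U where "U x = (g' 1 x)\<^sup>2 + (g' 2 x)\<^sup>2" for x
  have [measurable]: "f \<in> borel_measurable borel" "U \<in> borel_measurable borel"
    unfolding f_def U_def by measurable
  have c5: "x \<in> cube (11/2)" "x \<in> ?B" if "x \<in> cube 5" for x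
  proof -
    show *: "x \<in> cube (11/2)" using that by (auto simp: mem_cube)
    show "x \<in> ?B" using cube_subset_ball * by blast
  qed
  have gradU: "AE x in lborel. x \<in> cube 5 \<longrightarrow> (norm (weak_grad ?B v x))\<^sup>2 = U x"
    using gH(3)[of 1] gH(3)[of 2] g'(3)[of 1] g'(3)[of 2]
  proof eventually_elim
    case (elim x)
    then show ?case using c5[of x] by (auto simp: norm_sq_2 weak_grad_def U_def)
  qed
  have bound: "AE x in lborel. x \<in> cube 5 \<longrightarrow> (f x)\<^sup>2 \<le> (norm (A x))\<^sup>2 * U x"
  proof -
    have "AE x in lborel. x \<in> ?B \<longrightarrow> weak_laplacian ?B v x + A x \<bullet> weak_grad ?B v x = 0"
      using pde by (subst (asm) AE_lebesgue_on_iff_lborel) auto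
    then show ?thesis
      using gradU gH(6)[of 1] gH(6)[of 2] H'(3)[of 1] H'(3)[of 2]
    proof eventually_elim
      case (elim x)
      show ?case
      proof
        assume x: "x \<in> cube 5"
        have "weak_laplacian ?B v x = f x"
          using elim x c5[OF x] by (simp add: weak_laplacian_def f_def sum_2)
        then have "f x = - (A x \<bullet> weak_grad ?B v x)" using elim(1) c5[OF x] by simp
        then have "(f x)\<^sup>2 = (A x \<bullet> weak_grad ?B v x)\<^sup>2" by simp
        also have "\<dots> \<le> (norm (A x) * norm (weak_grad ?B v x))\<^sup>2"
          using Cauchy_Schwarz_ineq2[of "A x" "weak_grad ?B v x"] by (simp add: abs_le_square_iff[symmetric] abs_mult)
        also have "\<dots> = (norm (A x))\<^sup>2 * U x" using elim(2) x by (simp add: power_mult_distrib)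
        finally show "(f x)\<^sup>2 \<le> (norm (A x))\<^sup>2 * U x" .
      qed
    qed
  qed
  \<comment> \<open>Exact numerator \<open>f\<close>, variable squared gradient \<open>U\<close>: at
    the true gradient the quotient is bounded by the squared norm of \<open>A\<close>, at the
    mollified one it is compared with \<open>drift_sq\<close>.\<close>
  define w where "w U x = (f x)\<^sup>2 / (U x + \<epsilon>\<^sup>2)" for U :: "real^2 \<Rightarrow> real" and x
  have den: "0 < y + \<epsilon>\<^sup>2" if "0 \<le> y" for y using that \<epsilon> by (simp add: add_nonneg_pos)
  have U0: "0 \<le> U x" for x by (simp add: U_def)
  have limit: "(\<integral>\<^sup>+x. ennreal (w U x) * indicator (cube 5) x \<partial>lborel) \<le> ennreal (K\<^sup>2)"
  proof -
    have "(\<integral>\<^sup>+x. ennreal (w U x) * indicator (cube 5) x \<partial>lborel) = (\<integral>\<^sup>+x. ennreal (w U x) * indicator (cube 5) x \<partial>lebesgue)"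
      by (simp add: nn_integral_completion)
    also have "\<dots> \<le> (\<integral>\<^sup>+x. ennreal ((norm (A x))\<^sup>2) * indicator ?B x \<partial>lebesgue)"
    proof (rule nn_integral_mono_AE, unfold AE_completion_iff, use bound in eventually_elim)
      case (elim x)
      show ?case
      proof (cases "x \<in> cube 5")
        case True
        have "(f x)\<^sup>2 \<le> (norm (A x))\<^sup>2 * (U x + \<epsilon>\<^sup>2)"
          using elim True by (simp add: distrib_left add_increasing2)
        then have "w U x \<le> (norm (A x))\<^sup>2" using den[OF U0[of x]] by (simp add: w_def divide_le_eq)
        then show ?thesis using True c5[OF True] by (simp add: ennreal_leI)
      qed simp
    qed
    also have "\<dots> = ennreal ((L2_norm ?B A)\<^sup>2)" by (rule nn_integral_L2_norm_sq[OF A(1)]) simp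
    also have "\<dots> \<le> ennreal (K\<^sup>2)"
      using A(2) by (intro ennreal_leI power_mono) (auto simp: L2_norm_def)
    finally show ?thesis .
  qed
  define err where "err f h = (\<integral>\<^sup>+x. ennreal (\<bar>conv f h x - f x\<bar>\<^sup>2) * indicator (cube 5) x \<partial>lborel)" for f h
  have "\<exists>h. 0 < h \<and> h \<le> hm \<and> (\<forall>i. err (g' i) h < ennreal (1 / real (Suc n))) \<and> (\<forall>i. err (H' i) h < ennreal (1 / real (Suc n)))" for n
  proof -
    have e: "0 < 1 / real (Suc n)" by simp
    have g: "\<exists>h0>0. \<forall>h. 0 < h \<and> h \<le> h0 \<longrightarrow> err (g' i) h < ennreal (1 / real (Suc n))" for i
      unfolding err_def by (rule conv_tendsto[OF disjI2[OF refl] g'(1) g'(4) g'(2) e])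
    have H: "\<exists>h0>0. \<forall>h. 0 < h \<and> h \<le> h0 \<longrightarrow> err (H' i) h < ennreal (1 / real (Suc n))" for i
      unfolding err_def by (rule conv_tendsto[OF disjI2[OF refl] H'(1) H'(4) H'(2) e])
    obtain a1 where a1: "a1 > 0" "\<forall>h. 0 < h \<and> h \<le> a1 \<longrightarrow> err (g' 1) h < ennreal (1 / real (Suc n))" using g by blast
    obtain a2 where a2: "a2 > 0" "\<forall>h. 0 < h \<and> h \<le> a2 \<longrightarrow> err (g' 2) h < ennreal (1 / real (Suc n))" using g by blast
    obtain b1 where b1: "b1 > 0" "\<forall>h. 0 < h \<and> h \<le> b1 \<longrightarrow> err (H' 1) h < ennreal (1 / real (Suc n))" using H by blast
    obtain b2 where b2: "b2 > 0" "\<forall>h. 0 < h \<and> h \<le> b2 \<longrightarrow> err (H' 2) h < ennreal (1 / real (Suc n))" using H by blast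
    define h where "h = min hm (min (min a1 a2) (min b1 b2))"
    have h: "0 < h" "h \<le> hm" "h \<le> a1" "h \<le> a2" "h \<le> b1" "h \<le> b2"
      using hm a1(1) a2(1) b1(1) b2(1) by (simp_all add: h_def)
    have "err (g' i) h < ennreal (1 / real (Suc n))" for i using exhaust_2[of i] a1(2) a2(2) h by blast
    moreover have "err (H' i) h < ennreal (1 / real (Suc n))" for i using exhaust_2[of i] b1(2) b2(2) h by blast
    ultimately show ?thesis using h(1,2) by blast
  qed
  then obtain h where hh: "\<And>n. 0 < h n" "\<And>n. h n \<le> hm" "\<And>n i. err (g' i) (h n) < ennreal (1 / real (Suc n))"
    "\<And>n i. err (H' i) (h n) < ennreal (1 / real (Suc n))"
    by metis
  note h = hh[unfolded err_def]
  have [measurable]: "conv (g' i) (h n) \<in> borel_measurable borel" "conv (H' i) (h n) \<in> borel_measurable borel" for i n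
    by (intro borel_measurable_conv h(1); simp)+
  define D where "D n x = (\<bar>conv (g' 1) (h n) x - g' 1 x\<bar>\<^sup>2 + \<bar>conv (g' 2) (h n) x - g' 2 x\<bar>\<^sup>2) * indicator (cube 5) x" for n x
  have [measurable]: "D n \<in> borel_measurable borel" for n unfolding D_def by measurable
  have D0: "0 \<le> D n x" for n x by (simp add: D_def)
  have Dn: "(\<integral>\<^sup>+x. ennreal (D n x) \<partial>lborel) \<le> ennreal (2 / real (Suc n))" for n
  proof -
    have "(\<integral>\<^sup>+x. ennreal (D n x) \<partial>lborel) = (\<integral>\<^sup>+x. ennreal (\<bar>conv (g' 1) (h n) x - g' 1 x\<bar>\<^sup>2) * indicator (cube 5) x
       + ennreal (\<bar>conv (g' 2) (h n) x - g' 2 x\<bar>\<^sup>2) * indicator (cube 5) x \<partial>lborel)"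
      by (intro nn_integral_cong) (auto simp: D_def indicator_def)
    also have "\<dots> = (\<integral>\<^sup>+x. ennreal (\<bar>conv (g' 1) (h n) x - g' 1 x\<bar>\<^sup>2) * indicator (cube 5) x \<partial>lborel)
      + (\<integral>\<^sup>+x. ennreal (\<bar>conv (g' 2) (h n) x - g' 2 x\<bar>\<^sup>2) * indicator (cube 5) x \<partial>lborel)"
      by (intro nn_integral_add) auto
    also have "\<dots> \<le> ennreal (1 / real (Suc n)) + ennreal (1 / real (Suc n))"
      using h(3) by (intro add_mono less_imp_le)
    also have "\<dots> = ennreal (2 / real (Suc n))" by (simp flip: ennreal_plus)
    finally show ?thesis .
  qed
  have iD: "integrable lborel (D n)" for n
    using Dn[of n] D0 by (intro integrableI_nonneg) (auto simp: le_less_trans)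
  have "(\<lambda>n. LINT x|lborel. norm (D n x)) \<longlonglongrightarrow> 0"
  proof (rule tendsto_sandwich[OF _ _ tendsto_const])
    have "(LINT x|lborel. norm (D n x)) \<le> 2 / real (Suc n)" for n
    proof -
      have "ennreal (LINT x|lborel. D n x) \<le> ennreal (2 / real (Suc n))"
        using Dn[of n] nn_integral_eq_integral[OF iD[of n]] D0 by simp
      then show ?thesis using D0 by (simp add: ennreal_le_iff)
    qed
    then show "\<forall>\<^sub>F n in sequentially. (LINT x|lborel. norm (D n x)) \<le> 2 / real (Suc n)" by simp
    show "(\<lambda>n. 2 / real (Suc n)) \<longlonglongrightarrow> 0"
      using tendsto_mult_right_zero[OF LIMSEQ_Suc[OF lim_1_over_n], of 2] by simp
  qed simp
  \<comment> \<open>L^2 convergence of the gradients is L^1 convergence of \<open>D\<close>; a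
    subsequence converges almost everywhere, as the denominators require.\<close>
  from tendsto_L1_AE_subseq[OF iD this] obtain s :: "nat \<Rightarrow> nat" where s: "strict_mono s"
    and sD: "AE x in lborel. (\<lambda>n. D (s n) x) \<longlonglongrightarrow> 0" by blast
  define V where "V n x = (conv (g' 1) (h n) x)\<^sup>2 + (conv (g' 2) (h n) x)\<^sup>2" for n x
  have V0: "0 \<le> V n x" for n x by (simp add: V_def)
  have [measurable]: "V n \<in> borel_measurable borel" for n unfolding V_def by measurable
  have iF: "(\<integral>\<^sup>+x. ennreal ((f x)\<^sup>2 / \<epsilon>\<^sup>2) \<partial>lborel) < \<infinity>"
  proof -
    have "integrable lborel (\<lambda>x. 2 / \<epsilon>\<^sup>2 * (\<bar>H' 1 x\<bar>\<^sup>2 + \<bar>H' 2 x\<bar>\<^sup>2))"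
      using H'(4) by auto
    then have "integrable lborel (\<lambda>x. (f x)\<^sup>2 / \<epsilon>\<^sup>2)"
    proof (rule Bochner_Integration.integrable_bound)
      show "AE x in lborel. norm ((f x)\<^sup>2 / \<epsilon>\<^sup>2) \<le> norm (2 / \<epsilon>\<^sup>2 * (\<bar>H' 1 x\<bar>\<^sup>2 + \<bar>H' 2 x\<bar>\<^sup>2))"
      proof (intro AE_I2)
        fix x
        have "(f x)\<^sup>2 \<le> 2 * ((H' 1 x)\<^sup>2 + (H' 2 x)\<^sup>2)"
          unfolding f_def using zero_le_power2[of "H' 1 x - H' 2 x"] by (simp add: power2_eq_square algebra_simps)
        then have "(f x)\<^sup>2 / \<epsilon>\<^sup>2 \<le> 2 * ((H' 1 x)\<^sup>2 + (H' 2 x)\<^sup>2) / \<epsilon>\<^sup>2" by (rule divide_right_mono) simp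
        then show "norm ((f x)\<^sup>2 / \<epsilon>\<^sup>2) \<le> norm (2 / \<epsilon>\<^sup>2 * (\<bar>H' 1 x\<bar>\<^sup>2 + \<bar>H' 2 x\<bar>\<^sup>2))" by simp
      qed
    qed measurable
    then show ?thesis by (simp add: integrable_iff_bounded)
  qed
  have "(\<lambda>n. \<integral>\<^sup>+x. ennreal (w (V (s n)) x) * indicator (cube 5) x \<partial>lborel) \<longlonglongrightarrow> (\<integral>\<^sup>+x. ennreal (w U x) * indicator (cube 5) x \<partial>lborel)"
  proof (rule nn_integral_dominated_convergence[where w="\<lambda>x. ennreal ((f x)\<^sup>2 / \<epsilon>\<^sup>2)"])
    show "AE x in lborel. ennreal (w (V (s j)) x) * indicator (cube 5) x \<le> ennreal ((f x)\<^sup>2 / \<epsilon>\<^sup>2)" for j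
    proof (intro AE_I2)
      fix x
      have "w (V (s j)) x \<le> (f x)\<^sup>2 / \<epsilon>\<^sup>2"
        unfolding w_def using V0[of "s j" x] \<epsilon> den[OF V0] by (intro divide_left_mono) (auto intro!: mult_pos_pos)
      then show "ennreal (w (V (s j)) x) * indicator (cube 5) x \<le> ennreal ((f x)\<^sup>2 / \<epsilon>\<^sup>2)"
        by (auto simp: indicator_def ennreal_leI)
    qed
    show "AE x in lborel. (\<lambda>n. ennreal (w (V (s n)) x) * indicator (cube 5) x) \<longlonglongrightarrow> ennreal (w U x) * indicator (cube 5) x"
      using sD
    proof eventually_elim
      case (elim x)
      show ?case
      proof (cases "x \<in> cube 5")
        case True
        have lim: "(\<lambda>n. conv (g' i) (h (s n)) x) \<longlonglongrightarrow> g' i x" for i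
        proof -
          have "(\<lambda>n. (conv (g' i) (h (s n)) x - g' i x)\<^sup>2) \<longlonglongrightarrow> 0"
          proof (rule tendsto_sandwich[OF _ _ tendsto_const elim])
            show "\<forall>\<^sub>F n in sequentially. (conv (g' i) (h (s n)) x - g' i x)\<^sup>2 \<le> D (s n) x"
              using True exhaust_2[of i] by (auto simp: D_def)
          qed simp
          from tendsto_real_sqrt[OF this] have "(\<lambda>n. conv (g' i) (h (s n)) x - g' i x) \<longlonglongrightarrow> 0"
            by (simp add: tendsto_rabs_zero_iff)
          then show ?thesis by (simp add: LIM_zero_iff)
        qed
        have "(\<lambda>n. w (V (s n)) x) \<longlonglongrightarrow> w U x"
          unfolding w_def V_def U_def using den[OF U0[of x]]
          by (intro tendsto_intros lim) (auto simp: U_def)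
        then show ?thesis using True by (simp add: tendsto_ennrealI)
      qed simp
    qed
  qed (use iF in \<open>auto simp: w_def[abs_def]\<close>)
  moreover have "(\<integral>\<^sup>+x. ennreal (w U x) * indicator (cube 5) x \<partial>lborel) < ennreal (11/10 * K\<^sup>2)"
    using limit K by (elim le_less_trans) (auto intro!: ennreal_lessI)
  ultimately have "\<forall>\<^sub>F n in sequentially. (\<integral>\<^sup>+x. ennreal (w (V (s n)) x) * indicator (cube 5) x \<partial>lborel) < ennreal (11/10 * K\<^sup>2)"
    by (rule order_tendstoD)
  \<comment> \<open>The threshold 8 makes the gradient error at most 1/4, and
    \<open>40 / \<epsilon>\<^sup>2\<close> makes the numerator error at most 1/2; both survive the
    passage to \<open>s n\<close>, which is at least \<open>n\<close>.\<close>
  moreover have "\<forall>\<^sub>F n in sequentially. max 8 (40 / \<epsilon>\<^sup>2) \<le> real n"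
    using filterlim_real_sequentially unfolding filterlim_at_top by blast
  ultimately have "\<forall>\<^sub>F n in sequentially. (\<integral>\<^sup>+x. ennreal (w (V (s n)) x) * indicator (cube 5) x \<partial>lborel) < ennreal (11/10 * K\<^sup>2) \<and> max 8 (40 / \<epsilon>\<^sup>2) \<le> real n"
    by (rule eventually_conj)
  then obtain n where n: "(\<integral>\<^sup>+x. ennreal (w (V (s n)) x) * indicator (cube 5) x \<partial>lborel) < ennreal (11/10 * K\<^sup>2)" "max 8 (40 / \<epsilon>\<^sup>2) \<le> real n"
    using eventually_happens by force
  define m where "m = s n"
  have m: "8 \<le> real (Suc m)" "40 / \<epsilon>\<^sup>2 \<le> real (Suc m)"
    using n(2) seq_suble[OF s, of n] by (auto simp: m_def)
  define \<eta> where "\<eta> = h m"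
  have \<eta>: "0 < \<eta>" "\<eta> \<le> hm" "\<eta> \<le> 1/2" using hh(1,2)[of m] hm(2) by (simp_all add: \<eta>_def)
  define vh where "vh = mollify v \<eta>"
  have svh: "smooth vh" unfolding vh_def by (rule smooth_mollify[OF cont])
  have p1: "partial i vh x = conv (g' i) \<eta> x" and p2: "partial i (partial i vh) x = conv (H' i) \<eta> x" if "x \<in> cube 5" for i x
    unfolding vh_def
    using partial_mollify[OF cont gH(1) gH(4) g'(1,2,3,5) H'(1,2,3,5) \<eta>(1,3) that] by auto
  have gV: "grad_sq vh x = V m x" if "x \<in> cube 5" for x
    using p1[OF that] by (simp add: grad_sq_def V_def \<eta>_def)
  define fl where "fl x = conv (H' 1) (h m) x + conv (H' 2) (h m) x" for x
  have lfl: "lapl vh x = fl x" if "x \<in> cube 5" for x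
    using p2[OF that] by (simp add: lapl_def fl_def \<eta>_def)
  have "ennreal (integral (cube 5) (drift_sq \<epsilon> vh)) \<le> ennreal (2 * K\<^sup>2)"
  proof -
    have sd: "smooth (drift_sq \<epsilon> vh)" "\<And>x. 0 \<le> drift_sq \<epsilon> vh x"
      using smooth_drift_sq[OF \<epsilon> svh] drift_sq_nonneg[OF \<epsilon> svh] by auto
    \<comment> \<open>From \<open>(f + d)\<^sup>2 \<le> 5/4 * f\<^sup>2 + 5 * d\<^sup>2\<close>.
      With the factor 11/10 and the error 1/2 the total stays below \<open>2 * K\<^sup>2\<close>,
      because \<open>1 \<le> K\<close>.\<close>
    have pw: "drift_sq \<epsilon> vh x \<le> 5/4 * w (V m) x + 10 / \<epsilon>\<^sup>2 * (\<bar>conv (H' 1) (h m) x - H' 1 x\<bar>\<^sup>2 + \<bar>conv (H' 2) (h m) x - H' 2 x\<bar>\<^sup>2)"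
      if x: "x \<in> cube 5" for x
    proof -
      define p q where "p = conv (H' 1) (h m) x - H' 1 x" and "q = conv (H' 2) (h m) x - H' 2 x"
      have "fl x = f x + (p + q)" by (simp add: fl_def f_def p_def q_def)
      then have "(fl x)\<^sup>2 \<le> 5/4 * (f x)\<^sup>2 + 5 * (p + q)\<^sup>2"
        using zero_le_power2[of "f x / 2 - 2 * (p + q)"] by (simp add: power2_eq_square algebra_simps)
      also have "5 * (p + q)\<^sup>2 \<le> 10 * (p\<^sup>2 + q\<^sup>2)"
        using zero_le_power2[of "p - q"] by (simp add: power2_eq_square algebra_simps)
      finally have "(fl x)\<^sup>2 \<le> 5/4 * (f x)\<^sup>2 + 10 * (p\<^sup>2 + q\<^sup>2)" by simp
      then have "drift_sq \<epsilon> vh x \<le> (5/4 * (f x)\<^sup>2 + 10 * (p\<^sup>2 + q\<^sup>2)) / (V m x + \<epsilon>\<^sup>2)"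
        unfolding drift_sq_def lfl[OF x] gV[OF x] using den[OF V0[of m x]] by (intro divide_right_mono) auto
      also have "\<dots> = 5/4 * w (V m) x + 10 * (p\<^sup>2 + q\<^sup>2) / (V m x + \<epsilon>\<^sup>2)"
        by (simp add: w_def add_divide_distrib)
      also have "10 * (p\<^sup>2 + q\<^sup>2) / (V m x + \<epsilon>\<^sup>2) \<le> 10 * (p\<^sup>2 + q\<^sup>2) / \<epsilon>\<^sup>2"
        using V0[of m x] den[OF V0[of m x]] \<epsilon> by (intro divide_left_mono) (auto intro!: mult_pos_pos)
      finally show ?thesis by (simp add: p_def q_def)
    qed
    have "ennreal (integral (cube 5) (drift_sq \<epsilon> vh)) = (\<integral>\<^sup>+x. ennreal (drift_sq \<epsilon> vh x) * indicator (cube 5) x \<partial>lborel)"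
      by (rule nn_integral_smooth_cube[OF sd, symmetric])
    also have "\<dots> \<le> (\<integral>\<^sup>+x. ennreal (5/4) * (ennreal (w (V m) x) * indicator (cube 5) x)
       + ennreal (10 / \<epsilon>\<^sup>2) * (ennreal (\<bar>conv (H' 1) (h m) x - H' 1 x\<bar>\<^sup>2) * indicator (cube 5) x
         + ennreal (\<bar>conv (H' 2) (h m) x - H' 2 x\<bar>\<^sup>2) * indicator (cube 5) x) \<partial>lborel)"
    proof (rule nn_integral_mono)
      fix x
      have w0: "0 \<le> w (V m) x" using den[OF V0[of m x]] by (simp add: w_def)
      show "ennreal (drift_sq \<epsilon> vh x) * indicator (cube 5) x \<le> ennreal (5/4) * (ennreal (w (V m) x) * indicator (cube 5) x)
       + ennreal (10 / \<epsilon>\<^sup>2) * (ennreal (\<bar>conv (H' 1) (h m) x - H' 1 x\<bar>\<^sup>2) * indicator (cube 5) x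
         + ennreal (\<bar>conv (H' 2) (h m) x - H' 2 x\<bar>\<^sup>2) * indicator (cube 5) x)"
      proof (cases "x \<in> cube 5")
        case True
        have "ennreal (drift_sq \<epsilon> vh x) \<le> ennreal (5/4 * w (V m) x + 10 / \<epsilon>\<^sup>2 * (\<bar>conv (H' 1) (h m) x - H' 1 x\<bar>\<^sup>2 + \<bar>conv (H' 2) (h m) x - H' 2 x\<bar>\<^sup>2))"
          by (intro ennreal_leI pw True)
        also have "\<dots> = ennreal (5/4) * ennreal (w (V m) x) + ennreal (10 / \<epsilon>\<^sup>2) * (ennreal (\<bar>conv (H' 1) (h m) x - H' 1 x\<bar>\<^sup>2) + ennreal (\<bar>conv (H' 2) (h m) x - H' 2 x\<bar>\<^sup>2))"
          using w0 by (simp only: ennreal_plus[symmetric] ennreal_mult[symmetric] zero_le_power2 add_nonneg_nonneg mult_nonneg_nonneg divide_nonneg_nonneg zero_le_numeral)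
        finally show ?thesis using True by simp
      qed simp
    qed
    also have "\<dots> = ennreal (5/4) * (\<integral>\<^sup>+x. ennreal (w (V m) x) * indicator (cube 5) x \<partial>lborel)
       + ennreal (10 / \<epsilon>\<^sup>2) * ((\<integral>\<^sup>+x. ennreal (\<bar>conv (H' 1) (h m) x - H' 1 x\<bar>\<^sup>2) * indicator (cube 5) x \<partial>lborel)
         + (\<integral>\<^sup>+x. ennreal (\<bar>conv (H' 2) (h m) x - H' 2 x\<bar>\<^sup>2) * indicator (cube 5) x \<partial>lborel))"
      by (simp add: nn_integral_add nn_integral_cmult w_def[abs_def])
    also have "\<dots> \<le> ennreal (5/4) * ennreal (11/10 * K\<^sup>2) + ennreal (10 / \<epsilon>\<^sup>2) * (ennreal (1 / real (Suc m)) + ennreal (1 / real (Suc m)))"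
      using n(1) h(4)[where n=m] unfolding m_def[symmetric]
      by (intro add_mono mult_left_mono) (auto simp: less_imp_le)
    also have "\<dots> = ennreal (5/4 * (11/10 * K\<^sup>2) + 10 / \<epsilon>\<^sup>2 * (1 / real (Suc m) + 1 / real (Suc m)))"
      by (simp only: ennreal_plus[symmetric] ennreal_mult[symmetric] zero_le_power2 add_nonneg_nonneg mult_nonneg_nonneg divide_nonneg_nonneg zero_le_numeral zero_le_one of_nat_0_le_iff)
    also have "\<dots> \<le> ennreal (2 * K\<^sup>2)"
    proof (rule ennreal_leI)
      have "40 / \<epsilon>\<^sup>2 * (1 / real (Suc m)) \<le> 1"
      proof -
        have "40 / \<epsilon>\<^sup>2 * (1 / real (Suc m)) \<le> real (Suc m) * (1 / real (Suc m))"
          by (intro mult_right_mono m(2)) simp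
        then show ?thesis by simp
      qed
      moreover have "10 / \<epsilon>\<^sup>2 * (y + y) = 40 / \<epsilon>\<^sup>2 * y / 2" for y by simp
      ultimately have "10 / \<epsilon>\<^sup>2 * (1 / real (Suc m) + 1 / real (Suc m)) \<le> 1/2" by simp
      moreover have "1 \<le> K\<^sup>2" using K by simp
      ultimately show "5/4 * (11/10 * K\<^sup>2) + 10 / \<epsilon>\<^sup>2 * (1 / real (Suc m) + 1 / real (Suc m)) \<le> 2 * K\<^sup>2" by linarith
    qed
    finally show ?thesis .
  qed
  then have res1: "integral (cube 5) (drift_sq \<epsilon> vh) \<le> 2 * K\<^sup>2" by (simp add: ennreal_le_iff)
  have res2: "1/4 \<le> integral (cube 5) (\<lambda>x. (cutoff (6/5) (5/4) x)\<^sup>2 * grad_sq vh x)"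
  proof -
    let ?b = "ball (0::real^2) (6/5)"
    let ?I = "integral (cube 5) (\<lambda>x. (cutoff (6/5) (5/4) x)\<^sup>2 * grad_sq vh x)"
    have sub: "x \<in> cube 5" if "x \<in> ?b" for x using that by (intro norm_le_imp_mem_cube) auto
    \<comment> \<open>The integral of a function that is not integrable is 0 by convention, so the
      lower bound \<open>low\<close> itself forces integrability.\<close>
    have intb: "integrable (lebesgue_on ?b) (\<lambda>x. (norm (weak_grad ?B v x))\<^sup>2)"
      using low not_integrable_integral_eq[of "lebesgue_on ?b" "\<lambda>x. (norm (weak_grad ?B v x))\<^sup>2"]
      by (force simp: L2_norm_def)
    have "1 \<le> (LINT x|lebesgue_on ?b. (norm (weak_grad ?B v x))\<^sup>2)"
      using low by (simp add: L2_norm_def)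
    then have "1 \<le> ennreal (LINT x|lebesgue_on ?b. (norm (weak_grad ?B v x))\<^sup>2)"
      by (metis ennreal_1 ennreal_leI)
    also have "\<dots> = (\<integral>\<^sup>+x. ennreal ((norm (weak_grad ?B v x))\<^sup>2) \<partial>lebesgue_on ?b)"
      by (intro nn_integral_eq_integral[symmetric] intb) simp
    also have "\<dots> = (\<integral>\<^sup>+x. ennreal ((norm (weak_grad ?B v x))\<^sup>2) * indicator ?b x \<partial>lebesgue)"
      by (simp add: nn_integral_restrict_space)
    also have "\<dots> = (\<integral>\<^sup>+x. ennreal (U x) * indicator ?b x \<partial>lebesgue)"
      by (rule nn_integral_cong_AE, unfold AE_completion_iff, use gradU in eventually_elim) (use sub in \<open>auto simp: indicator_def\<close>)
    also have "\<dots> = (\<integral>\<^sup>+x. ennreal (U x) * indicator ?b x \<partial>lborel)" by (simp add: nn_integral_completion)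
    \<comment> \<open>From \<open>a\<^sup>2 \<le> 2 * c\<^sup>2 + 2 * (c - a)\<^sup>2\<close>: 1 is
      at most twice the wanted integral plus 1/2, which yields 1/4.\<close>
    also have "\<dots> \<le> (\<integral>\<^sup>+x. 2 * (ennreal ((cutoff (6/5) (5/4) x)\<^sup>2 * grad_sq vh x) * indicator (cube 5) x) + 2 * ennreal (D m x) \<partial>lborel)"
    proof (rule nn_integral_mono)
      fix x
      show "ennreal (U x) * indicator ?b x \<le> 2 * (ennreal ((cutoff (6/5) (5/4) x)\<^sup>2 * grad_sq vh x) * indicator (cube 5) x) + 2 * ennreal (D m x)"
      proof (cases "x \<in> ?b")
        case True
        have x: "x \<in> cube 5" using sub True by blast
        have sq: "a\<^sup>2 \<le> 2 * c\<^sup>2 + 2 * (c - a)\<^sup>2" for a c :: real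
          using zero_le_power2[of "2 * c - a"] by (simp add: power2_eq_square algebra_simps)
        have "U x \<le> 2 * V m x + 2 * D m x"
          using sq[of "g' 1 x" "conv (g' 1) (h m) x"] sq[of "g' 2 x" "conv (g' 2) (h m) x"] x
          by (simp add: U_def V_def D_def)
        also have "V m x = (cutoff (6/5) (5/4) x)\<^sup>2 * grad_sq vh x"
          using True gV[OF x] by (simp add: cutoff_eq_1)
        finally have "ennreal (U x) \<le> ennreal (2 * ((cutoff (6/5) (5/4) x)\<^sup>2 * grad_sq vh x) + 2 * D m x)" by (rule ennreal_leI)
        also have "\<dots> = 2 * ennreal ((cutoff (6/5) (5/4) x)\<^sup>2 * grad_sq vh x) + 2 * ennreal (D m x)"
          using D0 by (simp add: ennreal_plus ennreal_mult)
        finally show ?thesis using True x by simp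
      qed simp
    qed
    also have "\<dots> = 2 * (\<integral>\<^sup>+x. ennreal ((cutoff (6/5) (5/4) x)\<^sup>2 * grad_sq vh x) * indicator (cube 5) x \<partial>lborel) + 2 * (\<integral>\<^sup>+x. ennreal (D m x) \<partial>lborel)"
    proof -
      have [measurable]: "(\<lambda>x. (cutoff (6/5) (5/4) x)\<^sup>2 * grad_sq vh x) \<in> borel_measurable borel"
        by (intro borel_measurable_smooth smooth_intros smooth_cutoff svh)
      show ?thesis by (simp add: nn_integral_add nn_integral_cmult)
    qed
    also have "(\<integral>\<^sup>+x. ennreal ((cutoff (6/5) (5/4) x)\<^sup>2 * grad_sq vh x) * indicator (cube 5) x \<partial>lborel) = ennreal ?I"
      by (rule nn_integral_smooth_cube) (intro smooth_intros smooth_cutoff svh | simp)+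
    also have "2 * ennreal ?I + 2 * (\<integral>\<^sup>+x. ennreal (D m x) \<partial>lborel) \<le> 2 * ennreal ?I + 2 * ennreal (1/4)"
    proof (intro add_left_mono mult_left_mono order_trans[OF Dn] ennreal_leI)
      show "2 / real (Suc m) \<le> 1/4" using m(1) by (simp add: field_simps)
    qed simp
    also have "\<dots> = ennreal (2 * ?I + 2 * (1/4))"
    proof -
      have "0 \<le> ?I" by (intro integral_nonneg smooth_integrable_cube smooth_intros smooth_cutoff svh) simp
      moreover have "2 * ennreal a = ennreal (2 * a)" if "0 \<le> a" for a
        using ennreal_mult[of 2 a] that by simp
      ultimately show ?thesis by (simp only: ennreal_plus[symmetric] mult_nonneg_nonneg zero_le_numeral zero_le_divide_1_iff)
    qed
    finally have "ennreal 1 \<le> ennreal (2 * ?I + 2 * (1/4))" unfolding ennreal_1 .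
    moreover have "0 \<le> ?I" by (intro integral_nonneg smooth_integrable_cube smooth_intros smooth_cutoff svh) simp
    ultimately have "1 \<le> 2 * ?I + 2 * (1/4)" by (subst (asm) ennreal_le_iff) auto
    then show ?thesis by simp
  qed
  show ?thesis using \<eta> res1 res2 unfolding vh_def by blast
qed

section \<open>Conclusion for weak solutions\<close>

lemma continuous_le_of_AE:
  fixes v :: "'a::euclidean_space \<Rightarrow> real"
  assumes "continuous_on S v" "open S" "AE x in lebesgue_on S. \<bar>v x\<bar> \<le> M" "x \<in> S"
  shows "\<bar>v x\<bar> \<le> M"
proof (rule ccontr)
  assume nx: "\<not> \<bar>v x\<bar> \<le> M"
  let ?T = "S \<inter> (\<lambda>x. \<bar>v x\<bar>) -` {M<..}"
  have "open ?T" by (intro continuous_open_preimage continuous_intros assms)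
  moreover have "?T \<noteq> {}" using nx assms(4) by auto
  ultimately have "\<not> negligible ?T" by (rule open_not_negligible)
  moreover have "?T \<in> null_sets lebesgue"
  proof -
    have "AE x in lebesgue. x \<in> S \<longrightarrow> \<bar>v x\<bar> \<le> M"
      using assms(2,3) by (subst (asm) AE_restrict_space_iff) auto
    then have "AE x in lebesgue. x \<notin> ?T" by eventually_elim auto
    then show ?thesis using \<open>open ?T\<close> by (subst (asm) AE_iff_null_sets[symmetric]) auto
  qed
  ultimately show False by (simp add: negligible_iff_null_sets)
qed

text \<open>By contradiction: a real \<open>M \<ge> 0\<close> strictly between the essential
  supremum and \<open>m\<close> bounds \<open>v\<close> on the ball by continuity, hence a
  mollification on the ball of half the radius, and \<open>lower_bound_at\<close> gives
  \<open>m \<le> M\<close>.\<close>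

lemma Linf_norm_ge_of_lower_bound_at:
  fixes A :: "real^2 \<Rightarrow> real^2" and v :: "real^2 \<Rightarrow> real"
  assumes A: "A \<in> L2 (ball 0 8)" "L2_norm (ball 0 8) A \<le> K" and K: "1 \<le> K"
    and W: "v \<in> W22_loc (ball 0 8)" and cont: "continuous_on (ball 0 8) v"
    and pde: "AE x in lebesgue_on (ball 0 8). weak_laplacian (ball 0 8) v x + A x \<bullet> weak_grad (ball 0 8) v x = 0"
    and vC0: "\<forall>z\<in>ball 0 8. \<bar>v z\<bar> \<le> C0"
    and low: "1 \<le> L2_norm (ball 0 (6/5)) (weak_grad (ball 0 8) v)"
    and r: "0 < r" "r < 1" and \<epsilon>: "0 < \<epsilon>" and bound: "lower_bound_at r \<epsilon> C0 K m" and m: "0 < m"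
  shows "ereal m \<le> Linf_norm (ball 0 r) v"
proof (rule ccontr)
  assume "\<not> ?thesis"
  then have "max 0 (Linf_norm (ball 0 r) v) < ereal m"
    using m by simp
  then obtain M where M: "max 0 (Linf_norm (ball 0 r) v) < ereal M" "ereal M < ereal m"
    using ereal_dense2 by blast
  have M0: "0 \<le> M" using M(1) by simp
  have "AE x in lebesgue_on (ball 0 r). ereal \<bar>v x\<bar> \<le> Linf_norm (ball 0 r) v"
    unfolding Linf_norm_def by (rule esssup_AE)
  then have "AE x in lebesgue_on (ball 0 r). \<bar>v x\<bar> \<le> M"
  proof eventually_elim
    case (elim x)
    have "Linf_norm (ball 0 r) v \<le> ereal M" using M(1) by (simp add: less_imp_le)
    with elim have "ereal \<bar>v x\<bar> \<le> ereal M" by (rule order_trans)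
    then show ?case by simp
  qed
  then have vM: "\<bar>v x\<bar> \<le> M" if "norm x < r" for x
    using that r by (intro continuous_le_of_AE[of "ball 0 r"] continuous_on_subset[OF cont]) auto
  have hm: "0 < r/2" "r/2 \<le> 1/2" using r by auto
  obtain h where h: "0 < h" "h \<le> r/2" "integral (cube 5) (drift_sq \<epsilon> (mollify v h)) \<le> 2 * K\<^sup>2"
    "1/4 \<le> integral (cube 5) (\<lambda>x. (cutoff (6/5) (5/4) x)\<^sup>2 * grad_sq (mollify v h) x)"
    using exists_good_mollification[OF A K W cont pde low \<epsilon> hm] by blast
  have h2: "h \<le> 1/2" using h hm by linarith
  have tri: "norm t < norm x + h" if "norm (x - t) < h" for x t :: "real^2"
    using that norm_triangle_sub[of t x] by (simp add: norm_minus_commute)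
  have "m \<le> M"
  proof (rule mp[OF spec[OF spec[OF bound[unfolded lower_bound_at_def], of "mollify v h"], of M]], intro conjI allI impI smooth_mollify[OF cont] h(3) M0 h(4))
    show "\<bar>mollify v h x\<bar> \<le> C0" if "norm x \<le> 24/5" for x
    proof (rule abs_mollify_le[OF cont h(1) h2])
      show "x \<in> cube 5" using that by (intro norm_le_imp_mem_cube) simp
      show "\<bar>v t\<bar> \<le> C0" if "norm (x - t) < h" for t
        using vC0 tri[OF that] \<open>norm x \<le> 24/5\<close> h2 by force
    qed
    show "\<bar>mollify v h x\<bar> \<le> M" if "norm x \<le> r/2" for x
    proof (rule abs_mollify_le[OF cont h(1) h2])
      show "x \<in> cube 5" using that hm by (intro norm_le_imp_mem_cube) simp
      show "\<bar>v t\<bar> \<le> M" if "norm (x - t) < h" for t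
        using tri[OF that] \<open>norm x \<le> r/2\<close> h(2) by (intro vM) linarith
    qed
  qed
  then show False using M(2) by simp
qed

theorem theorem3p1:
  shows "\<exists>C2::real. C2 > 0 \<and>
    (\<forall>C0::real. C0 > 0 \<longrightarrow> (\<exists>C1::real. C1 > 0 \<and>
      (\<forall>K::real. K \<ge> 1 \<longrightarrow> (\<exists>r0::real. 0 < r0 \<and> r0 < 1 \<and>
        (\<forall>(A :: real^2 \<Rightarrow> real^2) (v :: real^2 \<Rightarrow> real).
           A \<in> L2 (ball 0 8) \<longrightarrow>
           L2_norm (ball 0 8) A \<le> K \<longrightarrow>
           v \<in> W22_loc (ball 0 8) \<longrightarrow>
           continuous_on (ball 0 8) v \<longrightarrow>
           (AE x in lebesgue_on (ball 0 8).
              weak_laplacian (ball 0 8) v x + A x \<bullet> weak_grad (ball 0 8) v x = 0) \<longrightarrow>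
           (\<forall>z\<in>ball 0 8. \<bar>v z\<bar> \<le> C0) \<longrightarrow>
           L2_norm (ball 0 (6/5)) (weak_grad (ball 0 8) v) \<ge> 1 \<longrightarrow>
           (\<forall>r. 0 < r \<and> r \<le> r0 \<longrightarrow>
              Linf_norm (ball 0 r) v \<ge> ereal (r powr (C1 + C2 * K\<^sup>2))))))))"
proof -
  \<comment> \<open>Choice functions record the dependencies: \<open>C1\<close> on
    \<open>C0\<close>, and \<open>r0\<close> on \<open>C0\<close> and \<open>K\<close>, both
    obtained before \<open>A\<close> and \<open>v\<close> are introduced.\<close>
  obtain C2 :: real and C1 :: "real \<Rightarrow> real" and r0 :: "real \<Rightarrow> real \<Rightarrow> real" where C2: "C2 > 0"
    and C1: "\<And>C0. C0 > 0 \<Longrightarrow> C1 C0 > 0"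
    and r0: "\<And>C0 K. C0 > 0 \<Longrightarrow> K \<ge> 1 \<Longrightarrow> 0 < r0 C0 K \<and> r0 C0 K < 1"
    and bound: "\<And>C0 K r. C0 > 0 \<Longrightarrow> K \<ge> 1 \<Longrightarrow> 0 < r \<Longrightarrow> r \<le> r0 C0 K \<Longrightarrow>
      \<exists>\<epsilon>>0. lower_bound_at r \<epsilon> C0 K (r powr (C1 C0 + C2 * K\<^sup>2))"
    using vanishing_order_smooth by metis
  have "ereal (r powr (C1 C0 + C2 * K\<^sup>2)) \<le> Linf_norm (ball 0 r) v"
    if "C0 > 0" "K \<ge> 1" "A \<in> L2 (ball 0 8)" "L2_norm (ball 0 8) A \<le> K"
      "v \<in> W22_loc (ball 0 8)" "continuous_on (ball 0 8) v"
      "AE x in lebesgue_on (ball 0 8). weak_laplacian (ball 0 8) v x + A x \<bullet> weak_grad (ball 0 8) v x = 0"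
      "\<forall>z\<in>ball 0 8. \<bar>v z\<bar> \<le> C0" "L2_norm (ball 0 (6/5)) (weak_grad (ball 0 8) v) \<ge> 1" "0 < r" "r \<le> r0 C0 K"
    for C0 K r and A :: "real^2 \<Rightarrow> real^2" and v
  proof -
    from bound[OF that(1,2,10,11)] obtain \<epsilon> where "\<epsilon> > 0" "lower_bound_at r \<epsilon> C0 K (r powr (C1 C0 + C2 * K\<^sup>2))"
      by blast
    then show ?thesis
      using that r0[of C0 K] by (intro Linf_norm_ge_of_lower_bound_at) auto
  qed
  note main = this
  show ?thesis
    by (rule exI[of _ C2], intro conjI C2 allI impI, rule_tac x="C1 C0" in exI,
        intro conjI C1 allI impI, assumption, rule_tac x="r0 C0 K" in exI,
        intro conjI allI impI, simp add: r0, simp add: r0, elim conjE, rule main)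
qed

end
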